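(* For every integer $m\ge 1$, the projective Auslander algebra of $\mathrm{Rep}(K_m)$ is isomorphic, as a $\mathbb{C}$-algebra, to the Nichols Hopf algebra $K_m$.
   Context: All algebras and modules are finite-dimensional over $\mathbb{C}$. The Nichols Hopf algebra $K_m$ is the $2^{m+1}$-dimensional $\mathbb{C}$-algebra generated by $K,\xi_1,\dots,\xi_m$ with relations $K^2=1$, $\xi_i^2=0$, $K\xi_i=-\xi_iK$, $\xi_i\xi_j=-\xi_j\xi_i$ ($i\ne j$), with Hopf structure $\Delta(K)=K\otimes K$, $\Delta(\xi_i)=K\otimes\xi_i+\xi_i\otimes 1$, $\epsilon(K)=1$, $\epsilon(\xi_i)=0$, $S(K)=K$, $S(\xi_i)=-K\xi_i$. $\mathrm{Rep}(K_m)$ is the category of finite-dimensional $K_m$-modules; it has exactly two simple modules $V(0),V(1)$ up to isomorphism (one-dimensional, with $K$ acting on $V(r)$ by $(-1)^r$ and every $\xi_i$ acting by $0$), with projective covers $P(0),P(1)$. For a finite tensor category $\mathcal{C}$ with a full list $\{P_i\}_{i\in I}$ of representatives of isomorphism classes of indecomposable projective objects, the projective Auslander algebra of $\mathcal C$ is $A_{\mathcal{C}}=\mathrm{Hom}(P,P)$ with $P=\bigoplus_{i\in I}P_i$, with multiplication given by composition. For $\mathrm{Rep}(K_m)$ this is $\mathrm{End}_{K_m}(P(0)\oplus P(1))$. *)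

theory Defs
  imports "HOL-Algebra.QuotRing" "HOL-Algebra.Module" "HOL-Library.Poly_Mapping" Complex_Main
begin

section \<open>Free algebras and presentations\<close>

text \<open>
  Words under concatenation, as an additive monoid, so that finitely supported functions
  from words to the complex numbers carry the convolution product of the free algebra.
\<close>

datatype 'g word = Word (letters: "'g list")

instantiation word :: (type) monoid_add
begin

definition zero_word :: "'a word" where "0 = Word []"

definition plus_word :: "'a word \<Rightarrow> 'a word \<Rightarrow> 'a word" where
  "u + v = Word (letters u @ letters v)"

instance
  by standard (simp_all add: zero_word_def plus_word_def)

end

text \<open>
  Complex algebras are records of type \<open>(complex, 'a) module\<close>: a ring together with a
  scalar multiplication by complex numbers.
\<close>

definition free_alg :: "'g set \<Rightarrow> (complex, 'g word \<Rightarrow>\<^sub>0 complex) module" where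
  "free_alg S =
    \<lparr>carrier = {p. \<forall>w\<in>Poly_Mapping.keys p. set (letters w) \<subseteq> S},
     mult = (*), one = 1, zero = 0, add = (+),
     smult = (\<lambda>c p. Poly_Mapping.single 0 c * p)\<rparr>"

abbreviation gen :: "'g \<Rightarrow> 'g word \<Rightarrow>\<^sub>0 complex" where
  "gen x \<equiv> Poly_Mapping.single (Word [x]) 1"

text \<open>
  The ring structure is that of the library's quotient ring; as there, the operation on cosets
  is given by the union over all representatives.
\<close>

definition quot_alg :: "(complex, 'a) module \<Rightarrow> 'a set \<Rightarrow> (complex, 'a set) module" where
  "quot_alg A I =
    \<lparr>carrier = carrier (A Quot I), mult = monoid.mult (A Quot I), one = one (A Quot I),
     zero = zero (A Quot I), add = add (A Quot I),
     smult = (\<lambda>c C. \<Union>x\<in>C. I +>\<^bsub>A\<^esub> (c \<odot>\<^bsub>A\<^esub> x))\<rparr>"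

definition alg_iso :: "(complex, 'a) module \<Rightarrow> (complex, 'b) module \<Rightarrow> bool" where
  "alg_iso A B \<longleftrightarrow>
    (\<exists>h\<in>ring_iso A B. \<forall>c. \<forall>x\<in>carrier A. h (c \<odot>\<^bsub>A\<^esub> x) = c \<odot>\<^bsub>B\<^esub> h x)"


section \<open>The algebra underlying the Nichols Hopf algebra\<close>

datatype nichols_gen = GK | GXi nat

definition nichols_gens :: "nat \<Rightarrow> nichols_gen set" where
  "nichols_gens m = insert GK (GXi ` {1..m})"

definition nichols_rels :: "nat \<Rightarrow> (nichols_gen word \<Rightarrow>\<^sub>0 complex) set" where
  "nichols_rels m =
     {gen GK * gen GK - 1}
     \<union> {gen (GXi i) * gen (GXi i) | i. i \<in> {1..m}}
     \<union> {gen GK * gen (GXi i) + gen (GXi i) * gen GK | i. i \<in> {1..m}}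
     \<union> {gen (GXi i) * gen (GXi j) + gen (GXi j) * gen (GXi i) | i j.
          i \<in> {1..m} \<and> j \<in> {1..m} \<and> i \<noteq> j}"

definition nichols :: "nat \<Rightarrow> (complex, (nichols_gen word \<Rightarrow>\<^sub>0 complex) set) module" where
  "nichols m =
    (let F = free_alg (nichols_gens m) in quot_alg F (genideal F (nichols_rels m)))"


section \<open>Finite-dimensional modules over a complex algebra\<close>

text \<open>
  The library's locale \<open>module\<close> is restricted to commutative base rings. As there, only the
  additive group and the scalar multiplication of the record \<open>M\<close> matter; its fields
  \<open>mult\<close> and \<open>one\<close> are never used.
\<close>

locale left_module = A?: ring A + M?: abelian_group M
  for A :: "(complex, 'a) module" and M :: "('a, 'v) module" +
  assumes act_closed:
      "\<lbrakk>a \<in> carrier A; x \<in> carrier M\<rbrakk> \<Longrightarrow> a \<odot>\<^bsub>M\<^esub> x \<in> carrier M"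
    and act_l_distr:
      "\<lbrakk>a \<in> carrier A; b \<in> carrier A; x \<in> carrier M\<rbrakk> \<Longrightarrow>
       (a \<oplus>\<^bsub>A\<^esub> b) \<odot>\<^bsub>M\<^esub> x = a \<odot>\<^bsub>M\<^esub> x \<oplus>\<^bsub>M\<^esub> b \<odot>\<^bsub>M\<^esub> x"
    and act_r_distr:
      "\<lbrakk>a \<in> carrier A; x \<in> carrier M; y \<in> carrier M\<rbrakk> \<Longrightarrow>
       a \<odot>\<^bsub>M\<^esub> (x \<oplus>\<^bsub>M\<^esub> y) = a \<odot>\<^bsub>M\<^esub> x \<oplus>\<^bsub>M\<^esub> a \<odot>\<^bsub>M\<^esub> y"
    and act_assoc:
      "\<lbrakk>a \<in> carrier A; b \<in> carrier A; x \<in> carrier M\<rbrakk> \<Longrightarrow>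
       (a \<otimes>\<^bsub>A\<^esub> b) \<odot>\<^bsub>M\<^esub> x = a \<odot>\<^bsub>M\<^esub> (b \<odot>\<^bsub>M\<^esub> x)"
    and act_one:
      "x \<in> carrier M \<Longrightarrow> \<one>\<^bsub>A\<^esub> \<odot>\<^bsub>M\<^esub> x = x"

text \<open>The complex vector space structure of an \<open>A\<close>-module is induced by the unit of \<open>A\<close>.\<close>

definition scal :: "(complex, 'a) module \<Rightarrow> ('a, 'v) module \<Rightarrow> complex \<Rightarrow> 'v \<Rightarrow> 'v" where
  "scal A M c x = (c \<odot>\<^bsub>A\<^esub> \<one>\<^bsub>A\<^esub>) \<odot>\<^bsub>M\<^esub> x"

definition fin_dim :: "(complex, 'a) module \<Rightarrow> ('a, 'v) module \<Rightarrow> bool" where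
  "fin_dim A M \<longleftrightarrow>
    (\<exists>S. finite S \<and> S \<subseteq> carrier M \<and>
      (\<forall>x\<in>carrier M. \<exists>c. x = (\<Oplus>\<^bsub>M\<^esub>s\<in>S. scal A M (c s) s)))"

text \<open>
  The objects of the category of finite-dimensional modules have carriers in the fixed type
  \<open>nat \<Rightarrow> complex\<close>. Neither the carrier nor the operations need be related to the
  pointwise structure of that type; as every finite-dimensional complex vector space is in
  bijection with a subset of it, every finite-dimensional module is isomorphic to such an object.
\<close>

type_synonym 'a rep = "('a, nat \<Rightarrow> complex) module"

definition Rep :: "(complex, 'a) module \<Rightarrow> 'a rep set" where
  "Rep A = {M. left_module A M \<and> fin_dim A M}"

text \<open>
  Homomorphisms are extensional functions, so that equality of homomorphisms is equality
  on the carrier.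
\<close>

definition mod_hom ::
    "(complex, 'a) module \<Rightarrow> ('a, 'v) module \<Rightarrow> ('a, 'w) module \<Rightarrow> ('v \<Rightarrow> 'w) set" where
  "mod_hom A M N =
    {f \<in> carrier M \<rightarrow>\<^sub>E carrier N.
      (\<forall>x\<in>carrier M. \<forall>y\<in>carrier M. f (x \<oplus>\<^bsub>M\<^esub> y) = f x \<oplus>\<^bsub>N\<^esub> f y) \<and>
      (\<forall>a\<in>carrier A. \<forall>x\<in>carrier M. f (a \<odot>\<^bsub>M\<^esub> x) = a \<odot>\<^bsub>N\<^esub> f x)}"

definition mod_iso ::
    "(complex, 'a) module \<Rightarrow> ('a, 'v) module \<Rightarrow> ('a, 'w) module \<Rightarrow> bool" where
  "mod_iso A M N \<longleftrightarrow> (\<exists>f\<in>mod_hom A M N. bij_betw f (carrier M) (carrier N))"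

definition direct_sum :: "('a, 'v) module list \<Rightarrow> ('a, nat \<Rightarrow> 'v) module" where
  "direct_sum Ms =
    \<lparr>carrier = (\<Pi>\<^sub>E i\<in>{..<length Ms}. carrier (Ms ! i)),
     mult = undefined, one = undefined,
     zero = (\<lambda>i\<in>{..<length Ms}. \<zero>\<^bsub>Ms ! i\<^esub>),
     add = (\<lambda>x y. \<lambda>i\<in>{..<length Ms}. x i \<oplus>\<^bsub>Ms ! i\<^esub> y i),
     smult = (\<lambda>a x. \<lambda>i\<in>{..<length Ms}. a \<odot>\<^bsub>Ms ! i\<^esub> x i)\<rparr>"

definition End_alg ::
    "(complex, 'a) module \<Rightarrow> ('a, 'v) module \<Rightarrow> (complex, 'v \<Rightarrow> 'v) module" where
  "End_alg A M =
    \<lparr>carrier = mod_hom A M M,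
     mult = (\<lambda>f g. compose (carrier M) f g),
     one = (\<lambda>x\<in>carrier M. x),
     zero = (\<lambda>x\<in>carrier M. \<zero>\<^bsub>M\<^esub>),
     add = (\<lambda>f g. \<lambda>x\<in>carrier M. f x \<oplus>\<^bsub>M\<^esub> g x),
     smult = (\<lambda>c f. \<lambda>x\<in>carrier M. scal A M c (f x))\<rparr>"


section \<open>Projective Auslander algebras\<close>

definition projective :: "(complex, 'a) module \<Rightarrow> 'a rep \<Rightarrow> bool" where
  "projective A P \<longleftrightarrow>
    P \<in> Rep A \<and>
    (\<forall>M\<in>Rep A. \<forall>N\<in>Rep A. \<forall>g\<in>mod_hom A M N. \<forall>f\<in>mod_hom A P N.
      g ` carrier M = carrier N \<longrightarrow>
      (\<exists>h\<in>mod_hom A P M. compose (carrier P) g h = f))"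

definition zero_module :: "('a, 'v) module \<Rightarrow> bool" where
  "zero_module M \<longleftrightarrow> carrier M = {\<zero>\<^bsub>M\<^esub>}"

definition indecomposable :: "(complex, 'a) module \<Rightarrow> 'a rep \<Rightarrow> bool" where
  "indecomposable A P \<longleftrightarrow>
    P \<in> Rep A \<and> \<not> zero_module P \<and>
    (\<forall>M\<in>Rep A. \<forall>N\<in>Rep A. mod_iso A P (direct_sum [M, N]) \<longrightarrow>
      zero_module M \<or> zero_module N)"

definition full_list_indec_proj :: "(complex, 'a) module \<Rightarrow> 'a rep list \<Rightarrow> bool" where
  "full_list_indec_proj A Ps \<longleftrightarrow>
    (\<forall>P\<in>set Ps. projective A P \<and> indecomposable A P) \<and>
    (\<forall>i<length Ps. \<forall>j<length Ps. i \<noteq> j \<longrightarrow> \<not> mod_iso A (Ps ! i) (Ps ! j)) \<and>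
    (\<forall>Q. projective A Q \<and> indecomposable A Q \<longrightarrow> (\<exists>P\<in>set Ps. mod_iso A Q P))"

definition proj_auslander_alg ::
    "(complex, 'a) module \<Rightarrow> 'a rep list \<Rightarrow> (complex, (nat \<Rightarrow> nat \<Rightarrow> complex) \<Rightarrow> (nat \<Rightarrow> nat \<Rightarrow> complex)) module" where
  "proj_auslander_alg A Ps = End_alg A (direct_sum Ps)"

end

(*
The proof isolates what matters about K_m: the idempotents (1 + K)/2 and (1 - K)/2, with sum 1, and
the two characters killing every xi_i.  Filtering by the number of xi_i in a word makes the common
kernel of the characters nilpotent, so each corner ring e A e is local.  For such an algebra A, the
indecomposable projectives are A e_0 and A e_1: a projective Q maps onto a simple module, the lift
of this map to A e_r splits, and indecomposability makes it an isomorphism.  Hence the direct sum of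
a full list is free of rank one, and its endomorphism algebra is the opposite algebra of A.  Since
the defining relations of K_m are invariant under reversing words, K_m is isomorphic to its opposite.
*)
theory Submission
  imports Defs
begin

section \<open>Modules over a complex algebra\<close>

text \<open>Objects of \<open>Rep A\<close> have carriers in
  \<open>nat \<Rightarrow> complex\<close>, and projectivity and indecomposability are tested
  against such objects only. The left ideals \<open>A e r\<close> live on the type of
  \<open>A\<close>, so they are copied into that type by an injective coding, with the operations
  transported along it.

  The characters take over the role of radical theory. An element of \<open>e r A e r\<close> on
  which \<open>chi r\<close> does not vanish is inverted there by a finite geometric series. This
  one fact gives the indecomposability of \<open>A e r\<close>, a homomorphism from any nonzero
  module onto a simple one, and the splitting of the lift. Nonvanishing, for instance of
  \<open>e r\<close>, is also read off from the characters. They are defined on the free algebra and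
  descend to the quotient, while words enter through spanning statements.

  A full list comes with unknown length and order. Both the number of its entries and their matching
  with the two idempotents have to be derived before the direct sum can be recognised.\<close>

context left_module
begin

lemma zero_act: "x \<in> carrier M \<Longrightarrow> \<zero>\<^bsub>A\<^esub> \<odot>\<^bsub>M\<^esub> x = \<zero>\<^bsub>M\<^esub>"
  by (metis A.l_zero A.zero_closed M.add.r_cancel_one' act_closed act_l_distr)

lemma act_zero: "a \<in> carrier A \<Longrightarrow> a \<odot>\<^bsub>M\<^esub> \<zero>\<^bsub>M\<^esub> = \<zero>\<^bsub>M\<^esub>"
  by (metis M.l_zero M.zero_closed M.add.r_cancel_one' act_closed act_r_distr)

lemma minus_act:
  assumes "a \<in> carrier A" "x \<in> carrier M"
  shows "(\<ominus>\<^bsub>A\<^esub> a) \<odot>\<^bsub>M\<^esub> x = \<ominus>\<^bsub>M\<^esub> (a \<odot>\<^bsub>M\<^esub> x)"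
  using assms
  by (metis A.a_inv_closed A.l_neg M.minus_equality act_closed act_l_distr zero_act)

lemma diff_act:
  assumes "a \<in> carrier A" "b \<in> carrier A" "x \<in> carrier M"
  shows "(a \<ominus>\<^bsub>A\<^esub> b) \<odot>\<^bsub>M\<^esub> x = a \<odot>\<^bsub>M\<^esub> x \<ominus>\<^bsub>M\<^esub> b \<odot>\<^bsub>M\<^esub> x"
  using assms by (simp add: a_minus_def act_l_distr minus_act)

lemma eq_if_diff_zero:
  assumes "x \<in> carrier M" "y \<in> carrier M" "x \<ominus>\<^bsub>M\<^esub> y = \<zero>\<^bsub>M\<^esub>"
  shows "x = y"
  using assms M.minus_equality[of x "\<ominus>\<^bsub>M\<^esub> y"] by (simp add: a_minus_def)

text \<open>Closure under negation comes from the action: the negative of \<open>x\<close> is the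
  negative of the unit acting on \<open>x\<close>.\<close>

lemma left_module_submodule:
  assumes sub: "N \<subseteq> carrier M" and "\<zero>\<^bsub>M\<^esub> \<in> N"
    and add: "\<And>x y. x \<in> N \<Longrightarrow> y \<in> N \<Longrightarrow> x \<oplus>\<^bsub>M\<^esub> y \<in> N"
    and act: "\<And>a x. a \<in> carrier A \<Longrightarrow> x \<in> N \<Longrightarrow> a \<odot>\<^bsub>M\<^esub> x \<in> N"
  shows "left_module A (M\<lparr>carrier := N\<rparr>)"
proof -
  have c: "x \<in> carrier M" if "x \<in> N" for x using that sub by auto
  have neg: "\<exists>y\<in>N. y \<oplus>\<^bsub>M\<^esub> x = \<zero>\<^bsub>M\<^esub>" if "x \<in> N" for x
  proof (rule bexI)
    show "\<ominus>\<^bsub>M\<^esub> x \<oplus>\<^bsub>M\<^esub> x = \<zero>\<^bsub>M\<^esub>" using that c by (simp add: M.l_neg)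
    show "\<ominus>\<^bsub>M\<^esub> x \<in> N"
      using act[of "\<ominus>\<^bsub>A\<^esub> \<one>\<^bsub>A\<^esub>" x] that c by (simp add: minus_act act_one)
  qed
  interpret N: abelian_group "M\<lparr>carrier := N\<rparr>"
    by (rule abelian_groupI) (use assms neg c in \<open>auto simp: M.a_ac\<close>)
  show ?thesis
    by unfold_locales
      (use c act in \<open>auto simp: act_l_distr act_r_distr act_assoc act_one\<close>)
qed

end

lemma mod_homI:
  assumes "\<And>x. x \<in> carrier M \<Longrightarrow> f x \<in> carrier N"
    and "\<And>x. x \<notin> carrier M \<Longrightarrow> f x = undefined"
    and "\<And>x y. x \<in> carrier M \<Longrightarrow> y \<in> carrier M \<Longrightarrow> f (x \<oplus>\<^bsub>M\<^esub> y) = f x \<oplus>\<^bsub>N\<^esub> f y"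
    and "\<And>a x. a \<in> carrier A \<Longrightarrow> x \<in> carrier M \<Longrightarrow> f (a \<odot>\<^bsub>M\<^esub> x) = a \<odot>\<^bsub>N\<^esub> f x"
  shows "f \<in> mod_hom A M N"
  using assms unfolding mod_hom_def by (auto simp: PiE_def extensional_def)

lemma mod_hom_closed: "f \<in> mod_hom A M N \<Longrightarrow> x \<in> carrier M \<Longrightarrow> f x \<in> carrier N"
  unfolding mod_hom_def by auto

lemma mod_hom_add:
  "f \<in> mod_hom A M N \<Longrightarrow> x \<in> carrier M \<Longrightarrow> y \<in> carrier M \<Longrightarrow> f (x \<oplus>\<^bsub>M\<^esub> y) = f x \<oplus>\<^bsub>N\<^esub> f y"
  unfolding mod_hom_def by auto

lemma mod_hom_act:
  "f \<in> mod_hom A M N \<Longrightarrow> a \<in> carrier A \<Longrightarrow> x \<in> carrier M \<Longrightarrow> f (a \<odot>\<^bsub>M\<^esub> x) = a \<odot>\<^bsub>N\<^esub> f x"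
  unfolding mod_hom_def by auto

lemma mod_hom_eqI:
  assumes "f \<in> mod_hom A M N" "g \<in> mod_hom A M N" "\<And>x. x \<in> carrier M \<Longrightarrow> f x = g x"
  shows "f = g"
proof
  fix x show "f x = g x"
    using assms by (cases "x \<in> carrier M") (auto simp: mod_hom_def PiE_def extensional_def)
qed

lemma mod_hom_zero:
  assumes "left_module A M" "left_module A N" "f \<in> mod_hom A M N"
  shows "f \<zero>\<^bsub>M\<^esub> = \<zero>\<^bsub>N\<^esub>"
proof -
  interpret M: left_module A M by fact
  interpret N: left_module A N by fact
  show ?thesis
    using mod_hom_act[OF assms(3), of "\<zero>\<^bsub>A\<^esub>" "\<zero>\<^bsub>M\<^esub>"] mod_hom_closed[OF assms(3), of "\<zero>\<^bsub>M\<^esub>"]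
    by (simp add: M.zero_act N.zero_act)
qed

lemma mod_hom_restrict_carrier:
  assumes "f \<in> mod_hom A M N" "\<And>x. x \<in> carrier M \<Longrightarrow> f x \<in> L"
  shows "f \<in> mod_hom A M (N\<lparr>carrier := L\<rparr>)"
  using assms unfolding mod_hom_def by (auto simp: PiE_def)

lemma mod_hom_compose:
  assumes M: "left_module A M" and f: "f \<in> mod_hom A M N" and g: "g \<in> mod_hom A N L"
  shows "compose (carrier M) g f \<in> mod_hom A M L"
proof -
  interpret M: left_module A M by fact
  show ?thesis
    by (rule mod_homI)
      (auto simp: compose_def mod_hom_closed[OF f] mod_hom_closed[OF g] mod_hom_add[OF f]
        mod_hom_add[OF g] mod_hom_act[OF f] mod_hom_act[OF g] M.act_closed)
qed

text \<open>Only \<open>M\<close> is known to be a module. Sums and multiples in \<open>N\<close>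
  are \<open>f\<close>-images of sums and multiples in \<open>M\<close>, which yields both the
  closure of \<open>carrier N\<close> and the compatibility of the inverse.\<close>

lemma mod_hom_inverse:
  assumes M: "left_module A M" and f: "f \<in> mod_hom A M N"
    and bij: "bij_betw f (carrier M) (carrier N)"
  shows "restrict (inv_into (carrier M) f) (carrier N) \<in> mod_hom A N M"
proof -
  interpret M: left_module A M by fact
  let ?g = "inv_into (carrier M) f"
  have g: "?g y \<in> carrier M" "f (?g y) = y" if "y \<in> carrier N" for y
    using bij that by (auto simp: bij_betw_def inv_into_into f_inv_into_f)
  have u: "?g y = x" if "x \<in> carrier M" "f x = y" for x y
    using bij that by (auto simp: bij_betw_def inv_into_f_eq)
  have add: "y \<oplus>\<^bsub>N\<^esub> z = f (?g y \<oplus>\<^bsub>M\<^esub> ?g z)" if "y \<in> carrier N" "z \<in> carrier N" for y z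
    using g that by (simp add: mod_hom_add[OF f])
  have act: "a \<odot>\<^bsub>N\<^esub> y = f (a \<odot>\<^bsub>M\<^esub> ?g y)" if "a \<in> carrier A" "y \<in> carrier N" for a y
    using g that by (simp add: mod_hom_act[OF f])
  have "y \<oplus>\<^bsub>N\<^esub> z \<in> carrier N" if "y \<in> carrier N" "z \<in> carrier N" for y z
    using add[OF that] g that mod_hom_closed[OF f] by simp
  moreover have "a \<odot>\<^bsub>N\<^esub> y \<in> carrier N" if "a \<in> carrier A" "y \<in> carrier N" for a y
    using act[OF that] g that mod_hom_closed[OF f] M.act_closed by simp
  ultimately show ?thesis
    by (intro mod_homI) (use g in \<open>auto intro!: u M.act_closed simp: add act\<close>)
qed

lemma mod_iso_sym:
  assumes "left_module A M" "mod_iso A M N"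
  shows "mod_iso A N M"
proof -
  obtain f where f: "f \<in> mod_hom A M N" "bij_betw f (carrier M) (carrier N)"
    using assms(2) unfolding mod_iso_def by blast
  have "bij_betw (restrict (inv_into (carrier M) f) (carrier N)) (carrier N) (carrier M)"
    using bij_betw_inv_into[OF f(2)] by (simp cong: bij_betw_cong)
  then show ?thesis
    unfolding mod_iso_def using mod_hom_inverse[OF assms(1) f] by blast
qed

text \<open>Transport of structure: \<open>f\<close> is onto, so every module law in
  \<open>N\<close> is the \<open>f\<close>-image of the same law in \<open>M\<close>. It serves to
  move a module to a carrier in a prescribed type.\<close>

lemma left_module_transport:
  assumes M: "left_module A M" and bij: "bij_betw f (carrier M) (carrier N)"
    and zero: "f \<zero>\<^bsub>M\<^esub> = \<zero>\<^bsub>N\<^esub>"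
    and add: "\<And>x y. x \<in> carrier M \<Longrightarrow> y \<in> carrier M \<Longrightarrow> f (x \<oplus>\<^bsub>M\<^esub> y) = f x \<oplus>\<^bsub>N\<^esub> f y"
    and act: "\<And>a x. a \<in> carrier A \<Longrightarrow> x \<in> carrier M \<Longrightarrow> f (a \<odot>\<^bsub>M\<^esub> x) = a \<odot>\<^bsub>N\<^esub> f x"
  shows "left_module A N"
proof -
  interpret M: left_module A M by fact
  have ex: "\<exists>x\<in>carrier M. y = f x" if "y \<in> carrier N" for y
    using bij that by (auto simp: bij_betw_def)
  have cl: "f x \<in> carrier N" if "x \<in> carrier M" for x
    using bij that by (auto simp: bij_betw_def)
  have neg: "\<exists>y\<in>carrier N. y \<oplus>\<^bsub>N\<^esub> f x = \<zero>\<^bsub>N\<^esub>" if "x \<in> carrier M" for x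
    by (rule bexI[of _ "f (\<ominus>\<^bsub>M\<^esub> x)"]) (use that in \<open>auto simp: add[symmetric] M.l_neg zero cl\<close>)
  interpret N: abelian_group N
  proof (rule abelian_groupI)
    fix x y assume "x \<in> carrier N" "y \<in> carrier N"
    then show "x \<oplus>\<^bsub>N\<^esub> y \<in> carrier N" "x \<oplus>\<^bsub>N\<^esub> y = y \<oplus>\<^bsub>N\<^esub> x"
      using ex by (auto simp: add[symmetric] cl M.a_ac dest!: ex)
  next
    fix x y z assume "x \<in> carrier N" "y \<in> carrier N" "z \<in> carrier N"
    then show "(x \<oplus>\<^bsub>N\<^esub> y) \<oplus>\<^bsub>N\<^esub> z = x \<oplus>\<^bsub>N\<^esub> (y \<oplus>\<^bsub>N\<^esub> z)"
      by (auto simp: add[symmetric] cl M.a_ac dest!: ex)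
  next
    fix x assume "x \<in> carrier N"
    then show "\<zero>\<^bsub>N\<^esub> \<oplus>\<^bsub>N\<^esub> x = x" "\<exists>y\<in>carrier N. y \<oplus>\<^bsub>N\<^esub> x = \<zero>\<^bsub>N\<^esub>"
      by (auto simp: add[symmetric] zero[symmetric] neg dest!: ex)
        (use neg zero in auto)
  qed (auto simp: zero[symmetric] cl)
  show ?thesis
    by unfold_locales
      (auto simp: add[symmetric] act[symmetric] cl M.act_closed M.act_l_distr M.act_r_distr
        M.act_assoc M.act_one dest!: ex)
qed


section \<open>Linear spans and finite dimension\<close>

text \<open>The coefficient set lets one notion serve twice: \<open>R = scalars\<close> gives the
  complex span, \<open>R = carrier A\<close> the submodule generated by \<open>S\<close>. Adding one
  term at a time allows induction without handling finite sums and coefficient families.\<close>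

inductive_set coeff_span :: "'a set \<Rightarrow> ('a, 'v) module \<Rightarrow> 'v set \<Rightarrow> 'v set"
  for R :: "'a set" and M :: "('a, 'v) module" and S :: "'v set" where
  zero: "\<zero>\<^bsub>M\<^esub> \<in> coeff_span R M S"
| step: "\<lbrakk>a \<in> R; s \<in> S; x \<in> coeff_span R M S\<rbrakk> \<Longrightarrow> a \<odot>\<^bsub>M\<^esub> s \<oplus>\<^bsub>M\<^esub> x \<in> coeff_span R M S"

context left_module
begin

lemma coeff_span_closed:
  assumes "x \<in> coeff_span R M S" "R \<subseteq> carrier A" "S \<subseteq> carrier M"
  shows "x \<in> carrier M"
  using assms by induction (auto intro: act_closed)

lemma coeff_span_add:
  assumes "x \<in> coeff_span R M S" "y \<in> coeff_span R M S" "R \<subseteq> carrier A" "S \<subseteq> carrier M"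
  shows "x \<oplus>\<^bsub>M\<^esub> y \<in> coeff_span R M S"
  using assms
proof induction
  case (step a s x)
  then have "a \<odot>\<^bsub>M\<^esub> s \<oplus>\<^bsub>M\<^esub> (x \<oplus>\<^bsub>M\<^esub> y) \<in> coeff_span R M S"
    by (intro coeff_span.step) auto
  moreover have "a \<odot>\<^bsub>M\<^esub> s \<in> carrier M" "x \<in> carrier M" "y \<in> carrier M"
    using step by (auto intro: act_closed coeff_span_closed)
  ultimately show ?case by (simp add: M.a_assoc)
qed (simp add: coeff_span_closed)

lemma coeff_span_act:
  assumes "x \<in> coeff_span R M S" "a \<in> R" "R \<subseteq> carrier A" "S \<subseteq> carrier M"
    and mult: "\<And>b c. b \<in> R \<Longrightarrow> c \<in> R \<Longrightarrow> b \<otimes>\<^bsub>A\<^esub> c \<in> R"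
  shows "a \<odot>\<^bsub>M\<^esub> x \<in> coeff_span R M S"
  using assms(1-4)
proof induction
  case zero
  then show ?case by (simp add: act_zero coeff_span.zero subset_iff)
next
  case (step b s x)
  then have "(a \<otimes>\<^bsub>A\<^esub> b) \<odot>\<^bsub>M\<^esub> s \<oplus>\<^bsub>M\<^esub> a \<odot>\<^bsub>M\<^esub> x \<in> coeff_span R M S"
    by (intro coeff_span.step mult) auto
  moreover have "a \<in> carrier A" "b \<in> carrier A" "s \<in> carrier M" "x \<in> carrier M"
    using step by (auto intro: act_closed coeff_span_closed)
  ultimately show ?case
    by (simp add: act_r_distr act_assoc act_closed)
qed

end

lemma coeff_span_image:
  assumes M: "left_module A M" and N: "left_module A N" and f: "f \<in> mod_hom A M N"
    and x: "x \<in> coeff_span R M S" and R: "R \<subseteq> carrier A" and S: "S \<subseteq> carrier M"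
  shows "f x \<in> coeff_span R N (f ` S)"
  using x
proof induction
  case zero
  then show ?case by (simp add: mod_hom_zero[OF M N f] coeff_span.zero)
next
  case (step a s x)
  interpret M: left_module A M by fact
  have "f (a \<odot>\<^bsub>M\<^esub> s \<oplus>\<^bsub>M\<^esub> x) = a \<odot>\<^bsub>N\<^esub> f s \<oplus>\<^bsub>N\<^esub> f x"
    using step R S M.coeff_span_closed[OF _ R S]
    by (simp add: mod_hom_add[OF f] mod_hom_act[OF f] M.act_closed subset_iff)
  then show ?case using step by (simp add: coeff_span.step)
qed

text \<open>The scalar structure is packed into the map from \<open>c\<close> to
  \<open>c \<odot> \<one>\<close>, a unital ring homomorphism from the complex numbers to the
  centre, through which every scalar multiplication factors. Modules receive their complex structure
  through the same elements, by \<open>scal\<close>.\<close>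

locale complex_algebra = ring A for A :: "(complex, 'a) module" (structure) +
  assumes scalar_closed: "c \<odot> \<one> \<in> carrier A"
    and scalar_add: "(c + d) \<odot> \<one> = c \<odot> \<one> \<oplus> d \<odot> \<one>"
    and scalar_mult: "(c * d) \<odot> \<one> = (c \<odot> \<one>) \<otimes> (d \<odot> \<one>)"
    and scalar_one: "1 \<odot> \<one> = \<one>"
    and scalar_commute: "x \<in> carrier A \<Longrightarrow> (c \<odot> \<one>) \<otimes> x = x \<otimes> (c \<odot> \<one>)"
    and smult_eq: "x \<in> carrier A \<Longrightarrow> c \<odot> x = (c \<odot> \<one>) \<otimes> x"
begin

definition scalars :: "'a set" where "scalars = range (\<lambda>c. c \<odot> \<one>)"

lemma scalars_subset: "scalars \<subseteq> carrier A"
  by (auto simp: scalars_def scalar_closed)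

lemma scalar_zero: "0 \<odot> \<one> = \<zero>"
  using scalar_add[of 0 0] scalar_closed[of 0] by simp

lemma smult_closed: "x \<in> carrier A \<Longrightarrow> c \<odot> x \<in> carrier A"
  unfolding smult_eq[of x c] by (simp add: scalar_closed)

lemma smult_assoc:
  "x \<in> carrier A \<Longrightarrow> c \<odot> (d \<odot> x) = (c * d) \<odot> x"
  unfolding smult_eq[of x] smult_eq[of "(d \<odot> \<one>) \<otimes> x"]
  by (subst smult_eq) (simp_all add: scalar_closed scalar_mult m_assoc)

lemma smult_mult_left:
  "x \<in> carrier A \<Longrightarrow> y \<in> carrier A \<Longrightarrow> (c \<odot> x) \<otimes> y = c \<odot> (x \<otimes> y)"
  unfolding smult_eq[of x c] smult_eq[of "x \<otimes> y" c, OF m_closed]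
  by (simp add: scalar_closed m_assoc)

lemma smult_mult_right:
  assumes "x \<in> carrier A" "y \<in> carrier A"
  shows "x \<otimes> (c \<odot> y) = c \<odot> (x \<otimes> y)"
proof -
  have "x \<otimes> ((c \<odot> \<one>) \<otimes> y) = (c \<odot> \<one>) \<otimes> (x \<otimes> y)"
    using assms scalar_commute[OF assms(1), of c] scalar_closed[of c]
    by (simp add: m_assoc[symmetric])
  then show ?thesis using assms by (simp add: smult_eq[of y c] smult_eq[of "x \<otimes> y" c])
qed

lemma zero_smult: "x \<in> carrier A \<Longrightarrow> 0 \<odot> x = \<zero>"
  by (simp add: smult_eq[of x] scalar_zero)

lemma smult_zero: "c \<odot> \<zero> = \<zero>"
  by (simp add: smult_eq[of \<zero>] scalar_closed)

lemma smult_add_left: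
  "x \<in> carrier A \<Longrightarrow> (c + d) \<odot> x = c \<odot> x \<oplus> d \<odot> x"
  by (simp add: smult_eq[of x] scalar_add l_distr scalar_closed)

lemma one_smult: "x \<in> carrier A \<Longrightarrow> 1 \<odot> x = x"
  by (simp add: smult_eq[of x] scalar_one)

text \<open>Bridge between the finite sums of \<open>fin_dim\<close> and the inductive span: one
  direction is induction on the summation set, the other merges the terms one by one into a
  coefficient family.\<close>

lemma fin_dim_iff:
  assumes "left_module A M"
  shows "fin_dim A M \<longleftrightarrow>
    (\<exists>S. finite S \<and> S \<subseteq> carrier M \<and> carrier M \<subseteq> coeff_span scalars M S)"
proof -
  interpret M: left_module A M by fact
  have scal_cl: "scal A M c x \<in> carrier M" if "x \<in> carrier M" for c x
    unfolding scal_def using that by (simp add: M.act_closed scalar_closed)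
  have 1: "(\<Oplus>\<^bsub>M\<^esub>s\<in>T. scal A M (c s) s) \<in> coeff_span scalars M S"
    if "finite T" "T \<subseteq> S" "S \<subseteq> carrier M" for c T S
    using that
  proof (induction T)
    case empty
    then show ?case by (simp add: coeff_span.zero)
  next
    case (insert s T)
    then have "(\<Oplus>\<^bsub>M\<^esub>s\<in>insert s T. scal A M (c s) s) =
      scal A M (c s) s \<oplus>\<^bsub>M\<^esub> (\<Oplus>\<^bsub>M\<^esub>s\<in>T. scal A M (c s) s)"
      by (intro M.finsum_insert) (auto intro!: scal_cl)
    with insert show ?case
      by (auto simp: scal_def scalars_def intro!: coeff_span.step)
  qed
  have 2: "\<exists>c. x = (\<Oplus>\<^bsub>M\<^esub>s\<in>S. scal A M (c s) s)"
    if "x \<in> coeff_span scalars M S" "finite S" "S \<subseteq> carrier M" for x S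
    using that
  proof induction
    case zero
    have "(\<Oplus>\<^bsub>M\<^esub>s\<in>S. scal A M 0 s) = (\<Oplus>\<^bsub>M\<^esub>s\<in>S. \<zero>\<^bsub>M\<^esub>)"
      using zero by (intro M.finsum_cong') (auto simp: scal_def scalar_zero M.zero_act)
    then show ?case by (intro exI[of _ "\<lambda>_. 0"]) (simp add: M.finsum_zero)
  next
    case (step a s x)
    then obtain c d where c: "x = (\<Oplus>\<^bsub>M\<^esub>s\<in>S. scal A M (c s) s)" and d: "a = d \<odot> \<one>"
      by (auto simp: scalars_def)
    have S: "S = insert s (S - {s})" "finite (S - {s})" "s \<in> carrier M"
      using step by auto
    have split: "(\<Oplus>\<^bsub>M\<^esub>s\<in>S. scal A M (c s) s) =
      scal A M (c s) s \<oplus>\<^bsub>M\<^esub> (\<Oplus>\<^bsub>M\<^esub>s\<in>S - {s}. scal A M (c s) s)" for c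
      by (subst S(1), rule M.finsum_insert) (use step S in \<open>auto intro!: scal_cl\<close>)
    \<comment> \<open>The vector \<open>s\<close> may already carry the coefficient
      \<open>c s\<close>, so the new term raises this coefficient by \<open>d\<close>.\<close>
    let ?c = "c(s := d + c s)"
    have rest: "(\<Oplus>\<^bsub>M\<^esub>t\<in>S - {s}. scal A M (?c t) t) = (\<Oplus>\<^bsub>M\<^esub>t\<in>S - {s}. scal A M (c t) t)"
      using step by (intro M.finsum_cong') (auto intro!: scal_cl)
    have "(\<Oplus>\<^bsub>M\<^esub>t\<in>S - {s}. scal A M (c t) t) \<in> carrier M"
      using step by (intro M.finsum_closed) (auto intro!: scal_cl)
    then have "a \<odot>\<^bsub>M\<^esub> s \<oplus>\<^bsub>M\<^esub> x = (\<Oplus>\<^bsub>M\<^esub>t\<in>S. scal A M (?c t) t)"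
      unfolding c split[of c] split[of ?c] rest using S(3) scal_cl[OF S(3), of "c s"]
      by (simp add: d scal_def scalar_add M.act_l_distr M.a_assoc scalar_closed M.act_closed)
    then show ?case by blast
  qed
  show ?thesis
  proof
    assume "fin_dim A M"
    then obtain S where S: "finite S" "S \<subseteq> carrier M"
      "\<forall>x\<in>carrier M. \<exists>c. x = (\<Oplus>\<^bsub>M\<^esub>s\<in>S. scal A M (c s) s)"
      unfolding fin_dim_def by blast
    have "x \<in> coeff_span scalars M S" if x: "x \<in> carrier M" for x
    proof -
      obtain c where "x = (\<Oplus>\<^bsub>M\<^esub>s\<in>S. scal A M (c s) s)"
        using S(3) x by blast
      then show ?thesis using 1[OF S(1) order_refl S(2), of c] by metis
    qed
    then show "\<exists>S. finite S \<and> S \<subseteq> carrier M \<and> carrier M \<subseteq> coeff_span scalars M S"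
      using S by blast
  next
    assume "\<exists>S. finite S \<and> S \<subseteq> carrier M \<and> carrier M \<subseteq> coeff_span scalars M S"
    then obtain S where S: "finite S" "S \<subseteq> carrier M" "carrier M \<subseteq> coeff_span scalars M S"
      by blast
    have "\<forall>x\<in>carrier M. \<exists>c. x = (\<Oplus>\<^bsub>M\<^esub>s\<in>S. scal A M (c s) s)"
      using 2[OF _ S(1,2)] S(3) by (meson subsetD)
    then show "fin_dim A M"
      unfolding fin_dim_def using S(1,2) by (intro exI[of _ S] conjI)
  qed
qed

lemma fin_dim_image:
  assumes "left_module A M" "left_module A N" "fin_dim A M"
    and f: "f \<in> mod_hom A M N" "f ` carrier M = carrier N"
  shows "fin_dim A N"
proof -
  obtain S where S: "finite S" "S \<subseteq> carrier M" "carrier M \<subseteq> coeff_span scalars M S"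
    using assms(3) unfolding fin_dim_iff[OF assms(1)] by (elim exE conjE)
  have sp: "carrier N \<subseteq> coeff_span scalars N (f ` S)"
  proof
    fix y assume "y \<in> carrier N"
    then obtain x where "x \<in> carrier M" "y = f x" unfolding f(2)[symmetric] by (rule imageE)
    then show "y \<in> coeff_span scalars N (f ` S)"
      using coeff_span_image[OF assms(1,2) f(1) _ scalars_subset S(2)] S(3) by (simp add: subset_iff)
  qed
  then show ?thesis
    unfolding fin_dim_iff[OF assms(2)] using S(1,2) f(2)
    by (intro exI[of _ "f ` S"] conjI sp) (simp, metis image_mono)
qed

text \<open>Choose coefficients for every vector over a finite spanning set and number that set.
  This encodes vectors by functions on the naturals, injectively because the coefficients determine
  the vector. The choice may be non-linear, since the operations of the copy are transported along
  the coding.\<close>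

lemma iso_Rep:
  assumes M: "left_module A M" and fd: "fin_dim A M"
  shows "\<exists>N\<in>Rep A. mod_iso A M N"
proof -
  interpret M: left_module A M by fact
  obtain S where S: "finite S" "S \<subseteq> carrier M"
    and sp: "\<And>x. x \<in> carrier M \<Longrightarrow> \<exists>c. x = (\<Oplus>\<^bsub>M\<^esub>s\<in>S. scal A M (c s) s)"
    using fd unfolding fin_dim_def by blast
  obtain c where c: "\<And>x. x \<in> carrier M \<Longrightarrow> x = (\<Oplus>\<^bsub>M\<^esub>s\<in>S. scal A M (c x s) s)"
    using sp by metis
  obtain k :: "_ \<Rightarrow> nat" where k: "inj_on k S"
    using finite_imp_inj_to_nat_seg[OF S(1)] by blast
  define g :: "_ \<Rightarrow> nat \<Rightarrow> complex"
    where "g x = (\<lambda>i. if i \<in> k ` S then c x (inv_into S k i) else 0)" for x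
  have g: "g x (k s) = c x s" if "s \<in> S" for x s
    using that k by (simp add: g_def)
  have inj: "inj_on g (carrier M)"
  proof (rule inj_onI)
    fix x y assume xy: "x \<in> carrier M" "y \<in> carrier M" "g x = g y"
    have "(\<Oplus>\<^bsub>M\<^esub>s\<in>S. scal A M (c x s) s) = (\<Oplus>\<^bsub>M\<^esub>s\<in>S. scal A M (c y s) s)"
      by (rule M.finsum_cong')
        (use xy(3) S(2) in \<open>auto simp: g[symmetric] scal_def scalar_closed intro!: M.act_closed\<close>)
    then show "x = y" using c xy by metis
  qed
  define h where "h = inv_into (carrier M) g"
  have h: "h (g x) = x" if "x \<in> carrier M" for x
    using that inj by (simp add: h_def)
  define N :: "('a, nat \<Rightarrow> complex) module" where "N = \<lparr>carrier = g ` carrier M, mult = undefined, one = undefined, zero = g \<zero>\<^bsub>M\<^esub>,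
    add = (\<lambda>x y. g (h x \<oplus>\<^bsub>M\<^esub> h y)), smult = (\<lambda>a x. g (a \<odot>\<^bsub>M\<^esub> h x))\<rparr>"
  have bij: "bij_betw g (carrier M) (carrier N)"
    using inj by (simp add: bij_betw_def N_def)
  have N: "left_module A N"
    by (rule left_module_transport[OF M bij]) (auto simp: N_def h)
  have f: "restrict g (carrier M) \<in> mod_hom A M N"
    by (rule mod_homI) (auto simp: N_def h M.act_closed)
  have bij': "bij_betw (restrict g (carrier M)) (carrier M) (carrier N)"
    using bij by (simp cong: bij_betw_cong)
  have "fin_dim A N"
    by (rule fin_dim_image[OF M N fd f]) (use bij' in \<open>auto simp: bij_betw_def\<close>)
  then show ?thesis
    unfolding Rep_def mod_iso_def using N f bij' by blast
qed

end


section \<open>Principal modules\<close>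

text \<open>
  For an idempotent \<open>e\<close>, this says that \<open>M\<close> is isomorphic to the left ideal \<open>A e\<close>, with
  \<open>u\<close> corresponding to \<open>e\<close>.
\<close>

definition principal_module :: "(complex, 'a) module \<Rightarrow> ('a, 'v) module \<Rightarrow> 'a \<Rightarrow> 'v \<Rightarrow> bool" where
  "principal_module A M e u \<longleftrightarrow> u \<in> carrier M \<and> e \<odot>\<^bsub>M\<^esub> u = u \<and>
    carrier M = (\<lambda>a. a \<odot>\<^bsub>M\<^esub> u) ` carrier A \<and>
    (\<forall>a\<in>carrier A. a \<odot>\<^bsub>M\<^esub> u = \<zero>\<^bsub>M\<^esub> \<longrightarrow> a \<otimes>\<^bsub>A\<^esub> e = \<zero>\<^bsub>A\<^esub>)"

lemma principal_generator:
  "principal_module A M e u \<Longrightarrow> u \<in> carrier M" "principal_module A M e u \<Longrightarrow> e \<odot>\<^bsub>M\<^esub> u = u"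
  unfolding principal_module_def by blast+

lemma principalE:
  assumes "principal_module A M e u" "x \<in> carrier M"
  obtains a where "a \<in> carrier A" "x = a \<odot>\<^bsub>M\<^esub> u"
  using assms unfolding principal_module_def by blast

definition regular_module :: "(complex, 'a) module \<Rightarrow> ('a, 'a) module" where
  "regular_module A = \<lparr>carrier = carrier A, mult = undefined, one = undefined,
    zero = zero A, add = add A, smult = monoid.mult A\<rparr>"

context complex_algebra
begin

lemma left_module_regular: "left_module A (regular_module A)"
proof -
  interpret reg: abelian_group "regular_module A"
    by (rule abelian_groupI) (auto simp: regular_module_def a_ac intro: bexI[of _ "\<ominus> _"] l_neg)
  show ?thesis
    by unfold_locales (auto simp: regular_module_def l_distr r_distr m_assoc)
qed

lemma left_module_left_ideal:
  assumes "e \<in> carrier A"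
  shows "left_module A (regular_module A\<lparr>carrier := (\<lambda>a. a \<otimes> e) ` carrier A\<rparr>)"
proof (rule left_module.left_module_submodule[OF left_module_regular])
  show "\<zero>\<^bsub>regular_module A\<^esub> \<in> (\<lambda>a. a \<otimes> e) ` carrier A"
    using assms by (auto simp: regular_module_def intro!: image_eqI[of _ _ \<zero>])
next
  fix x y assume "x \<in> (\<lambda>a. a \<otimes> e) ` carrier A" "y \<in> (\<lambda>a. a \<otimes> e) ` carrier A"
  then obtain a b where "a \<in> carrier A" "b \<in> carrier A" "x = a \<otimes> e" "y = b \<otimes> e" by auto
  then show "x \<oplus>\<^bsub>regular_module A\<^esub> y \<in> (\<lambda>a. a \<otimes> e) ` carrier A"
    using assms by (auto simp: regular_module_def l_distr intro!: image_eqI[of _ _ "a \<oplus> b"])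
next
  fix b x assume "b \<in> carrier A" "x \<in> (\<lambda>a. a \<otimes> e) ` carrier A"
  then show "b \<odot>\<^bsub>regular_module A\<^esub> x \<in> (\<lambda>a. a \<otimes> e) ` carrier A"
    using assms by (auto simp: regular_module_def m_assoc[symmetric] intro!: imageI)
qed (use assms in \<open>auto simp: regular_module_def\<close>)

lemma principal_left_ideal:
  assumes "e \<in> carrier A" "e \<otimes> e = e"
  shows "principal_module A (regular_module A\<lparr>carrier := (\<lambda>a. a \<otimes> e) ` carrier A\<rparr>) e e"
  using assms unfolding principal_module_def regular_module_def
  by (auto intro!: image_eqI[of _ _ \<one>])

end

text \<open>The universal property of \<open>A e\<close>: homomorphisms to \<open>N\<close>
  correspond to vectors fixed by \<open>e\<close>. Sending \<open>a u\<close> to \<open>a y\<close>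
  is well defined because \<open>a u = 0\<close> implies \<open>a e = 0\<close>, and then
  \<open>a y = a e y = 0\<close>.\<close>

lemma principal_mod_hom:
  assumes M: "left_module A M" and N: "left_module A N" and u: "principal_module A M e u"
    and e: "e \<in> carrier A" and y: "y \<in> carrier N" "e \<odot>\<^bsub>N\<^esub> y = y"
  shows "\<exists>f\<in>mod_hom A M N. \<forall>a\<in>carrier A. f (a \<odot>\<^bsub>M\<^esub> u) = a \<odot>\<^bsub>N\<^esub> y"
proof -
  interpret M: left_module A M by fact
  interpret N: left_module A N by fact
  have uM: "u \<in> carrier M" using principal_generator(1)[OF u] .
  have wd: "a \<odot>\<^bsub>N\<^esub> y = b \<odot>\<^bsub>N\<^esub> y"
    if ab: "a \<in> carrier A" "b \<in> carrier A" "a \<odot>\<^bsub>M\<^esub> u = b \<odot>\<^bsub>M\<^esub> u" for a b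
  proof -
    have "(a \<ominus>\<^bsub>A\<^esub> b) \<odot>\<^bsub>M\<^esub> u = \<zero>\<^bsub>M\<^esub>"
      using ab uM M.diff_act[of a b u] by (simp add: M.act_closed M.r_neg a_minus_def)
    then have "(a \<ominus>\<^bsub>A\<^esub> b) \<otimes>\<^bsub>A\<^esub> e = \<zero>\<^bsub>A\<^esub>"
      using u ab by (auto simp: principal_module_def)
    then have "(a \<ominus>\<^bsub>A\<^esub> b) \<odot>\<^bsub>N\<^esub> y = \<zero>\<^bsub>N\<^esub>"
      using N.act_assoc[of "a \<ominus>\<^bsub>A\<^esub> b" e y] ab e y by (simp add: N.zero_act)
    then show ?thesis
      using N.eq_if_diff_zero[of "a \<odot>\<^bsub>N\<^esub> y" "b \<odot>\<^bsub>N\<^esub> y"] N.diff_act[OF ab(1,2) y(1)] ab(1,2) y(1)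
      by (simp add: N.act_closed)
  qed
  define c where "c x = (SOME a. a \<in> carrier A \<and> x = a \<odot>\<^bsub>M\<^esub> u)" for x
  have c: "c x \<in> carrier A" "x = c x \<odot>\<^bsub>M\<^esub> u" if "x \<in> carrier M" for x
  proof -
    have "\<exists>a. a \<in> carrier A \<and> x = a \<odot>\<^bsub>M\<^esub> u" using principalE[OF u that] by metis
    from someI_ex[OF this] show "c x \<in> carrier A" "x = c x \<odot>\<^bsub>M\<^esub> u"
      by (auto simp: c_def)
  qed
  let ?f = "\<lambda>x\<in>carrier M. c x \<odot>\<^bsub>N\<^esub> y"
  have f: "?f (a \<odot>\<^bsub>M\<^esub> u) = a \<odot>\<^bsub>N\<^esub> y" if "a \<in> carrier A" for a
    using wd[of "c (a \<odot>\<^bsub>M\<^esub> u)" a] c[of "a \<odot>\<^bsub>M\<^esub> u"] that uM by (simp add: M.act_closed)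
  have "?f \<in> mod_hom A M N"
  proof (rule mod_homI)
    fix x z assume x: "x \<in> carrier M" "z \<in> carrier M"
    have "?f (x \<oplus>\<^bsub>M\<^esub> z) = ?f ((c x \<oplus>\<^bsub>A\<^esub> c z) \<odot>\<^bsub>M\<^esub> u)"
      using c[OF x(1)] c[OF x(2)] uM by (simp add: M.act_l_distr)
    also have "\<dots> = ?f x \<oplus>\<^bsub>N\<^esub> ?f z"
      using x c y by (subst f) (auto simp: N.act_l_distr)
    finally show "?f (x \<oplus>\<^bsub>M\<^esub> z) = ?f x \<oplus>\<^bsub>N\<^esub> ?f z" .
  next
    fix a x assume x: "a \<in> carrier A" "x \<in> carrier M"
    have "?f (a \<odot>\<^bsub>M\<^esub> x) = ?f ((a \<otimes>\<^bsub>A\<^esub> c x) \<odot>\<^bsub>M\<^esub> u)"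
      using c[OF x(2)] uM x by (simp add: M.act_assoc)
    also have "\<dots> = a \<odot>\<^bsub>N\<^esub> ?f x"
      using x c y by (subst f) (auto simp: N.act_assoc)
    finally show "?f (a \<odot>\<^bsub>M\<^esub> x) = a \<odot>\<^bsub>N\<^esub> ?f x" .
  qed (use c y in \<open>auto simp: N.act_closed\<close>)
  with f show ?thesis by blast
qed

lemma principal_hom_eqI:
  assumes u: "principal_module A M e u" and f: "f \<in> mod_hom A M N" and g: "g \<in> mod_hom A M N"
    and eq: "f u = g u"
  shows "f = g"
proof (rule mod_hom_eqI[OF f g])
  fix x assume "x \<in> carrier M"
  then obtain a where "a \<in> carrier A" "x = a \<odot>\<^bsub>M\<^esub> u" by (rule principalE[OF u])
  then show "f x = g x"
    using principal_generator(1)[OF u] eq by (simp add: mod_hom_act[OF f] mod_hom_act[OF g])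
qed

text \<open>The homomorphisms exchanging the generators \<open>u\<close> and \<open>v\<close> are
  mutually inverse, because both modules consist of multiples of their generators.\<close>

lemma principal_mod_iso:
  assumes M: "left_module A M" and N: "left_module A N" and e: "e \<in> carrier A"
    and u: "principal_module A M e u" and v: "principal_module A N e v"
  shows "mod_iso A M N"
proof -
  interpret M: left_module A M by fact
  have uv: "u \<in> carrier M" "v \<in> carrier N" "e \<odot>\<^bsub>M\<^esub> u = u" "e \<odot>\<^bsub>N\<^esub> v = v"
    using u v by (auto simp: principal_module_def)
  obtain f where f: "f \<in> mod_hom A M N" "\<And>a. a \<in> carrier A \<Longrightarrow> f (a \<odot>\<^bsub>M\<^esub> u) = a \<odot>\<^bsub>N\<^esub> v"
    using principal_mod_hom[OF M N u e uv(2,4)] by blast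
  obtain g where g: "g \<in> mod_hom A N M" "\<And>a. a \<in> carrier A \<Longrightarrow> g (a \<odot>\<^bsub>N\<^esub> v) = a \<odot>\<^bsub>M\<^esub> u"
    using principal_mod_hom[OF N M v e uv(1,3)] by blast
  have "bij_betw f (carrier M) (carrier N)"
  proof (rule bij_betw_byWitness[where f' = g])
    show "\<forall>x\<in>carrier M. g (f x) = x" "\<forall>y\<in>carrier N. f (g y) = y"
      using f(2) g(2) by (auto elim!: principalE[OF u] principalE[OF v])
  qed (use mod_hom_closed[OF f(1)] mod_hom_closed[OF g(1)] in auto)
  then show ?thesis using f(1) unfolding mod_iso_def by blast
qed

lemma principal_transport:
  assumes M: "left_module A M" and N: "left_module A N"
    and u: "principal_module A M e u" and e: "e \<in> carrier A" and iso: "mod_iso A M N"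
  shows "\<exists>v. principal_module A N e v"
proof -
  interpret M: left_module A M by fact
  obtain f where f: "f \<in> mod_hom A M N" "bij_betw f (carrier M) (carrier N)"
    using iso unfolding mod_iso_def by blast
  have uM: "u \<in> carrier M" "e \<odot>\<^bsub>M\<^esub> u = u" using u by (auto simp: principal_module_def)
  have inj: "x = \<zero>\<^bsub>M\<^esub>" if "x \<in> carrier M" "f x = \<zero>\<^bsub>N\<^esub>" for x
    using f(2) that mod_hom_zero[OF M N f(1)] by (auto simp: bij_betw_def inj_on_def)
  have car: "carrier N = (\<lambda>a. a \<odot>\<^bsub>N\<^esub> f u) ` carrier A"
  proof -
    have "carrier N = f ` carrier M" using f(2) by (simp add: bij_betw_def)
    also have "\<dots> = f ` (\<lambda>a. a \<odot>\<^bsub>M\<^esub> u) ` carrier A" using u by (simp add: principal_module_def)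
    also have "\<dots> = (\<lambda>a. a \<odot>\<^bsub>N\<^esub> f u) ` carrier A"
      using uM by (auto simp: image_image mod_hom_act[OF f(1)])
    finally show ?thesis .
  qed
  have "principal_module A N e (f u)"
    unfolding principal_module_def
  proof (intro conjI ballI impI)
    show "f u \<in> carrier N" using mod_hom_closed[OF f(1)] uM by simp
    show "e \<odot>\<^bsub>N\<^esub> f u = f u" using mod_hom_act[OF f(1) e uM(1)] uM by simp
    fix a assume "a \<in> carrier A" "a \<odot>\<^bsub>N\<^esub> f u = \<zero>\<^bsub>N\<^esub>"
    then have "a \<odot>\<^bsub>M\<^esub> u = \<zero>\<^bsub>M\<^esub>"
      using inj uM by (simp add: mod_hom_act[OF f(1)] M.act_closed)
    then show "a \<otimes>\<^bsub>A\<^esub> e = \<zero>\<^bsub>A\<^esub>" using u \<open>a \<in> carrier A\<close> by (simp add: principal_module_def)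
  qed (rule car)
  then show ?thesis ..
qed

text \<open>A preimage \<open>z\<close> of \<open>f u\<close> under \<open>g\<close> may fail to be
  fixed by \<open>e\<close>. But \<open>e z\<close> is fixed, and it is still a preimage because
  \<open>f u\<close> is fixed by \<open>e\<close>. The universal property of \<open>u\<close> then
  supplies the lift.\<close>

lemma principal_projective:
  assumes P: "P \<in> Rep A" and u: "principal_module A P e u" and e: "e \<in> carrier A" "e \<otimes>\<^bsub>A\<^esub> e = e"
  shows "projective A P"
  unfolding projective_def
proof (intro conjI ballI impI)
  fix M N g f assume MN: "M \<in> Rep A" "N \<in> Rep A" and g: "g \<in> mod_hom A M N"
    and f: "f \<in> mod_hom A P N" and surj: "g ` carrier M = carrier N"
  have lm: "left_module A P" "left_module A M" "left_module A N"
    using P MN by (auto simp: Rep_def)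
  interpret M: left_module A M by fact
  have uP: "u \<in> carrier P" "e \<odot>\<^bsub>P\<^esub> u = u" using u by (auto simp: principal_module_def)
  obtain z where z: "z \<in> carrier M" "g z = f u"
    using surj mod_hom_closed[OF f uP(1)] by (metis imageE)
  have "e \<odot>\<^bsub>M\<^esub> z \<in> carrier M" "e \<odot>\<^bsub>M\<^esub> (e \<odot>\<^bsub>M\<^esub> z) = e \<odot>\<^bsub>M\<^esub> z"
    using z e M.act_assoc[of e e z] by (auto simp: M.act_closed)
  then obtain h where h: "h \<in> mod_hom A P M"
    "\<And>a. a \<in> carrier A \<Longrightarrow> h (a \<odot>\<^bsub>P\<^esub> u) = a \<odot>\<^bsub>M\<^esub> (e \<odot>\<^bsub>M\<^esub> z)"
    using principal_mod_hom[OF lm(1,2) u e(1)] by blast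
  have "g (h u) = g (e \<odot>\<^bsub>M\<^esub> z)"
    using h(2)[OF e(1)] uP \<open>e \<odot>\<^bsub>M\<^esub> (e \<odot>\<^bsub>M\<^esub> z) = e \<odot>\<^bsub>M\<^esub> z\<close> by simp
  also have "\<dots> = f u"
    using mod_hom_act[OF g e(1) z(1)] mod_hom_act[OF f e(1) uP(1)] z uP by simp
  finally have "compose (carrier P) g h u = f u" using uP by (simp add: compose_def)
  then have "compose (carrier P) g h = f"
    by (rule principal_hom_eqI[OF u mod_hom_compose[OF lm(1) h(1) g] f])
  then show "\<exists>h\<in>mod_hom A P M. compose (carrier P) g h = f" using h(1) by blast
qed (rule P)


section \<open>Direct sums and idempotent endomorphisms\<close>

lemma direct_sum_simps:
  "carrier (direct_sum Ms) = (\<Pi>\<^sub>E i\<in>{..<length Ms}. carrier (Ms ! i))"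
  "zero (direct_sum Ms) = (\<lambda>i\<in>{..<length Ms}. \<zero>\<^bsub>Ms ! i\<^esub>)"
  "add (direct_sum Ms) x y = (\<lambda>i\<in>{..<length Ms}. x i \<oplus>\<^bsub>Ms ! i\<^esub> y i)"
  "smult (direct_sum Ms) a x = (\<lambda>i\<in>{..<length Ms}. a \<odot>\<^bsub>Ms ! i\<^esub> x i)"
  by (simp_all add: direct_sum_def)

lemma left_module_direct_sum:
  assumes "ring A" and lm: "\<And>M. M \<in> set Ms \<Longrightarrow> left_module A M"
  shows "left_module A (direct_sum Ms)"
proof -
  interpret A: ring A by fact
  have lm': "left_module A (Ms ! i)" if "i < length Ms" for i using lm that by simp
  have ag: "abelian_group (Ms ! i)" if "i < length Ms" for i
    using lm'[OF that] by (simp add: left_module_def)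
  note cl = abelian_groupE(1)[OF ag] abelian_groupE(2)[OF ag]
    and assoc = abelian_groupE(3)[OF ag] and comm = abelian_groupE(4)[OF ag]
    and l_zero = abelian_groupE(5)[OF ag]
  interpret D: abelian_group "direct_sum Ms"
  proof (rule abelian_groupI)
    fix x assume x: "x \<in> carrier (direct_sum Ms)"
    show "\<exists>y\<in>carrier (direct_sum Ms). y \<oplus>\<^bsub>direct_sum Ms\<^esub> x = \<zero>\<^bsub>direct_sum Ms\<^esub>"
      by (rule bexI[of _ "\<lambda>i\<in>{..<length Ms}. \<ominus>\<^bsub>Ms ! i\<^esub> x i"])
        (use x in \<open>auto simp: direct_sum_simps abelian_group.l_neg[OF ag] PiE_iff
          abelian_group.a_inv_closed[OF ag] intro!: restrict_ext\<close>)
  next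
    fix x y assume "x \<in> carrier (direct_sum Ms)" "y \<in> carrier (direct_sum Ms)"
    then show "x \<oplus>\<^bsub>direct_sum Ms\<^esub> y = y \<oplus>\<^bsub>direct_sum Ms\<^esub> x"
      by (auto simp: direct_sum_simps PiE_iff intro!: restrict_ext comm)
  qed (auto simp: direct_sum_simps PiE_iff cl assoc l_zero extensional_def intro!: ext)
  show ?thesis
    by unfold_locales
      (auto simp: direct_sum_simps PiE_iff extensional_def left_module.act_closed[OF lm']
        left_module.act_l_distr[OF lm'] left_module.act_r_distr[OF lm']
        left_module.act_assoc[OF lm'] left_module.act_one[OF lm'] intro!: ext)
qed

lemma direct_sum_pair:
  assumes "x \<in> carrier M" "y \<in> carrier N"
  shows "(\<lambda>i\<in>{..<2}. if i = 0 then x else y) \<in> carrier (direct_sum [M, N])"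
  using assms by (auto simp: direct_sum_simps PiE_iff less_Suc_eq numeral_2_eq_2)

lemma direct_sum_pair_eqI:
  assumes "z \<in> carrier (direct_sum [M, N])" "w \<in> carrier (direct_sum [M, N])"
    "z 0 = w 0" "z 1 = w 1"
  shows "z = w"
proof
  fix i show "z i = w i"
    using assms by (cases "i < 2") (auto simp: direct_sum_simps PiE_iff extensional_def
      less_Suc_eq numeral_2_eq_2)
qed

text \<open>An idempotent endomorphism splits the module into its image and its kernel.\<close>

lemma (in complex_algebra) indecomposable_idempotent:
  assumes Q: "indecomposable A Q" and p: "p \<in> mod_hom A Q Q"
    and idem: "\<And>x. x \<in> carrier Q \<Longrightarrow> p (p x) = p x"
  shows "(\<forall>x\<in>carrier Q. p x = \<zero>\<^bsub>Q\<^esub>) \<or> (\<forall>x\<in>carrier Q. p x = x)"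
proof -
  have QR: "left_module A Q" "fin_dim A Q" using Q by (auto simp: indecomposable_def Rep_def)
  interpret Q: left_module A Q by fact
  note pc = mod_hom_closed[OF p] and padd = mod_hom_add[OF p] and pact = mod_hom_act[OF p]
    and pz = mod_hom_zero[OF QR(1) QR(1) p]
  have pdiff: "p (x \<ominus>\<^bsub>Q\<^esub> p x) = \<zero>\<^bsub>Q\<^esub>" if x: "x \<in> carrier Q" for x
  proof -
    have "p (\<ominus>\<^bsub>Q\<^esub> p x) = \<ominus>\<^bsub>Q\<^esub> p (p x)"
      using pact[of "\<ominus> \<one>" "p x"] x pc by (simp add: Q.minus_act Q.act_one)
    then show ?thesis using x pc idem by (simp add: a_minus_def padd Q.r_neg)
  qed
  let ?X = "Q\<lparr>carrier := p ` carrier Q\<rparr>" and ?Y = "Q\<lparr>carrier := {x\<in>carrier Q. p x = \<zero>\<^bsub>Q\<^esub>}\<rparr>"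
  have X: "left_module A ?X"
  proof (rule Q.left_module_submodule)
    show "p ` carrier Q \<subseteq> carrier Q" using pc by blast
    show "\<zero>\<^bsub>Q\<^esub> \<in> p ` carrier Q" using pz by (metis Q.zero_closed imageI)
  next
    fix x y assume "x \<in> p ` carrier Q" "y \<in> p ` carrier Q"
    then show "x \<oplus>\<^bsub>Q\<^esub> y \<in> p ` carrier Q" using padd by (auto intro: rev_image_eqI)
  next
    fix a x assume "a \<in> carrier A" "x \<in> p ` carrier Q"
    then show "a \<odot>\<^bsub>Q\<^esub> x \<in> p ` carrier Q" using pact by (auto intro: rev_image_eqI Q.act_closed)
  qed
  interpret X: left_module A ?X by fact
  have Y: "left_module A ?Y"
    by (rule Q.left_module_submodule) (auto simp: padd pact pz Q.act_closed Q.act_zero)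
  interpret Y: left_module A ?Y by fact
  have "p \<in> mod_hom A Q ?X" by (rule mod_hom_restrict_carrier[OF p]) simp
  then have fX: "fin_dim A ?X" by (rule fin_dim_image[OF QR(1) X QR(2)]) simp
  \<comment> \<open>The kernel of \<open>p\<close> is the image of the identity minus
    \<open>p\<close>, so it too is finite-dimensional as a homomorphic image of
    \<open>Q\<close>.\<close>
  let ?q = "\<lambda>x\<in>carrier Q. x \<ominus>\<^bsub>Q\<^esub> p x"
  have q: "?q \<in> mod_hom A Q ?Y"
  proof (rule mod_homI)
    fix x y assume "x \<in> carrier Q" "y \<in> carrier Q"
    then show "?q (x \<oplus>\<^bsub>Q\<^esub> y) = ?q x \<oplus>\<^bsub>?Y\<^esub> ?q y"
      using pc by (simp add: a_minus_def padd Q.minus_add Q.a_ac)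
  next
    fix a x assume "a \<in> carrier A" "x \<in> carrier Q"
    then show "?q (a \<odot>\<^bsub>Q\<^esub> x) = a \<odot>\<^bsub>?Y\<^esub> ?q x"
      using pc Q.act_assoc[of a "\<ominus> \<one>" "p x"] Q.minus_act[of a "p x"]
      by (simp add: a_minus_def pact Q.act_closed Q.act_r_distr Q.minus_act Q.act_one r_minus)
  qed (use pc pdiff in auto)
  have "?q ` carrier Q = carrier ?Y"
  proof
    show "carrier ?Y \<subseteq> ?q ` carrier Q"
    proof
      fix x assume "x \<in> carrier ?Y"
      then have "x = ?q x" "x \<in> carrier Q" by (auto simp: a_minus_def)
      then show "x \<in> ?q ` carrier Q" by (rule image_eqI)
    qed
  qed (use mod_hom_closed[OF q] in blast)
  then have fY: "fin_dim A ?Y" by (rule fin_dim_image[OF QR(1) Y QR(2) q])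
  obtain X' Y' where X': "X' \<in> Rep A" "mod_iso A ?X X'" and Y': "Y' \<in> Rep A" "mod_iso A ?Y Y'"
    using iso_Rep[OF X fX] iso_Rep[OF Y fY] by blast
  obtain f g where f: "f \<in> mod_hom A ?X X'" "bij_betw f (carrier ?X) (carrier X')"
    and g: "g \<in> mod_hom A ?Y Y'" "bij_betw g (carrier ?Y) (carrier Y')"
    using X'(2) Y'(2) unfolding mod_iso_def by blast
  have lm': "left_module A X'" "left_module A Y'" using X' Y' by (auto simp: Rep_def)
  have q_cl: "x \<ominus>\<^bsub>Q\<^esub> p x \<in> carrier ?Y" if "x \<in> carrier Q" for x
    using that pc pdiff by simp
  let ?h = "\<lambda>x\<in>carrier Q. \<lambda>i\<in>{..<2::nat}. if i = 0 then f (p x) else g (x \<ominus>\<^bsub>Q\<^esub> p x)"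
  have h_cl: "?h x \<in> carrier (direct_sum [X', Y'])" if "x \<in> carrier Q" for x
    using direct_sum_pair[of "f (p x)" X' "g (x \<ominus>\<^bsub>Q\<^esub> p x)" Y'] that q_cl[OF that]
      mod_hom_closed[OF f(1), of "p x"] mod_hom_closed[OF g(1), of "x \<ominus>\<^bsub>Q\<^esub> p x"] by simp
  have h: "?h \<in> mod_hom A Q (direct_sum [X', Y'])"
  proof (rule mod_homI)
    fix x y assume x: "x \<in> carrier Q" "y \<in> carrier Q"
    have "f (p (x \<oplus>\<^bsub>Q\<^esub> y)) = f (p x) \<oplus>\<^bsub>X'\<^esub> f (p y)"
      using mod_hom_add[OF f(1), of "p x" "p y"] x by (simp add: padd)
    moreover have "g ((x \<oplus>\<^bsub>Q\<^esub> y) \<ominus>\<^bsub>Q\<^esub> p (x \<oplus>\<^bsub>Q\<^esub> y)) =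
        g (x \<ominus>\<^bsub>Q\<^esub> p x) \<oplus>\<^bsub>Y'\<^esub> g (y \<ominus>\<^bsub>Q\<^esub> p y)"
      using mod_hom_add[OF g(1) q_cl[OF x(1)] q_cl[OF x(2)]] mod_hom_add[OF q x] x by simp
    ultimately show "?h (x \<oplus>\<^bsub>Q\<^esub> y) = ?h x \<oplus>\<^bsub>direct_sum [X', Y']\<^esub> ?h y"
      using x by (auto simp: direct_sum_simps numeral_2_eq_2 less_Suc_eq intro!: restrict_ext)
  next
    fix a x assume x: "a \<in> carrier A" "x \<in> carrier Q"
    have "f (p (a \<odot>\<^bsub>Q\<^esub> x)) = a \<odot>\<^bsub>X'\<^esub> f (p x)"
      using mod_hom_act[OF f(1), of a "p x"] x by (simp add: pact)
    moreover have "g (a \<odot>\<^bsub>Q\<^esub> x \<ominus>\<^bsub>Q\<^esub> p (a \<odot>\<^bsub>Q\<^esub> x)) = a \<odot>\<^bsub>Y'\<^esub> g (x \<ominus>\<^bsub>Q\<^esub> p x)"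
      using mod_hom_act[OF g(1) x(1) q_cl[OF x(2)]] mod_hom_act[OF q x] x
      by (simp add: Q.act_closed)
    ultimately show "?h (a \<odot>\<^bsub>Q\<^esub> x) = a \<odot>\<^bsub>direct_sum [X', Y']\<^esub> ?h x"
      using x by (auto simp: direct_sum_simps numeral_2_eq_2 less_Suc_eq Q.act_closed
        intro!: restrict_ext)
  next
    fix x assume "x \<in> carrier Q"
    then show "?h x \<in> carrier (direct_sum [X', Y'])" by (rule h_cl)
  qed auto
  have sum: "p x \<oplus>\<^bsub>Q\<^esub> (x \<ominus>\<^bsub>Q\<^esub> p x) = x" if "x \<in> carrier Q" for x
    using that pc by (simp add: a_minus_def Q.a_lcomm[of "p x" x] Q.r_neg)
  have "inj_on ?h (carrier Q)"
  proof (rule inj_onI)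
    fix x y assume x: "x \<in> carrier Q" "y \<in> carrier Q" and eq: "?h x = ?h y"
    have "f (p x) = f (p y)" "g (x \<ominus>\<^bsub>Q\<^esub> p x) = g (y \<ominus>\<^bsub>Q\<^esub> p y)"
      using fun_cong[OF eq, of 0] fun_cong[OF eq, of 1] x by simp_all
    then have "p x = p y" "x \<ominus>\<^bsub>Q\<^esub> p x = y \<ominus>\<^bsub>Q\<^esub> p y"
      using f(2) g(2) x q_cl[OF x(1)] q_cl[OF x(2)] by (auto simp: bij_betw_def dest!: inj_onD)
    then show "x = y" using sum x by metis
  qed
  moreover have "\<exists>x\<in>carrier Q. z = ?h x" if z: "z \<in> carrier (direct_sum [X', Y'])" for z
  proof -
    have "z 0 \<in> carrier X'" "z 1 \<in> carrier Y'"
      using PiE_mem[of z "{..<2}" "\<lambda>i. carrier ([X', Y'] ! i)" 0]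
        PiE_mem[of z "{..<2}" "\<lambda>i. carrier ([X', Y'] ! i)" 1] z
      by (simp_all add: direct_sum_simps numeral_2_eq_2)
    then have "z 0 \<in> f ` carrier ?X" "z 1 \<in> g ` carrier ?Y"
      unfolding bij_betw_imp_surj_on[OF f(2)] bij_betw_imp_surj_on[OF g(2)] .
    then obtain x y where x: "x \<in> p ` carrier Q" "f x = z 0"
      and y: "y \<in> carrier Q" "p y = \<zero>\<^bsub>Q\<^esub>" "g y = z 1"
      by (elim imageE) auto
    have xQ: "x \<in> carrier Q" "p x = x" using x pc idem by auto
    have "p (x \<oplus>\<^bsub>Q\<^esub> y) = x" using xQ y by (simp add: padd)
    moreover have "(x \<oplus>\<^bsub>Q\<^esub> y) \<ominus>\<^bsub>Q\<^esub> x = y"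
      using xQ y by (simp add: a_minus_def Q.a_assoc Q.a_lcomm[of x y] Q.r_neg)
    ultimately have "z = ?h (x \<oplus>\<^bsub>Q\<^esub> y)"
      using x y xQ by (intro direct_sum_pair_eqI[OF z h_cl]) auto
    then show ?thesis using xQ y by blast
  qed
  ultimately have "bij_betw ?h (carrier Q) (carrier (direct_sum [X', Y']))"
    using h_cl unfolding bij_betw_def by blast
  then have "zero_module X' \<or> zero_module Y'"
    using Q X'(1) Y'(1) h unfolding indecomposable_def mod_iso_def by blast
  then show ?thesis
  proof
    assume z: "zero_module X'"
    have "p x = \<zero>\<^bsub>Q\<^esub>" if x: "x \<in> carrier Q" for x
    proof -
      have px: "p x \<in> carrier ?X" using x by simp
      have "f (p x) = f \<zero>\<^bsub>?X\<^esub>"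
        using z mod_hom_closed[OF f(1) px] mod_hom_zero[OF X lm'(1) f(1)]
        by (simp add: zero_module_def)
      from inj_onD[OF bij_betw_imp_inj_on[OF f(2)] this px X.M.zero_closed]
      show ?thesis by simp
    qed
    then show ?thesis by blast
  next
    assume z: "zero_module Y'"
    have "x \<ominus>\<^bsub>Q\<^esub> p x = \<zero>\<^bsub>Q\<^esub>" if x: "x \<in> carrier Q" for x
    proof -
      have "g (x \<ominus>\<^bsub>Q\<^esub> p x) = g \<zero>\<^bsub>?Y\<^esub>"
        using z mod_hom_closed[OF g(1) q_cl[OF x]] mod_hom_zero[OF Y lm'(2) g(1)]
        by (simp add: zero_module_def)
      from inj_onD[OF bij_betw_imp_inj_on[OF g(2)] this q_cl[OF x] Y.M.zero_closed]
      show ?thesis by simp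
    qed
    then show ?thesis using Q.eq_if_diff_zero pc by metis
  qed
qed


section \<open>Endomorphisms of a free module of rank one\<close>

text \<open>
  Endomorphisms of the regular module are right multiplications, so its endomorphism algebra
  is the opposite algebra.
\<close>

lemma (in complex_algebra) End_alg_iso:
  assumes M: "left_module A M" and u: "principal_module A M \<one> u"
    and bij: "bij_betw t (carrier A) (carrier A)"
    and add: "\<And>x y. x \<in> carrier A \<Longrightarrow> y \<in> carrier A \<Longrightarrow> t (x \<oplus> y) = t x \<oplus> t y"
    and anti: "\<And>x y. x \<in> carrier A \<Longrightarrow> y \<in> carrier A \<Longrightarrow> t (x \<otimes> y) = t y \<otimes> t x"
    and one: "t \<one> = \<one>"
    and smult: "\<And>c x. x \<in> carrier A \<Longrightarrow> t (c \<odot> x) = c \<odot> t x"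
  shows "alg_iso (End_alg A M) A"
proof -
  interpret M: left_module A M by fact
  have uM: "u \<in> carrier M" using principal_generator(1)[OF u] .
  have uniq: "a = b" if "a \<in> carrier A" "b \<in> carrier A" "a \<odot>\<^bsub>M\<^esub> u = b \<odot>\<^bsub>M\<^esub> u" for a b
  proof -
    have "(a \<ominus> b) \<odot>\<^bsub>M\<^esub> u = \<zero>\<^bsub>M\<^esub>"
      using that uM M.diff_act[of a b u] by (simp add: M.act_closed M.r_neg a_minus_def)
    then have "(a \<ominus> b) \<otimes> \<one> = \<zero>" using u that by (auto simp: principal_module_def)
    then show ?thesis using that minus_equality[of a "\<ominus> b"] by (simp add: a_minus_def)
  qed
  define k where "k f = (THE a. a \<in> carrier A \<and> f u = a \<odot>\<^bsub>M\<^esub> u)" for f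
  have kI: "k f = a" if "a \<in> carrier A" "f u = a \<odot>\<^bsub>M\<^esub> u" for a f
    unfolding k_def using that uniq by (intro the_equality) auto
  have k: "k f \<in> carrier A" "f u = k f \<odot>\<^bsub>M\<^esub> u" if f: "f \<in> mod_hom A M M" for f
  proof -
    obtain a where a: "a \<in> carrier A" "f u = a \<odot>\<^bsub>M\<^esub> u"
      using principalE[OF u mod_hom_closed[OF f uM]] .
    with kI[of a f] show "k f \<in> carrier A" "f u = k f \<odot>\<^bsub>M\<^esub> u" by auto
  qed
  have tc: "t x \<in> carrier A" if "x \<in> carrier A" for x
    using bij that by (auto simp: bij_betw_def)
  have k_bij: "bij_betw k (mod_hom A M M) (carrier A)"
    unfolding bij_betw_def
  proof (intro conjI inj_onI equalityI subsetI)
    fix f g assume "f \<in> mod_hom A M M" "g \<in> mod_hom A M M" "k f = k g"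
    then show "f = g" using principal_hom_eqI[OF u, of f M g] k(2)[of f] k(2)[of g] by simp
  next
    fix a assume a: "a \<in> carrier A"
    obtain f where f: "f \<in> mod_hom A M M"
      "\<And>b. b \<in> carrier A \<Longrightarrow> f (b \<odot>\<^bsub>M\<^esub> u) = b \<odot>\<^bsub>M\<^esub> (a \<odot>\<^bsub>M\<^esub> u)"
      using principal_mod_hom[OF M M u _ M.act_closed[OF a uM]] a uM
      by (auto simp: M.act_one M.act_closed)
    have "f u = a \<odot>\<^bsub>M\<^esub> u" using f(2)[of \<one>] a uM by (simp add: M.act_one M.act_closed)
    then have "k f = a" using kI a by simp
    then show "a \<in> k ` mod_hom A M M" using f(1) by blast
  qed (use k in auto)
  have "bij_betw (t \<circ> k) (carrier (End_alg A M)) (carrier A)"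
    using bij_betw_trans[OF k_bij bij] by (simp add: End_alg_def)
  moreover have "t \<circ> k \<in> ring_hom (End_alg A M) A"
  proof (rule ring_hom_memI)
    fix f g assume fg: "f \<in> carrier (End_alg A M)" "g \<in> carrier (End_alg A M)"
    then have fg': "f \<in> mod_hom A M M" "g \<in> mod_hom A M M" by (auto simp: End_alg_def)
    \<comment> \<open>\<open>f (g u)\<close> is \<open>k g\<close> acting on \<open>f u\<close>,
      hence \<open>k g\<close> times \<open>k f\<close> acting on \<open>u\<close>; applying
      \<open>t\<close> restores the order.\<close>
    have "k (compose (carrier M) f g) = k g \<otimes> k f"
      using k[OF fg'(1)] k[OF fg'(2)] uM
      by (intro kI) (auto simp: compose_def mod_hom_act[OF fg'(1)] M.act_assoc)
    then show "(t \<circ> k) (f \<otimes>\<^bsub>End_alg A M\<^esub> g) = (t \<circ> k) f \<otimes> (t \<circ> k) g"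
      using k(1) fg' by (simp add: End_alg_def anti)
    have "k (\<lambda>x\<in>carrier M. f x \<oplus>\<^bsub>M\<^esub> g x) = k f \<oplus> k g"
      using k[OF fg'(1)] k[OF fg'(2)] uM by (intro kI) (auto simp: M.act_l_distr)
    then show "(t \<circ> k) (f \<oplus>\<^bsub>End_alg A M\<^esub> g) = (t \<circ> k) f \<oplus> (t \<circ> k) g"
      using k(1) fg' by (simp add: End_alg_def add)
  next
    have "k (\<lambda>x\<in>carrier M. x) = \<one>" using uM by (intro kI) (auto simp: M.act_one)
    then show "(t \<circ> k) \<one>\<^bsub>End_alg A M\<^esub> = \<one>" by (simp add: End_alg_def one)
  qed (use k tc in \<open>auto simp: End_alg_def\<close>)
  moreover have "(t \<circ> k) (c \<odot>\<^bsub>End_alg A M\<^esub> f) = c \<odot> (t \<circ> k) f"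
    if "f \<in> carrier (End_alg A M)" for c f
  proof -
    have f: "f \<in> mod_hom A M M" using that by (simp add: End_alg_def)
    have "k (\<lambda>x\<in>carrier M. scal A M c (f x)) = (c \<odot> \<one>) \<otimes> k f"
      using k[OF f] uM by (intro kI) (auto simp: scal_def M.act_assoc scalar_closed)
    also have "\<dots> = c \<odot> k f" by (rule smult_eq[OF k(1)[OF f], symmetric])
    finally show ?thesis using k[OF f] by (simp add: End_alg_def smult)
  qed
  ultimately show ?thesis unfolding alg_iso_def ring_iso_def
    by (intro bexI[of _ "t \<circ> k"] ballI allI CollectI conjI)
qed


section \<open>Algebras with two vertices\<close>

text \<open>
  A basic algebra with two primitive orthogonal idempotents whose local corner rings
  \<open>e r A e r\<close> have residue field \<open>\<complex>\<close>; the residue maps extend to the characters \<open>chi r\<close> of \<open>A\<close>.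
\<close>

locale two_vertex_algebra = complex_algebra A for A :: "(complex, 'a) module" (structure) +
  fixes e :: "bool \<Rightarrow> 'a" and chi :: "bool \<Rightarrow> 'a \<Rightarrow> complex"
  assumes fin_dim_regular: "fin_dim A (regular_module A)"
    and e_closed: "e r \<in> carrier A"
    and e_idem: "e r \<otimes> e r = e r"
    and e_sum: "e False \<oplus> e True = \<one>"
    and chi_add: "a \<in> carrier A \<Longrightarrow> b \<in> carrier A \<Longrightarrow> chi r (a \<oplus> b) = chi r a + chi r b"
    and chi_mult: "a \<in> carrier A \<Longrightarrow> b \<in> carrier A \<Longrightarrow> chi r (a \<otimes> b) = chi r a * chi r b"
    and chi_e: "chi r (e s) = (if r = s then 1 else 0)"
    and chi_scalar: "chi r (c \<odot> \<one>) = c"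
    and corner_nilpotent: "a \<in> carrier A \<Longrightarrow> e r \<otimes> a = a \<Longrightarrow> a \<otimes> e r = a \<Longrightarrow> chi r a = 0 \<Longrightarrow>
      \<exists>n::nat. a [^] n = \<zero>"
begin

section \<open>Characters and the corner rings\<close>

lemma chi_one: "chi r \<one> = 1"
  using chi_scalar[of r 1] by (simp add: scalar_one)

lemma chi_zero: "chi r \<zero> = 0"
  using chi_add[of \<zero> \<zero> r] by simp

lemma chi_minus: "a \<in> carrier A \<Longrightarrow> chi r (\<ominus> a) = - chi r a"
  using chi_add[of a "\<ominus> a" r] by (simp add: r_neg chi_zero add_eq_0_iff)

lemma chi_diff: "a \<in> carrier A \<Longrightarrow> b \<in> carrier A \<Longrightarrow> chi r (a \<ominus> b) = chi r a - chi r b"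
  by (simp add: a_minus_def chi_add chi_minus)

lemma chi_corner: "a \<in> carrier A \<Longrightarrow> chi r (e r \<otimes> a \<otimes> e r) = chi r a"
  by (simp add: chi_mult chi_e e_closed)

lemma e_orthogonal:
  assumes "r \<noteq> s"
  shows "e r \<otimes> e s = \<zero>"
proof -
  have 1: "e r \<oplus> e s = \<one>"
    using assms e_sum a_comm[OF e_closed e_closed] by (cases r; cases s) auto
  have "e r \<oplus> e r \<otimes> e s = e r \<otimes> (e r \<oplus> e s)"
    by (simp add: r_distr e_closed e_idem)
  then have "e r \<oplus> e r \<otimes> e s = e r" by (simp add: 1 e_closed)
  then show ?thesis by (simp add: e_closed)
qed

text \<open>\<open>b\<close> is the partial sum \<open>e r + d + ... + d^(k-1)\<close> of the
  geometric series in the corner ring, whose unit is \<open>e r\<close>. The factor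
  \<open>e r\<close> behind the power matters for \<open>k = 0\<close>, where the power is the unit
  of the whole algebra.\<close>

lemma geometric_series:
  assumes d: "d \<in> carrier A" "e r \<otimes> d = d" "d \<otimes> e r = d"
  shows "\<exists>b\<in>carrier A. e r \<otimes> b = b \<and> b \<otimes> e r = b \<and>
    b \<otimes> (e r \<ominus> d) = e r \<ominus> d [^] (k::nat) \<otimes> e r"
proof (induction k)
  case 0
  then show ?case
    using d(1) by (intro bexI[of _ \<zero>]) (auto simp: e_closed a_minus_def r_neg)
next
  case (Suc k)
  then obtain b where b: "b \<in> carrier A" "e r \<otimes> b = b" "b \<otimes> e r = b"
    "b \<otimes> (e r \<ominus> d) = e r \<ominus> d [^] k \<otimes> e r"
    by blast
  note cl = e_closed d(1) b(1)
  \<comment> \<open>Multiplying a partial sum by \<open>d\<close> shifts it by one term, so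
    \<open>e r + d b\<close> is the next partial sum.\<close>
  have "(e r \<oplus> d \<otimes> b) \<otimes> (e r \<ominus> d) = e r \<otimes> (e r \<ominus> d) \<oplus> d \<otimes> (b \<otimes> (e r \<ominus> d))"
    using cl by (simp add: l_distr m_assoc)
  also have "e r \<otimes> (e r \<ominus> d) = e r \<ominus> d"
    using cl d by (simp add: a_minus_def r_distr r_minus e_idem)
  also have "d \<otimes> (b \<otimes> (e r \<ominus> d)) = d \<ominus> d [^] Suc k \<otimes> e r"
    unfolding b(4) using cl d
    by (simp add: a_minus_def r_distr r_minus m_assoc[symmetric] nat_pow_Suc2[symmetric]
      del: nat_pow_Suc)
  also have "(e r \<ominus> d) \<oplus> (d \<ominus> d [^] Suc k \<otimes> e r) = e r \<ominus> d [^] Suc k \<otimes> e r"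
    using cl by (simp add: a_minus_def a_assoc r_neg1 del: nat_pow_Suc)
  finally have "(e r \<oplus> d \<otimes> b) \<otimes> (e r \<ominus> d) = e r \<ominus> d [^] Suc k \<otimes> e r" .
  moreover have "e r \<otimes> (e r \<oplus> d \<otimes> b) = e r \<oplus> d \<otimes> b" "(e r \<oplus> d \<otimes> b) \<otimes> e r = e r \<oplus> d \<otimes> b"
    using cl d b by (simp_all add: r_distr l_distr e_idem m_assoc[symmetric])
      (simp add: m_assoc)
  ultimately show ?case using cl by (intro bexI[of _ "e r \<oplus> d \<otimes> b"]) auto
qed

text \<open>Locality of the corner ring. Rescaling \<open>a\<close> to have value one under
  \<open>chi r\<close> puts \<open>d = e r - t a\<close> into the kernel of \<open>chi r\<close>, so
  \<open>d\<close> is nilpotent. The geometric series of \<open>d\<close> then inverts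
  \<open>t a\<close> from the left.\<close>

lemma corner_inverse:
  assumes a: "a \<in> carrier A" "e r \<otimes> a = a" "a \<otimes> e r = a" and "chi r a \<noteq> 0"
  shows "\<exists>b\<in>carrier A. e r \<otimes> b = b \<and> b \<otimes> e r = b \<and> b \<otimes> a = e r"
proof -
  define t where "t = inverse (chi r a) \<odot> \<one>"
  have t: "t \<in> carrier A" "chi r t * chi r a = 1" "\<And>x. x \<in> carrier A \<Longrightarrow> t \<otimes> x = x \<otimes> t"
    using assms by (auto simp: t_def scalar_closed chi_scalar scalar_commute)
  note cl = e_closed[of r] a(1) t(1)
  have et: "e r \<otimes> (t \<otimes> a) = t \<otimes> a"
    using cl a(2) t(3)[of "e r"] by (metis m_assoc)
  have te: "(t \<otimes> a) \<otimes> e r = t \<otimes> a"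
    using cl a(3) by (simp add: m_assoc)
  define d where "d = e r \<ominus> t \<otimes> a"
  have d: "d \<in> carrier A" "e r \<otimes> d = d" "d \<otimes> e r = d"
    using cl et te by (simp_all add: d_def a_minus_def r_distr l_distr r_minus l_minus e_idem)
  have "chi r d = 0"
    using cl t(2) by (simp add: d_def chi_diff chi_mult chi_e)
  then obtain n :: nat where n: "d [^] n = \<zero>" using corner_nilpotent d by blast
  obtain b where b: "b \<in> carrier A" "e r \<otimes> b = b" "b \<otimes> e r = b" "b \<otimes> (e r \<ominus> d) = e r \<ominus> \<zero> \<otimes> e r"
    using geometric_series[OF d, of n] n by auto
  have "e r \<ominus> d = t \<otimes> a"
    using cl by (simp add: d_def a_minus_def minus_add r_neg1 a_assoc[symmetric] r_neg)
  then have "(t \<otimes> b) \<otimes> a = e r"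
    using b cl t(3)[of b] by (simp add: m_assoc a_minus_def)
  moreover have "e r \<otimes> (t \<otimes> b) = t \<otimes> b" "(t \<otimes> b) \<otimes> e r = t \<otimes> b"
    using b cl t(3)[of "e r"] by (metis m_assoc)+
  ultimately show ?thesis using b cl by (intro bexI[of _ "t \<otimes> b"]) auto
qed

text \<open>If \<open>chi r a\<close> vanishes, \<open>a\<close> is nilpotent and equal to all its
  positive powers. Otherwise \<open>a\<close> has a left inverse, and cancelling it in
  \<open>a a = a\<close> leaves \<open>e r\<close>.\<close>

lemma corner_idempotent:
  assumes a: "a \<in> carrier A" "e r \<otimes> a = a" "a \<otimes> e r = a" "a \<otimes> a = a"
  shows "a = \<zero> \<or> a = e r"
proof (cases "chi r a = 0")
  case True
  then obtain n :: nat where n: "a [^] n = \<zero>" using corner_nilpotent a by blast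
  have "a [^] Suc k = a" for k by (induction k) (use a in auto)
  from this[of n] n a show ?thesis by simp
next
  case False
  then obtain b where b: "b \<in> carrier A" "b \<otimes> a = e r" using corner_inverse a by blast
  have "e r \<otimes> a = b \<otimes> (a \<otimes> a)" unfolding b(2)[symmetric] using a(1) b(1) by (simp add: m_assoc)
  then show ?thesis using a b by simp
qed

section \<open>The modules \<open>A e r\<close>: indecomposable and pairwise non-isomorphic\<close>

lemma e_nonzero: "e r \<noteq> \<zero>"
  using chi_e[of r r] chi_zero[of r] by auto

text \<open>Any coefficient \<open>a\<close> of \<open>x\<close> can be compressed to
  \<open>e s a e r\<close>, since \<open>x\<close> is fixed by \<open>e s\<close> and
  \<open>u\<close> by \<open>e r\<close>. Together with uniqueness of coefficients this identifies
  the vectors of \<open>A e r\<close> fixed by \<open>e s\<close> with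
  \<open>e s A e r\<close>.\<close>

lemma principal_corner_coeff:
  assumes M: "left_module A M" and u: "principal_module A M (e r) u"
    and x: "x \<in> carrier M" "e s \<odot>\<^bsub>M\<^esub> x = x"
  shows "\<exists>a\<in>carrier A. e s \<otimes> a = a \<and> a \<otimes> e r = a \<and> x = a \<odot>\<^bsub>M\<^esub> u"
proof -
  interpret M: left_module A M by fact
  obtain a where a: "a \<in> carrier A" "x = a \<odot>\<^bsub>M\<^esub> u" using principalE[OF u x(1)] .
  note ug = principal_generator[OF u]
  have "x = (e s \<otimes> a \<otimes> e r) \<odot>\<^bsub>M\<^esub> u"
    using a x(2) ug by (simp add: M.act_assoc e_closed M.act_closed)
  moreover have "e s \<otimes> (e s \<otimes> a \<otimes> e r) = e s \<otimes> a \<otimes> e r"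
    using a e_closed by (simp add: m_assoc[symmetric] e_idem)
  moreover have "(e s \<otimes> a \<otimes> e r) \<otimes> e r = e s \<otimes> a \<otimes> e r"
    using a e_closed by (simp add: m_assoc e_idem)
  ultimately show ?thesis using a e_closed by (intro bexI[of _ "e s \<otimes> a \<otimes> e r"]) auto
qed

lemma principal_coeff_eqI:
  assumes M: "left_module A M" and u: "principal_module A M (e r) u"
    and a: "a \<in> carrier A" "a \<otimes> e r = a" and b: "b \<in> carrier A" "b \<otimes> e r = b"
    and eq: "a \<odot>\<^bsub>M\<^esub> u = b \<odot>\<^bsub>M\<^esub> u"
  shows "a = b"
proof -
  interpret M: left_module A M by fact
  have "(a \<ominus> b) \<odot>\<^bsub>M\<^esub> u = \<zero>\<^bsub>M\<^esub>"
    using a b eq M.diff_act[of a b u] principal_generator(1)[OF u]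
    by (simp add: M.act_closed M.r_neg a_minus_def)
  then have "(a \<ominus> b) \<otimes> e r = \<zero>" using u a(1) b(1) by (auto simp: principal_module_def)
  then have "a \<ominus> b = \<zero>" using a b e_closed by (simp add: a_minus_def l_distr l_minus)
  then show ?thesis using a b minus_equality[of a "\<ominus> b"] by (simp add: a_minus_def)
qed

lemma principal_not_zero:
  assumes M: "left_module A M" and u: "principal_module A M (e r) u"
  shows "u \<noteq> \<zero>\<^bsub>M\<^esub>"
proof
  interpret M: left_module A M by fact
  assume "u = \<zero>\<^bsub>M\<^esub>"
  then have "\<one> \<otimes> e r = \<zero>" using u M.act_zero[of \<one>] by (auto simp: principal_module_def)
  then show False using e_nonzero e_closed by simp
qed

text \<open>A decomposition produces an idempotent of the corner ring. If \<open>u\<close>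
  corresponds to the pair \<open>(x, y)\<close>, the vector corresponding to \<open>(x, 0)\<close>
  is \<open>a u\<close> with \<open>a\<close> in the corner. Then \<open>a\<close> fixes
  \<open>x\<close> and kills \<open>y\<close>, which makes it idempotent. So \<open>a\<close> is
  zero or \<open>e r\<close>, hence \<open>x\<close> or \<open>y\<close> vanishes, and with it the
  summand that this component generates.\<close>

lemma principal_indecomposable:
  assumes P: "P \<in> Rep A" and u: "principal_module A P (e r) u"
  shows "indecomposable A P"
  unfolding indecomposable_def
proof (intro conjI ballI impI)
  have lP: "left_module A P" using P by (simp add: Rep_def)
  interpret P: left_module A P by fact
  note ug = principal_generator[OF u]
  show "\<not> zero_module P"
    using ug principal_not_zero[OF lP u] by (auto simp: zero_module_def)
  fix X Y assume XY: "X \<in> Rep A" "Y \<in> Rep A" and "mod_iso A P (direct_sum [X, Y])"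
  then obtain f where f: "f \<in> mod_hom A P (direct_sum [X, Y])"
    and bij: "bij_betw f (carrier P) (carrier (direct_sum [X, Y]))"
    unfolding mod_iso_def by blast
  have lX: "left_module A X" "left_module A Y" using XY by (auto simp: Rep_def)
  interpret X: left_module A X by fact
  interpret Y: left_module A Y by fact
  have comp: "z 0 \<in> carrier X" "z 1 \<in> carrier Y" if "z \<in> carrier (direct_sum [X, Y])" for z
    using PiE_mem[of z "{..<2}" "\<lambda>i. carrier ([X, Y] ! i)" 0]
      PiE_mem[of z "{..<2}" "\<lambda>i. carrier ([X, Y] ! i)" 1] that
    by (simp_all add: direct_sum_simps numeral_2_eq_2)
  have act0: "f (a \<odot>\<^bsub>P\<^esub> x) 0 = a \<odot>\<^bsub>X\<^esub> f x 0" and act1: "f (a \<odot>\<^bsub>P\<^esub> x) 1 = a \<odot>\<^bsub>Y\<^esub> f x 1"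
    if "a \<in> carrier A" "x \<in> carrier P" for a x
    by (simp_all add: mod_hom_act[OF f that] direct_sum_simps)
  have inj: "x = y" if "x \<in> carrier P" "y \<in> carrier P" "f x 0 = f y 0" "f x 1 = f y 1" for x y
  proof (rule inj_onD[OF bij_betw_imp_inj_on[OF bij] _ that(1,2)])
    show "f x = f y"
      using that by (intro direct_sum_pair_eqI[OF mod_hom_closed[OF f] mod_hom_closed[OF f]]) auto
  qed
  have surj: "\<exists>p\<in>carrier P. f p 0 = x \<and> f p 1 = y" if "x \<in> carrier X" "y \<in> carrier Y" for x y
  proof -
    have "(\<lambda>i\<in>{..<2}. if i = 0 then x else y) \<in> f ` carrier P"
      using direct_sum_pair[OF that] bij_betw_imp_surj_on[OF bij] by simp
    then obtain p where "p \<in> carrier P" "f p = (\<lambda>i\<in>{..<2}. if i = 0 then x else y)"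
      by (elim imageE) metis
    then show ?thesis by (intro bexI[of _ p]) auto
  qed
  define x y where "x = f u 0" and "y = f u 1"
  have xy: "x \<in> carrier X" "y \<in> carrier Y" "e r \<odot>\<^bsub>X\<^esub> x = x" "e r \<odot>\<^bsub>Y\<^esub> y = y"
    using comp[OF mod_hom_closed[OF f ug(1)]] act0[OF e_closed ug(1), of r] act1[OF e_closed ug(1), of r] ug(2)
    unfolding x_def y_def by simp_all
  obtain z where z: "z \<in> carrier P" "f z 0 = x" "f z 1 = \<zero>\<^bsub>Y\<^esub>"
    using surj[OF xy(1) Y.M.zero_closed] by blast
  have "e r \<odot>\<^bsub>P\<^esub> z = z"
  proof (rule inj)
    show "f (e r \<odot>\<^bsub>P\<^esub> z) 0 = f z 0" unfolding act0[OF e_closed z(1)] z(2) by (rule xy(3))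
    show "f (e r \<odot>\<^bsub>P\<^esub> z) 1 = f z 1"
      unfolding act1[OF e_closed z(1)] z(3) by (rule Y.act_zero[OF e_closed])
  qed (use z e_closed P.act_closed in auto)
  then obtain a where a: "a \<in> carrier A" "e r \<otimes> a = a" "a \<otimes> e r = a" "z = a \<odot>\<^bsub>P\<^esub> u"
    using principal_corner_coeff[OF lP u z(1)] by blast
  have ax: "a \<odot>\<^bsub>X\<^esub> x = x" "a \<odot>\<^bsub>Y\<^esub> y = \<zero>\<^bsub>Y\<^esub>"
    using z(2,3) unfolding a(4) act0[OF a(1) ug(1)] act1[OF a(1) ug(1)]
    by (simp_all add: x_def y_def)
  have "a \<odot>\<^bsub>P\<^esub> z = z"
  proof (rule inj)
    show "f (a \<odot>\<^bsub>P\<^esub> z) 0 = f z 0" unfolding act0[OF a(1) z(1)] z(2) by (rule ax(1))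
    show "f (a \<odot>\<^bsub>P\<^esub> z) 1 = f z 1"
      unfolding act1[OF a(1) z(1)] z(3) by (rule Y.act_zero[OF a(1)])
  qed (use z a(1) P.act_closed in auto)
  then have "a \<otimes> a = a"
    using principal_coeff_eqI[OF lP u, of "a \<otimes> a" a] a P.act_assoc[OF a(1) a(1) ug(1)]
    by (simp add: m_assoc e_closed)
  then consider "a = \<zero>" | "a = e r" using corner_idempotent a by blast
  then show "zero_module X \<or> zero_module Y"
  proof cases
    case 1
    then have x0: "x = \<zero>\<^bsub>X\<^esub>" using ax(1) X.zero_act xy by simp
    have "w = \<zero>\<^bsub>X\<^esub>" if w: "w \<in> carrier X" for w
    proof -
      obtain p where p: "p \<in> carrier P" "f p 0 = w" using surj[OF w Y.M.zero_closed] by blast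
      obtain b where "b \<in> carrier A" "p = b \<odot>\<^bsub>P\<^esub> u" using principalE[OF u p(1)] .
      then show ?thesis using p act0 ug(1) x0 by (auto simp: x_def X.act_zero)
    qed
    then show ?thesis by (auto simp: zero_module_def)
  next
    case 2
    then have y0: "y = \<zero>\<^bsub>Y\<^esub>" using ax(2) xy by simp
    have "w = \<zero>\<^bsub>Y\<^esub>" if w: "w \<in> carrier Y" for w
    proof -
      obtain p where p: "p \<in> carrier P" "f p 1 = w" using surj[OF X.M.zero_closed w] by blast
      obtain b where "b \<in> carrier A" "p = b \<odot>\<^bsub>P\<^esub> u" using principalE[OF u p(1)] .
      then show ?thesis using p act1 ug(1) y0 by (auto simp: y_def Y.act_zero simp del: One_nat_def)
    qed
    then show ?thesis by (auto simp: zero_module_def)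
  qed
qed (rule P)

text \<open>An isomorphism would give one module generators of both types. Expressing each through
  the other yields \<open>a\<close> in \<open>e r A e s\<close> and \<open>b\<close> with
  \<open>a b = e r\<close>. For \<open>r \<noteq> s\<close> this contradicts \<open>chi r\<close>,
  which takes the value 1 on \<open>e r\<close> but vanishes on \<open>a = a e s\<close>.\<close>

lemma principal_not_iso:
  assumes M: "left_module A M" and N: "left_module A N"
    and u: "principal_module A M (e r) u" and v: "principal_module A N (e s) v" and "mod_iso A M N"
  shows "r = s"
proof (rule ccontr)
  assume "r \<noteq> s"
  interpret M: left_module A M by fact
  obtain v' where v': "principal_module A M (e s) v'"
    using principal_transport[OF N M v e_closed mod_iso_sym[OF M \<open>mod_iso A M N\<close>]] by blast
  note ug = principal_generator[OF u] and vg = principal_generator[OF v']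
  obtain a where a: "a \<in> carrier A" "e r \<otimes> a = a" "a \<otimes> e s = a" "u = a \<odot>\<^bsub>M\<^esub> v'"
    using principal_corner_coeff[OF M v' ug(1) ug(2)] by blast
  obtain b where b: "b \<in> carrier A" "e s \<otimes> b = b" "b \<otimes> e r = b" "v' = b \<odot>\<^bsub>M\<^esub> u"
    using principal_corner_coeff[OF M u vg(1) vg(2)] by blast
  have "a \<otimes> b = e r"
  proof (rule principal_coeff_eqI[OF M u])
    show "(a \<otimes> b) \<odot>\<^bsub>M\<^esub> u = e r \<odot>\<^bsub>M\<^esub> u"
      using a b ug by (metis M.act_assoc)
  qed (use a b e_closed e_idem m_assoc in auto)
  then have "chi r a * chi r b = 1" using a b chi_mult[of a b r] chi_e by simp
  moreover have "chi r a = chi r a * chi r (e s)" using chi_mult[of a "e s" r] a e_closed by simp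
  ultimately show False using \<open>r \<noteq> s\<close> chi_e by simp
qed

text \<open>The witness is a copy of the left ideal \<open>A e r\<close>, which is
  finite-dimensional as the image of the regular module under right multiplication by
  \<open>e r\<close>.\<close>

lemma principal_exists: "\<exists>P u. P \<in> Rep A \<and> principal_module A P (e r) u"
proof -
  let ?L = "regular_module A\<lparr>carrier := (\<lambda>a. a \<otimes> e r) ` carrier A\<rparr>"
  have L: "left_module A ?L" by (rule left_module_left_ideal[OF e_closed])
  have "(\<lambda>a\<in>carrier A. a \<otimes> e r) \<in> mod_hom A (regular_module A) ?L"
    by (rule mod_homI) (auto simp: regular_module_def l_distr m_assoc e_closed)
  then have "fin_dim A ?L"
    by (rule fin_dim_image[OF left_module_regular L fin_dim_regular]) (simp add: regular_module_def)
  then obtain P where P: "P \<in> Rep A" "mod_iso A ?L P" using iso_Rep[OF L] by blast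
  then have "left_module A P" by (simp add: Rep_def)
  then show ?thesis
    using principal_transport[OF L _ principal_left_ideal[OF e_closed e_idem] e_closed P(2)] P(1)
    by blast
qed

section \<open>Simple modules and the shape of indecomposable projectives\<close>

text \<open>The line is realized by the constant functions, since objects of \<open>Rep A\<close> live in \<open>nat \<Rightarrow> complex\<close>.\<close>

definition simple_module :: "bool \<Rightarrow> 'a rep" where
  "simple_module r = \<lparr>carrier = range (\<lambda>c _. c), mult = undefined, one = undefined,
    zero = (\<lambda>_. 0), add = (\<lambda>x y i. x i + y i), smult = (\<lambda>a x i. chi r a * x i)\<rparr>"

lemma left_module_simple: "left_module A (simple_module r)"
proof -
  have neg: "\<exists>d. (\<lambda>_::nat. c + d) = (\<lambda>_. 0)" for c :: complex
    by (intro exI[of _ "- c"]) auto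
  interpret V: abelian_group "simple_module r"
    by (rule abelian_groupI) (auto simp: simple_module_def algebra_simps neg)
  show ?thesis
    by unfold_locales
      (auto simp: simple_module_def chi_add chi_mult chi_one algebra_simps)
qed

lemma simple_module_Rep: "simple_module r \<in> Rep A"
proof -
  interpret V: left_module A "simple_module r" by (rule left_module_simple)
  have "x \<in> coeff_span scalars (simple_module r) {\<lambda>_. 1}" if x: "x \<in> carrier (simple_module r)" for x
  proof -
    obtain c where c: "x = (\<lambda>_. c)" using x by (auto simp: simple_module_def)
    have "x = (c \<odot> \<one>) \<odot>\<^bsub>simple_module r\<^esub> (\<lambda>_. 1) \<oplus>\<^bsub>simple_module r\<^esub> \<zero>\<^bsub>simple_module r\<^esub>"
      by (simp add: c simple_module_def chi_scalar)
    then show ?thesis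
      by (metis coeff_span.step[OF _ singletonI coeff_span.zero] rangeI scalars_def)
  qed
  moreover have "(\<lambda>_. 1) \<in> carrier (simple_module r)" by (auto simp: simple_module_def)
  ultimately have "fin_dim A (simple_module r)"
    unfolding fin_dim_iff[OF left_module_simple] by (intro exI[of _ "{\<lambda>_. 1}"]) auto
  then show ?thesis by (simp add: Rep_def left_module_simple)
qed

text \<open>
  Given a generating set of minimal size consisting of vectors in some \<open>e s Q\<close>, the coefficient
  at one of its members is well defined modulo the kernel of \<open>chi r\<close>: otherwise that member
  would be redundant by \<open>corner_inverse\<close>.
\<close>

lemma hom_to_simple_exists:
  assumes Q: "Q \<in> Rep A" "\<not> zero_module Q"
  shows "\<exists>r. \<exists>f\<in>mod_hom A Q (simple_module r). \<exists>q\<in>carrier Q. e r \<odot>\<^bsub>Q\<^esub> q = q \<and> f q = (\<lambda>_. 1)"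
proof -
  have lQ: "left_module A Q" "fin_dim A Q" using Q by (auto simp: Rep_def)
  interpret Q: left_module A Q by fact
  let ?sp = "coeff_span (carrier A) Q"
  define hom where "hom = {q\<in>carrier Q. \<exists>r. e r \<odot>\<^bsub>Q\<^esub> q = q}"
  define generating where "generating S \<longleftrightarrow> finite S \<and> S \<subseteq> hom \<and> carrier Q \<subseteq> ?sp S" for S
  obtain T where T: "finite T" "T \<subseteq> carrier Q" "carrier Q \<subseteq> coeff_span scalars Q T"
    using lQ(2) unfolding fin_dim_iff[OF lQ(1)] by (elim exE conjE)
  \<comment> \<open>Every spanning vector is replaced by its two components under the idempotents.
    They still generate because the idempotents sum to one, and each of them lies in
    \<open>hom\<close>.\<close>
  let ?T = "(\<lambda>(r, s). e r \<odot>\<^bsub>Q\<^esub> s) ` (UNIV \<times> T)"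
  have Tc: "?T \<subseteq> carrier Q" using T(2) by (auto intro: Q.act_closed e_closed)
  have "x \<in> ?sp ?T" if "x \<in> coeff_span scalars Q T" for x
    using that
  proof induction
    case (step a s x)
    then have cl: "a \<in> carrier A" "s \<in> carrier Q" using scalars_subset T by auto
    have x: "x \<in> carrier Q" using Q.coeff_span_closed[OF step(3)] scalars_subset T by auto
    have "a \<odot>\<^bsub>Q\<^esub> s = a \<odot>\<^bsub>Q\<^esub> ((e False \<oplus> e True) \<odot>\<^bsub>Q\<^esub> s)"
      using cl by (simp add: e_sum Q.act_one)
    then have "a \<odot>\<^bsub>Q\<^esub> s = a \<odot>\<^bsub>Q\<^esub> (e False \<odot>\<^bsub>Q\<^esub> s) \<oplus>\<^bsub>Q\<^esub> a \<odot>\<^bsub>Q\<^esub> (e True \<odot>\<^bsub>Q\<^esub> s)"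
      using cl by (simp add: Q.act_l_distr Q.act_r_distr e_closed Q.act_closed)
    then have "a \<odot>\<^bsub>Q\<^esub> s \<oplus>\<^bsub>Q\<^esub> x =
        a \<odot>\<^bsub>Q\<^esub> (e False \<odot>\<^bsub>Q\<^esub> s) \<oplus>\<^bsub>Q\<^esub> (a \<odot>\<^bsub>Q\<^esub> (e True \<odot>\<^bsub>Q\<^esub> s) \<oplus>\<^bsub>Q\<^esub> x)"
      using cl x by (simp add: Q.M.a_assoc e_closed Q.act_closed)
    then show ?case
      using cl step by (auto intro!: coeff_span.step)
  qed (rule coeff_span.zero)
  moreover have "?T \<subseteq> hom"
    using Tc T(2) Q.act_assoc[OF e_closed e_closed] e_idem
    by (auto simp: hom_def) (metis subsetD)
  ultimately have "generating ?T" using T by (auto simp: generating_def)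
  then obtain S where S: "generating S" "\<And>S'. generating S' \<Longrightarrow> card S \<le> card S'"
    using ex_has_least_nat[of generating _ card] by blast
  have Sc: "finite S" "S \<subseteq> carrier Q" "carrier Q \<subseteq> ?sp S" using S(1) by (auto simp: generating_def hom_def)
  have "S \<noteq> {}"
  proof
    assume "S = {}"
    then have "?sp S \<subseteq> {\<zero>\<^bsub>Q\<^esub>}" by (auto elim: coeff_span.cases)
    then show False using Sc(3) Q by (auto simp: zero_module_def)
  qed
  then obtain q where "q \<in> S" by blast
  moreover have "q \<in> hom" using S(1) \<open>q \<in> S\<close> by (auto simp: generating_def)
  ultimately obtain r where q: "q \<in> S" "q \<in> carrier Q" "e r \<odot>\<^bsub>Q\<^esub> q = q"
    by (auto simp: hom_def)
  let ?N = "?sp (S - {q})"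
  have Nc: "S - {q} \<subseteq> carrier Q" using Sc by auto
  note N_cl = Q.coeff_span_closed[OF _ order_refl Nc]
    and N_add = Q.coeff_span_add[OF _ _ order_refl Nc]
    and N_act = Q.coeff_span_act[OF _ _ order_refl Nc m_closed]
  have split: "\<exists>a\<in>carrier A. \<exists>y\<in>?N. x = a \<odot>\<^bsub>Q\<^esub> q \<oplus>\<^bsub>Q\<^esub> y" if "x \<in> ?sp S" for x
    using that
  proof induction
    case zero
    then show ?case
      using q by (intro bexI[of _ \<zero>] bexI[of _ "\<zero>\<^bsub>Q\<^esub>"]) (auto simp: Q.zero_act coeff_span.zero)
  next
    case (step b s x)
    then obtain a y where ay: "a \<in> carrier A" "y \<in> ?N" "x = a \<odot>\<^bsub>Q\<^esub> q \<oplus>\<^bsub>Q\<^esub> y" by blast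
    have yc: "y \<in> carrier Q" "s \<in> carrier Q" using N_cl ay step Sc by auto
    show ?case
    proof (cases "s = q")
      case True
      then have "b \<odot>\<^bsub>Q\<^esub> s \<oplus>\<^bsub>Q\<^esub> x = (b \<oplus> a) \<odot>\<^bsub>Q\<^esub> q \<oplus>\<^bsub>Q\<^esub> y"
        using ay yc step q by (simp add: Q.act_l_distr Q.M.a_assoc Q.act_closed)
      then show ?thesis using ay step by blast
    next
      case False
      then have "b \<odot>\<^bsub>Q\<^esub> s \<oplus>\<^bsub>Q\<^esub> x = a \<odot>\<^bsub>Q\<^esub> q \<oplus>\<^bsub>Q\<^esub> (b \<odot>\<^bsub>Q\<^esub> s \<oplus>\<^bsub>Q\<^esub> y)"
        using ay yc step q by (simp add: Q.M.a_lcomm Q.act_closed)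
      moreover have "b \<odot>\<^bsub>Q\<^esub> s \<oplus>\<^bsub>Q\<^esub> y \<in> ?N"
        using False ay step by (intro coeff_span.step) auto
      ultimately show ?thesis using ay by blast
    qed
  qed
  have "q \<notin> ?N"
  proof
    assume qN: "q \<in> ?N"
    have "x \<in> ?N" if x: "x \<in> carrier Q" for x
    proof -
      have "x \<in> ?sp S" using x Sc by auto
      then obtain a y where "a \<in> carrier A" "y \<in> ?N" "x = a \<odot>\<^bsub>Q\<^esub> q \<oplus>\<^bsub>Q\<^esub> y"
        using split by blast
      then show ?thesis using N_add N_act qN by simp
    qed
    then have "generating (S - {q})" using S(1) by (auto simp: generating_def)
    then have "card S \<le> card (S - {q})" by (rule S(2))
    then show False using q Sc by (metis card_Diff1_less not_less)
  qed
  have uniq: "chi r a = chi r b"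
    if ab: "a \<in> carrier A" "b \<in> carrier A" "y \<in> ?N" "z \<in> ?N"
      "a \<odot>\<^bsub>Q\<^esub> q \<oplus>\<^bsub>Q\<^esub> y = b \<odot>\<^bsub>Q\<^esub> q \<oplus>\<^bsub>Q\<^esub> z" for a b y z
  proof (rule ccontr)
    assume "chi r a \<noteq> chi r b"
    have yz: "y \<in> carrier Q" "z \<in> carrier Q" using N_cl ab by auto
    have "(a \<ominus> b) \<odot>\<^bsub>Q\<^esub> q = z \<oplus>\<^bsub>Q\<^esub> (\<ominus> \<one>) \<odot>\<^bsub>Q\<^esub> y"
    proof -
      have "a \<odot>\<^bsub>Q\<^esub> q = (a \<odot>\<^bsub>Q\<^esub> q \<oplus>\<^bsub>Q\<^esub> y) \<oplus>\<^bsub>Q\<^esub> \<ominus>\<^bsub>Q\<^esub> y"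
        using ab(1) yz q by (simp add: Q.M.a_assoc Q.M.r_neg Q.act_closed)
      also have "\<dots> = b \<odot>\<^bsub>Q\<^esub> q \<oplus>\<^bsub>Q\<^esub> (z \<oplus>\<^bsub>Q\<^esub> \<ominus>\<^bsub>Q\<^esub> y)"
        unfolding ab(5) using ab(2) yz q by (simp add: Q.M.a_assoc Q.act_closed)
      finally have "a \<odot>\<^bsub>Q\<^esub> q = b \<odot>\<^bsub>Q\<^esub> q \<oplus>\<^bsub>Q\<^esub> (z \<oplus>\<^bsub>Q\<^esub> \<ominus>\<^bsub>Q\<^esub> y)" .
      then show ?thesis
        unfolding Q.diff_act[OF ab(1,2) q(2)] using ab(2) yz q
        by (simp add: Q.minus_act Q.act_one Q.act_closed a_minus_def Q.M.a_ac Q.M.r_neg2 Q.M.r_neg)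
    qed
    then have dN: "(a \<ominus> b) \<odot>\<^bsub>Q\<^esub> q \<in> ?N" using N_add N_act ab by simp
    \<comment> \<open>Compression to the corner preserves the value of \<open>chi r\<close>, and it
      keeps the product with \<open>q\<close> in \<open>?N\<close> because \<open>q\<close> is fixed
      by \<open>e r\<close>. Inverting \<open>?d\<close> in the corner then puts \<open>q\<close>
      itself into \<open>?N\<close>.\<close>
    let ?d = "e r \<otimes> (a \<ominus> b) \<otimes> e r"
    have d: "?d \<in> carrier A" "e r \<otimes> ?d = ?d" "?d \<otimes> e r = ?d"
      using ab(1,2) e_closed
      by (simp, simp add: m_assoc[symmetric] e_idem, simp add: m_assoc e_idem)
    have "chi r ?d \<noteq> 0"
      using \<open>chi r a \<noteq> chi r b\<close> ab by (simp add: chi_corner chi_diff)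
    then obtain c where c: "c \<in> carrier A" "c \<otimes> ?d = e r" using corner_inverse[OF d] by blast
    have "?d \<odot>\<^bsub>Q\<^esub> q = e r \<odot>\<^bsub>Q\<^esub> ((a \<ominus> b) \<odot>\<^bsub>Q\<^esub> q)"
      using ab(1,2) q e_closed by (simp add: Q.act_assoc Q.act_closed)
    then have "?d \<odot>\<^bsub>Q\<^esub> q \<in> ?N" using dN N_act e_closed by simp
    then have "c \<odot>\<^bsub>Q\<^esub> (?d \<odot>\<^bsub>Q\<^esub> q) \<in> ?N" using c N_act by simp
    then have "q \<in> ?N" using c d(1) q Q.act_assoc[of c ?d q] by simp
    then show False using \<open>q \<notin> ?N\<close> by contradiction
  qed
  \<comment> \<open>\<open>k x\<close> is an arbitrary admissible coefficient at \<open>q\<close>;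
    by \<open>uniq\<close> its value under \<open>chi r\<close> does not depend on the
    choice.\<close>
  define k where "k x = (SOME a. a \<in> carrier A \<and> (\<exists>y\<in>?N. x = a \<odot>\<^bsub>Q\<^esub> q \<oplus>\<^bsub>Q\<^esub> y))" for x
  have k: "k x \<in> carrier A \<and> (\<exists>y\<in>?N. x = k x \<odot>\<^bsub>Q\<^esub> q \<oplus>\<^bsub>Q\<^esub> y)" if "x \<in> carrier Q" for x
    unfolding k_def by (rule someI_ex) (use split[of x] that Sc in blast)
  have kI: "chi r (k x) = chi r a" if "x \<in> carrier Q" "a \<in> carrier A" "y \<in> ?N" "x = a \<odot>\<^bsub>Q\<^esub> q \<oplus>\<^bsub>Q\<^esub> y"
    for x a y
    using k[OF that(1)] that uniq by metis
  let ?f = "\<lambda>x\<in>carrier Q. \<lambda>_::nat. chi r (k x)"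
  have f: "?f \<in> mod_hom A Q (simple_module r)"
  proof (rule mod_homI)
    fix x x' assume x: "x \<in> carrier Q" "x' \<in> carrier Q"
    obtain y y' where y: "y \<in> ?N" "x = k x \<odot>\<^bsub>Q\<^esub> q \<oplus>\<^bsub>Q\<^esub> y" and y': "y' \<in> ?N" "x' = k x' \<odot>\<^bsub>Q\<^esub> q \<oplus>\<^bsub>Q\<^esub> y'"
      using k x by blast
    note kc = k[OF x(1), THEN conjunct1] k[OF x(2), THEN conjunct1]
    have yc: "y \<in> carrier Q" "y' \<in> carrier Q" using N_cl y y' by auto
    have "(k x \<odot>\<^bsub>Q\<^esub> q \<oplus>\<^bsub>Q\<^esub> y) \<oplus>\<^bsub>Q\<^esub> (k x' \<odot>\<^bsub>Q\<^esub> q \<oplus>\<^bsub>Q\<^esub> y') = (k x \<oplus> k x') \<odot>\<^bsub>Q\<^esub> q \<oplus>\<^bsub>Q\<^esub> (y \<oplus>\<^bsub>Q\<^esub> y')"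
      using kc yc q by (simp add: Q.act_l_distr Q.act_closed Q.M.a_ac)
    then have "x \<oplus>\<^bsub>Q\<^esub> x' = (k x \<oplus> k x') \<odot>\<^bsub>Q\<^esub> q \<oplus>\<^bsub>Q\<^esub> (y \<oplus>\<^bsub>Q\<^esub> y')"
      unfolding y(2)[symmetric] y'(2)[symmetric] .
    then have "chi r (k (x \<oplus>\<^bsub>Q\<^esub> x')) = chi r (k x \<oplus> k x')"
      by (intro kI[OF Q.M.a_closed[OF x] a_closed[OF kc] N_add[OF y(1) y'(1)]])
    then show "?f (x \<oplus>\<^bsub>Q\<^esub> x') = ?f x \<oplus>\<^bsub>simple_module r\<^esub> ?f x'"
      using x kc by (simp add: simple_module_def chi_add)
  next
    fix a x assume a: "a \<in> carrier A" and x: "x \<in> carrier Q"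
    obtain y where y: "y \<in> ?N" "x = k x \<odot>\<^bsub>Q\<^esub> q \<oplus>\<^bsub>Q\<^esub> y" using k x by blast
    note kc = k[OF x, THEN conjunct1]
    have yc: "y \<in> carrier Q" using N_cl y by auto
    have "a \<odot>\<^bsub>Q\<^esub> (k x \<odot>\<^bsub>Q\<^esub> q \<oplus>\<^bsub>Q\<^esub> y) = (a \<otimes> k x) \<odot>\<^bsub>Q\<^esub> q \<oplus>\<^bsub>Q\<^esub> a \<odot>\<^bsub>Q\<^esub> y"
      using a kc yc q by (simp add: Q.act_r_distr Q.act_closed Q.act_assoc)
    then have "a \<odot>\<^bsub>Q\<^esub> x = (a \<otimes> k x) \<odot>\<^bsub>Q\<^esub> q \<oplus>\<^bsub>Q\<^esub> a \<odot>\<^bsub>Q\<^esub> y"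
      unfolding y(2)[symmetric] .
    then have "chi r (k (a \<odot>\<^bsub>Q\<^esub> x)) = chi r (a \<otimes> k x)"
      by (intro kI[OF Q.act_closed[OF a x] m_closed[OF a kc] N_act[OF y(1) a]])
    then show "?f (a \<odot>\<^bsub>Q\<^esub> x) = a \<odot>\<^bsub>simple_module r\<^esub> ?f x"
      using x kc a by (simp add: simple_module_def chi_mult Q.act_closed)
  qed (auto simp: simple_module_def)
  have "chi r (k q) = chi r \<one>"
    using q by (intro kI[of q \<one> "\<zero>\<^bsub>Q\<^esub>"]) (auto simp: Q.act_one coeff_span.zero)
  then have "?f q = (\<lambda>_. 1)" using q by (simp add: chi_one)
  then show ?thesis using f q by blast
qed

text \<open>An explicit form of Nakayama's argument shows that the lift is onto. It sends
  \<open>q\<close> to some \<open>a u\<close>, and comparing values in the simple module gives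
  \<open>chi r a = 1\<close>. So \<open>a\<close> is invertible in the corner, and a multiple
  \<open>v\<close> of \<open>q\<close> is a preimage of \<open>u\<close>; sending \<open>u\<close>
  to \<open>v\<close> splits the lift.\<close>

lemma indecomposable_projective_principal:
  assumes proj: "projective A Q" and ind: "indecomposable A Q"
  shows "\<exists>r v. principal_module A Q (e r) v"
proof -
  have Q: "Q \<in> Rep A" "\<not> zero_module Q" using ind by (auto simp: indecomposable_def)
  obtain r f q where f: "f \<in> mod_hom A Q (simple_module r)"
    and q: "q \<in> carrier Q" "e r \<odot>\<^bsub>Q\<^esub> q = q" "f q = (\<lambda>_. 1)"
    using hom_to_simple_exists[OF Q] by blast
  obtain P u where P: "P \<in> Rep A" "principal_module A P (e r) u" using principal_exists by blast
  have lm: "left_module A Q" "left_module A P" using Q P by (auto simp: Rep_def)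
  interpret Q: left_module A Q by fact
  interpret P: left_module A P by fact
  note ug = principal_generator[OF P(2)]
  have V1: "(\<lambda>_. 1) \<in> carrier (simple_module r)"
    "e r \<odot>\<^bsub>simple_module r\<^esub> (\<lambda>_. 1) = (\<lambda>_. 1)"
    by (auto simp: simple_module_def chi_e)
  obtain g where g: "g \<in> mod_hom A P (simple_module r)"
    "\<And>a. a \<in> carrier A \<Longrightarrow> g (a \<odot>\<^bsub>P\<^esub> u) = a \<odot>\<^bsub>simple_module r\<^esub> (\<lambda>_. 1)"
    using principal_mod_hom[OF lm(2) left_module_simple P(2) e_closed V1] by blast
  have "g ` carrier P = carrier (simple_module r)"
  proof
    show "carrier (simple_module r) \<subseteq> g ` carrier P"
    proof
      fix x assume "x \<in> carrier (simple_module r)"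
      then obtain c where "x = (\<lambda>_. c)" by (auto simp: simple_module_def)
      then have "x = g ((c \<odot> \<one>) \<odot>\<^bsub>P\<^esub> u)"
        by (simp add: g(2) scalar_closed) (simp add: simple_module_def chi_scalar)
      then show "x \<in> g ` carrier P" using ug by (auto intro!: P.act_closed scalar_closed)
    qed
  qed (use mod_hom_closed[OF g(1)] in blast)
  then obtain h where h: "h \<in> mod_hom A Q P" "compose (carrier Q) g h = f"
    using proj P(1) simple_module_Rep g(1) f unfolding projective_def by blast
  have "e r \<odot>\<^bsub>P\<^esub> h q = h q"
    using mod_hom_act[OF h(1) e_closed q(1), of r] q(2) by simp
  then obtain a where a: "a \<in> carrier A" "e r \<otimes> a = a" "a \<otimes> e r = a" "h q = a \<odot>\<^bsub>P\<^esub> u"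
    using principal_corner_coeff[OF lm(2) P(2) mod_hom_closed[OF h(1) q(1)]] by blast
  have "(\<lambda>_. 1) = (\<lambda>_::nat. chi r a)"
    using q h(2) a g(2)[OF a(1)] by (auto simp: compose_def simple_module_def)
  then have "chi r a \<noteq> 0" by (metis zero_neq_one)
  then obtain b where b: "b \<in> carrier A" "e r \<otimes> b = b" "b \<otimes> a = e r"
    using corner_inverse[OF a(1-3)] by blast
  define v where "v = b \<odot>\<^bsub>Q\<^esub> q"
  have v: "v \<in> carrier Q" "e r \<odot>\<^bsub>Q\<^esub> v = v"
    using b q Q.act_assoc[OF e_closed b(1) q(1), of r] by (auto simp: v_def Q.act_closed)
  have hv: "h v = u"
    using P.act_assoc[OF b(1) a(1) ug(1)] ug b(3) a(4) mod_hom_act[OF h(1) b(1) q(1)]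
    by (simp add: v_def)
  obtain k where k: "k \<in> mod_hom A P Q" "\<And>a. a \<in> carrier A \<Longrightarrow> k (a \<odot>\<^bsub>P\<^esub> u) = a \<odot>\<^bsub>Q\<^esub> v"
    using principal_mod_hom[OF lm(2,1) P(2) e_closed v] by blast
  have ku: "k u = v" using k(2)[OF e_closed[of r]] ug v by simp
  \<comment> \<open>\<open>h\<close> after \<open>k\<close> is the identity of \<open>P\<close>, so
    \<open>k\<close> after \<open>h\<close> is idempotent. It fixes the nonzero vector
    \<open>v\<close>, hence indecomposability makes it the identity of \<open>Q\<close>.\<close>
  let ?p = "compose (carrier Q) k h"
  have p: "?p \<in> mod_hom A Q Q" by (rule mod_hom_compose[OF lm(1) h(1) k(1)])
  have hk: "h (k z) = z" if "z \<in> carrier P" for z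
    using principalE[OF P(2) that] k(2) mod_hom_act[OF h(1) _ v(1)] hv by metis
  have idem: "?p (?p x) = ?p x" if "x \<in> carrier Q" for x
    using that mod_hom_closed[OF h(1) that] mod_hom_closed[OF k(1), of "h x"] hk[of "h x"]
    by (simp add: compose_def)
  have "v \<noteq> \<zero>\<^bsub>Q\<^esub>"
    using hv principal_not_zero[OF lm(2) P(2)] mod_hom_zero[OF lm h(1)] by auto
  moreover have "?p v = v" using v hv ku by (simp add: compose_def)
  ultimately have pid: "?p x = x" if "x \<in> carrier Q" for x
    using indecomposable_idempotent[OF ind p idem] v(1) that by force
  have "\<exists>c\<in>carrier A. x = c \<odot>\<^bsub>Q\<^esub> v" if x: "x \<in> carrier Q" for x
  proof -
    obtain c where c: "c \<in> carrier A" "h x = c \<odot>\<^bsub>P\<^esub> u"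
      using principalE[OF P(2) mod_hom_closed[OF h(1) x]] .
    then have "x = c \<odot>\<^bsub>Q\<^esub> v" using pid[OF x] x k(2) by (simp add: compose_def)
    with c show ?thesis by blast
  qed
  moreover have "c \<otimes> e r = \<zero>" if "c \<in> carrier A" "c \<odot>\<^bsub>Q\<^esub> v = \<zero>\<^bsub>Q\<^esub>" for c
  proof -
    have "c \<odot>\<^bsub>P\<^esub> u = \<zero>\<^bsub>P\<^esub>"
      using mod_hom_act[OF h(1) that(1) v(1)] that(2) hv mod_hom_zero[OF lm h(1)] by simp
    then show ?thesis using P(2) that(1) by (auto simp: principal_module_def)
  qed
  ultimately have "principal_module A Q (e r) v"
    unfolding principal_module_def using v by (auto intro: Q.act_closed)
  then show ?thesis by blast
qed

section \<open>Full lists of indecomposable projectives and their direct sums\<close>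

lemma full_list_exists: "\<exists>Ps. full_list_indec_proj A Ps"
proof -
  obtain P u where P: "\<And>r. P r \<in> Rep A" and u: "\<And>r. principal_module A (P r) (e r) (u r)"
    using principal_exists by metis
  have lm: "left_module A (P r)" for r using P by (simp add: Rep_def)
  have "full_list_indec_proj A [P False, P True]"
    unfolding full_list_indec_proj_def
  proof (intro conjI ballI allI impI)
    fix X assume "X \<in> set [P False, P True]"
    then obtain r where "X = P r" by auto
    then show "projective A X" "indecomposable A X"
      using principal_projective[OF P u e_closed e_idem] principal_indecomposable[OF P u] by auto
  next
    fix i j assume "i < length [P False, P True]" "j < length [P False, P True]" "i \<noteq> j"
    then show "\<not> mod_iso A ([P False, P True] ! i) ([P False, P True] ! j)"
      using principal_not_iso[OF lm lm u u, of False True] principal_not_iso[OF lm lm u u, of True False]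
      by (auto simp: less_Suc_eq)
  next
    fix Q assume Q: "projective A Q \<and> indecomposable A Q"
    then obtain r v where v: "principal_module A Q (e r) v"
      using indecomposable_projective_principal by blast
    have "left_module A Q" using Q by (simp add: projective_def Rep_def)
    then have "mod_iso A Q (P r)"
      by (rule principal_mod_iso[OF _ lm e_closed v u])
    then show "\<exists>P\<in>set [P False, P True]. mod_iso A Q P" by (cases r) auto
  qed
  then show ?thesis by blast
qed

text \<open>Entry \<open>i\<close> is a copy of \<open>A e (t i)\<close>. Distinct entries are not
  isomorphic, so \<open>t\<close> is injective; every \<open>A e r\<close> occurs up to isomorphism,
  so \<open>t\<close> is onto. The tuple of generators is free: an element \<open>a\<close> killing
  it satisfies \<open>a e r = 0\<close> for both \<open>r\<close>, and the idempotents sum to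
  one.\<close>

lemma full_list_direct_sum_principal:
  assumes full: "full_list_indec_proj A Ps"
  shows "left_module A (direct_sum Ps)" "\<exists>u. principal_module A (direct_sum Ps) \<one> u"
proof -
  let ?n = "length Ps"
  have Ps: "projective A (Ps ! i)" "indecomposable A (Ps ! i)" if "i < ?n" for i
    using full that by (auto simp: full_list_indec_proj_def)
  have lm: "left_module A (Ps ! i)" if "i < ?n" for i
    using Ps[OF that] by (simp add: projective_def Rep_def)
  show lD: "left_module A (direct_sum Ps)"
    by (rule left_module_direct_sum) (use ring_axioms lm in \<open>auto simp: in_set_conv_nth\<close>)
  interpret D: left_module A "direct_sum Ps" by fact
  have "\<exists>r v. principal_module A (Ps ! i) (e r) v" if "i < ?n" for i
    using indecomposable_projective_principal Ps[OF that] by blast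
  then obtain t u where u: "\<And>i. i < ?n \<Longrightarrow> principal_module A (Ps ! i) (e (t i)) (u i)"
    by metis
  have t_inj: "i = j" if "i < ?n" "j < ?n" "t i = t j" for i j
  proof (rule ccontr)
    assume "i \<noteq> j"
    then have "\<not> mod_iso A (Ps ! i) (Ps ! j)"
      using full that by (auto simp: full_list_indec_proj_def)
    then show False
      using principal_mod_iso[OF lm[OF that(1)] lm[OF that(2)] e_closed u[OF that(1)]]
        u[OF that(2)] that(3) by simp
  qed
  have "\<exists>i<?n. t i = r" for r
  proof -
    obtain P v where P: "P \<in> Rep A" and v: "principal_module A P (e r) v" using principal_exists by blast
    have "projective A P \<and> indecomposable A P"
      using principal_projective[OF P v e_closed e_idem] principal_indecomposable[OF P v] by blast
    then obtain i where i: "i < ?n" "mod_iso A P (Ps ! i)"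
      using full unfolding full_list_indec_proj_def by (metis in_set_conv_nth)
    have "left_module A P" using P by (simp add: Rep_def)
    then have "r = t i" using principal_not_iso[OF _ lm[OF i(1)] v u[OF i(1)] i(2)] by blast
    then show ?thesis using i by blast
  qed
  then obtain s where s: "\<And>r. s r < ?n" "\<And>r. t (s r) = r" by metis
  have st: "s (t i) = i" if "i < ?n" for i
    using t_inj that s by metis
  define w where "w = (\<lambda>i\<in>{..<?n}. u i)"
  have w: "w \<in> carrier (direct_sum Ps)"
    using principal_generator(1)[OF u] by (auto simp: w_def direct_sum_simps)
  have ker: "a = \<zero>" if a: "a \<in> carrier A" "a \<odot>\<^bsub>direct_sum Ps\<^esub> w = \<zero>\<^bsub>direct_sum Ps\<^esub>" for a
  proof -
    have "a \<otimes> e r = \<zero>" for r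
    proof -
      have "a \<odot>\<^bsub>Ps ! s r\<^esub> u (s r) = \<zero>\<^bsub>Ps ! s r\<^esub>"
        using fun_cong[OF a(2), of "s r"] s by (simp add: direct_sum_simps w_def)
      then show ?thesis using u[OF s(1)] a(1) by (auto simp: principal_module_def s(2))
    qed
    then have "a \<otimes> (e False \<oplus> e True) = \<zero>" using a e_closed by (simp add: r_distr)
    then show ?thesis using a by (simp add: e_sum)
  qed
  have surj: "\<exists>a\<in>carrier A. x = a \<odot>\<^bsub>direct_sum Ps\<^esub> w" if x: "x \<in> carrier (direct_sum Ps)" for x
  proof -
    have "x (s r) \<in> carrier (Ps ! s r)" for r
      using x s by (auto simp: direct_sum_simps)
    then have "\<exists>b\<in>carrier A. x (s r) = b \<odot>\<^bsub>Ps ! s r\<^esub> u (s r)" for r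
      using principalE[OF u[OF s(1)]] by metis
    then obtain b where b: "\<And>r. b r \<in> carrier A" "\<And>r. x (s r) = b r \<odot>\<^bsub>Ps ! s r\<^esub> u (s r)"
      by metis
    \<comment> \<open>The coefficients required in the two entries are glued along the idempotents.
      By orthogonality \<open>?a\<close> acts on the generator fixed by \<open>e r\<close> as
      \<open>b r\<close> does.\<close>
    let ?a = "b False \<otimes> e False \<oplus> b True \<otimes> e True"
    have ae: "?a \<otimes> e r = b r \<otimes> e r" for r
      using b(1) e_closed e_orthogonal[of False True] e_orthogonal[of True False]
      by (cases r) (simp_all add: l_distr m_assoc e_idem)
    have "x i = ?a \<odot>\<^bsub>Ps ! i\<^esub> u i" if i: "i < ?n" for i
    proof -
      interpret Pi: left_module A "Ps ! i" by (rule lm[OF i])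
      note ug = principal_generator[OF u[OF i]]
      have "?a \<odot>\<^bsub>Ps ! i\<^esub> u i = (?a \<otimes> e (t i)) \<odot>\<^bsub>Ps ! i\<^esub> u i"
        using Pi.act_assoc[of ?a "e (t i)" "u i"] b e_closed ug by simp
      also have "\<dots> = b (t i) \<odot>\<^bsub>Ps ! i\<^esub> u i"
        unfolding ae using Pi.act_assoc[of "b (t i)" "e (t i)" "u i"] b e_closed ug by simp
      also have "\<dots> = x i" using b(2)[of "t i"] st[OF i] by simp
      finally show ?thesis by simp
    qed
    then have "x = ?a \<odot>\<^bsub>direct_sum Ps\<^esub> w"
      using x by (auto simp: direct_sum_simps w_def PiE_iff extensional_def intro!: ext)
    then show ?thesis using b e_closed by blast
  qed
  have "principal_module A (direct_sum Ps) \<one> w"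
    unfolding principal_module_def using w ker surj D.act_closed[OF _ w] by (auto simp: D.act_one)
  then show "\<exists>u. principal_module A (direct_sum Ps) \<one> u" by blast
qed

end


section \<open>Free algebras and their quotients\<close>

lemma monomial_induct [case_names zero add]:
  fixes p :: "'w \<Rightarrow>\<^sub>0 complex"
  assumes "P 0"
    and "\<And>w c p. w \<notin> Poly_Mapping.keys p \<Longrightarrow> c \<noteq> 0 \<Longrightarrow> P p \<Longrightarrow> P (Poly_Mapping.single w c + p)"
  shows "P p"
proof (induction p rule: update_induct)
  case const
  show ?case by (rule assms(1))
next
  case (update p w c)
  have "Poly_Mapping.update w c p = Poly_Mapping.single w c + p"
    using update(1) by (intro poly_mapping_eqI)
      (auto simp: lookup_update lookup_add lookup_single when_def in_keys_iff)
  then show ?case using assms(2) update by simp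
qed

lemma keys_single_add:
  assumes "w \<notin> Poly_Mapping.keys p" "c \<noteq> 0"
  shows "Poly_Mapping.keys (Poly_Mapping.single w c + p) = insert w (Poly_Mapping.keys p)"
  using assms by (auto simp: in_keys_iff lookup_add lookup_single when_def split: if_splits)

lemma free_alg_simps:
  "mult (free_alg S) = (*)" "one (free_alg S) = 1" "zero (free_alg S) = 0"
  "add (free_alg S) = (+)" "smult (free_alg S) c p = Poly_Mapping.single 0 c * p"
  by (simp_all add: free_alg_def)

lemma carrier_free_alg:
  "p \<in> carrier (free_alg S) \<longleftrightarrow> (\<forall>w\<in>Poly_Mapping.keys p. set (letters w) \<subseteq> S)"
  by (simp add: free_alg_def)

lemma free_alg_closed:
  assumes "p \<in> carrier (free_alg S)" "q \<in> carrier (free_alg S)"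
  shows "p + q \<in> carrier (free_alg S)" "- p \<in> carrier (free_alg S)"
    "p - q \<in> carrier (free_alg S)" "p * q \<in> carrier (free_alg S)"
proof -
  have add: "p + q \<in> carrier (free_alg S)" if "q \<in> carrier (free_alg S)" for q
    using assms(1) that keys_add[of p q] by (auto simp: carrier_free_alg)
  have neg: "- p \<in> carrier (free_alg S)" if "p \<in> carrier (free_alg S)" for p
    using that by (auto simp: carrier_free_alg in_keys_iff)
  show "p + q \<in> carrier (free_alg S)" "- p \<in> carrier (free_alg S)"
    using add neg assms by auto
  show "p - q \<in> carrier (free_alg S)" using add[OF neg[OF assms(2)]] by simp
  show "p * q \<in> carrier (free_alg S)"
    using assms keys_mult[of p q] by (fastforce simp: carrier_free_alg plus_word_def)
qed

lemma free_alg_single: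
  "set (letters w) \<subseteq> S \<Longrightarrow> Poly_Mapping.single w c \<in> carrier (free_alg S)"
  by (simp add: carrier_free_alg)

lemma free_alg_zero: "0 \<in> carrier (free_alg S)"
  by (simp add: carrier_free_alg)

lemma free_alg_scalar: "Poly_Mapping.single 0 c \<in> carrier (free_alg S)"
  by (rule free_alg_single) (simp add: zero_word_def)

lemma free_alg_one: "1 \<in> carrier (free_alg S)"
  using free_alg_scalar[of 1 S] by simp

text \<open>The word \<open>w\<close> is new to \<open>p\<close>, so nothing cancels and the
  condition on the support passes from the sum to \<open>p\<close>.\<close>

lemma free_alg_induct [consumes 1, case_names zero add]:
  assumes "p \<in> carrier (free_alg S)" and "P 0"
    and "\<And>w c p. set (letters w) \<subseteq> S \<Longrightarrow> w \<notin> Poly_Mapping.keys p \<Longrightarrow> c \<noteq> 0 \<Longrightarrow>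
      p \<in> carrier (free_alg S) \<Longrightarrow> P p \<Longrightarrow> P (Poly_Mapping.single w c + p)"
  shows "P p"
  using assms(1)
proof (induction p rule: monomial_induct)
  case (add w c p)
  then show ?case
    using keys_single_add[OF add(1,2)] by (intro assms(3)) (auto simp: carrier_free_alg)
qed (rule assms(2))

lemma ring_free_alg: "ring (free_alg S)"
proof (rule ringI)
  show "abelian_group (free_alg S)"
    by (rule abelian_groupI)
      (auto simp: free_alg_simps free_alg_closed free_alg_zero algebra_simps
        intro!: bexI[of _ "- _"])
  show "Group.monoid (free_alg S)"
    by (rule monoidI) (auto simp: free_alg_simps free_alg_closed free_alg_one algebra_simps)
qed (auto simp: free_alg_simps algebra_simps)

lemma free_alg_minus:
  assumes "p \<in> carrier (free_alg S)" "q \<in> carrier (free_alg S)"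
  shows "p \<ominus>\<^bsub>free_alg S\<^esub> q = p - q"
proof -
  interpret ring "free_alg S" by (rule ring_free_alg)
  have "\<ominus>\<^bsub>free_alg S\<^esub> q = - q"
    using assms by (intro minus_equality) (auto simp: free_alg_simps free_alg_closed)
  then show ?thesis by (simp add: a_minus_def free_alg_simps)
qed

lemma scalar_mult_commute:
  fixes p :: "'w::monoid_add \<Rightarrow>\<^sub>0 complex"
  shows "Poly_Mapping.single 0 c * p = p * Poly_Mapping.single 0 c"
  by (induction p rule: monomial_induct) (simp_all add: distrib_left distrib_right mult_single mult.commute)

section \<open>Characters of the free algebra prescribed on generators\<close>

definition evaluate :: "('g \<Rightarrow> complex) \<Rightarrow> ('g word \<Rightarrow>\<^sub>0 complex) \<Rightarrow> complex" where
  "evaluate f p = (\<Sum>w\<in>Poly_Mapping.keys p. Poly_Mapping.lookup p w * prod_list (map f (letters w)))"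

lemma evaluate_add: "evaluate f (p + q) = evaluate f p + evaluate f q"
proof -
  let ?T = "Poly_Mapping.keys p \<union> Poly_Mapping.keys q"
  have "evaluate f r = (\<Sum>w\<in>?T. Poly_Mapping.lookup r w * prod_list (map f (letters w)))"
    if "Poly_Mapping.keys r \<subseteq> ?T" for r
    unfolding evaluate_def
    by (rule sum.mono_neutral_left) (use that in \<open>auto simp: in_keys_iff\<close>)
  from this[of p] this[of q] this[of "p + q"] show ?thesis
    using keys_add[of p q] by (simp add: lookup_add distrib_right sum.distrib)
qed

lemma evaluate_single: "evaluate f (Poly_Mapping.single w c) = c * prod_list (map f (letters w))"
  by (simp add: evaluate_def)

lemma evaluate_zero: "evaluate f 0 = 0"
  by (simp add: evaluate_def)

lemma evaluate_diff: "evaluate f (p - q) = evaluate f p - evaluate f q"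
  using evaluate_add[of f "p - q" q] by simp

lemma evaluate_mult: "evaluate f (p * q) = evaluate f p * evaluate f q"
proof (induction p rule: monomial_induct)
  case (add u a p)
  have "evaluate f (Poly_Mapping.single u a * q) = evaluate f (Poly_Mapping.single u a) * evaluate f q"
    by (induction q rule: monomial_induct)
      (simp_all add: evaluate_zero evaluate_add evaluate_single distrib_left mult_single plus_word_def)
  then show ?case using add by (simp add: distrib_right evaluate_add)
qed (simp add: evaluate_zero)

lemma letters_zero: "letters 0 = []"
  by (simp add: zero_word_def)

lemma evaluate_scalar: "evaluate f (Poly_Mapping.single 0 c) = c"
  by (simp add: evaluate_single letters_zero)

lemma evaluate_one: "evaluate f 1 = 1"
  using evaluate_scalar[of f 1] by simp

section \<open>The reversal anti-automorphism of the free algebra\<close>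

definition rev_word :: "'g word \<Rightarrow> 'g word" where
  "rev_word w = Word (rev (letters w))"

text \<open>\<open>map_key\<close> pulls coefficients back: the coefficient at a word is that of
  \<open>p\<close> at the reversed word. Since \<open>rev_word\<close> is an involution, this is the
  same as replacing every word of \<open>p\<close> by its reverse.\<close>

definition reversal :: "('g word \<Rightarrow>\<^sub>0 complex) \<Rightarrow> ('g word \<Rightarrow>\<^sub>0 complex)" where
  "reversal = Poly_Mapping.map_key rev_word"

lemma rev_word_rev_word: "rev_word (rev_word w) = w"
  by (simp add: rev_word_def)

lemma inj_rev_word: "inj rev_word"
  by (metis injI rev_word_rev_word)

lemma reversal_add: "reversal (p + q) = reversal p + reversal q"
  by (simp add: reversal_def map_key_plus inj_rev_word)

lemma reversal_zero: "reversal 0 = 0"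
  by (simp add: reversal_def inj_rev_word)

lemma reversal_single: "reversal (Poly_Mapping.single w c) = Poly_Mapping.single (rev_word w) c"
  using map_key_single[OF inj_rev_word, of "rev_word w" c]
  by (simp add: reversal_def rev_word_rev_word)

lemma reversal_scalar: "reversal (Poly_Mapping.single 0 c) = Poly_Mapping.single 0 c"
  by (simp add: reversal_single rev_word_def letters_zero) (simp add: zero_word_def)

lemma reversal_one: "reversal 1 = 1"
  using reversal_scalar[of 1] by simp

lemma reversal_diff: "reversal (p - q) = reversal p - reversal q"
  using reversal_add[of "p - q" q] by (simp add: eq_diff_eq)

lemma reversal_reversal: "reversal (reversal p) = p"
  by (induction p rule: monomial_induct)
    (simp_all add: reversal_zero reversal_add reversal_single rev_word_rev_word)

lemma reversal_mult: "reversal (p * q) = reversal q * reversal p"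
proof (induction p rule: monomial_induct)
  case (add u a p)
  have "reversal (Poly_Mapping.single u a * q) = reversal q * reversal (Poly_Mapping.single u a)"
    by (induction q rule: monomial_induct)
      (simp_all add: reversal_zero reversal_add reversal_single distrib_left distrib_right
        mult_single plus_word_def rev_word_def mult.commute)
  then show ?case using add by (simp add: distrib_right distrib_left reversal_add)
qed (simp add: reversal_zero)

lemma reversal_closed: "p \<in> carrier (free_alg S) \<Longrightarrow> reversal p \<in> carrier (free_alg S)"
proof (induction p rule: free_alg_induct)
  case (add w c p)
  then show ?case
    by (simp add: reversal_add reversal_single free_alg_closed free_alg_single rev_word_def)
qed (simp add: reversal_zero free_alg_zero)

section \<open>Quotients of free algebras by two-sided ideals\<close>

locale free_quotient =
  fixes S :: "'g set" and I :: "('g word \<Rightarrow>\<^sub>0 complex) set"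
  assumes ideal: "ideal I (free_alg S)"
begin

abbreviation "F \<equiv> free_alg S"
abbreviation "A \<equiv> quot_alg F I"

definition proj :: "('g word \<Rightarrow>\<^sub>0 complex) \<Rightarrow> ('g word \<Rightarrow>\<^sub>0 complex) set" where
  "proj p = I +>\<^bsub>F\<^esub> p"

sublocale I: ideal I F by (rule ideal)

lemma carrier_quot: "carrier A = proj ` carrier F"
  by (auto simp: quot_alg_def FactRing_def A_RCOSETS_def' proj_def)

lemma proj_ring_hom: "proj \<in> ring_hom F (F Quot I)"
  using I.rcos_ring_hom by (simp add: proj_def[abs_def])

lemma quot_simps:
  "p \<in> carrier F \<Longrightarrow> q \<in> carrier F \<Longrightarrow> proj p \<oplus>\<^bsub>A\<^esub> proj q = proj (p + q)"
  "p \<in> carrier F \<Longrightarrow> q \<in> carrier F \<Longrightarrow> proj p \<otimes>\<^bsub>A\<^esub> proj q = proj (p * q)"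
  "\<one>\<^bsub>A\<^esub> = proj 1" "\<zero>\<^bsub>A\<^esub> = proj 0"
  using ring_hom_mult[OF proj_ring_hom, of p q] ring_hom_add[OF proj_ring_hom, of p q]
    ring_hom_one[OF proj_ring_hom]
    ring_hom_zero[OF proj_ring_hom I.ring_axioms I.quotient_is_ring]
  by (simp_all add: quot_alg_def free_alg_simps)

lemma proj_eq_iff:
  assumes "p \<in> carrier F" "q \<in> carrier F"
  shows "proj p = proj q \<longleftrightarrow> p - q \<in> I"
  using I.quotient_eq_iff_same_a_r_cos[OF ideal assms] free_alg_minus[OF assms]
  by (simp add: proj_def)

lemma scalar_mult_closed: "p \<in> carrier F \<Longrightarrow> Poly_Mapping.single 0 c * p \<in> carrier F"
  by (intro free_alg_closed free_alg_scalar)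

text \<open>The definition takes a union over all representatives of the coset. Representatives
  differ by elements of the ideal, so all members of the union agree, and the coset is
  nonempty.\<close>

lemma quot_smult:
  assumes p: "p \<in> carrier F"
  shows "c \<odot>\<^bsub>A\<^esub> proj p = proj (Poly_Mapping.single 0 c * p)"
proof -
  have eq: "proj (Poly_Mapping.single 0 c * x) = proj (Poly_Mapping.single 0 c * p)" if x: "x \<in> proj p" for x
  proof -
    have xF: "x \<in> carrier F" using x p I.a_r_coset_subset_G[OF I.a_subset] by (auto simp: proj_def)
    have "x - p \<in> I"
    proof -
      obtain i where "i \<in> I" "x = i + p"
        using x by (auto simp: proj_def a_r_coset_def' free_alg_simps)
      then show ?thesis by simp
    qed
    then have "Poly_Mapping.single 0 c * (x - p) \<in> I"
      using I.I_l_closed[OF _ free_alg_scalar] by (simp add: free_alg_simps)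
    then show ?thesis
      using xF p by (simp add: proj_eq_iff scalar_mult_closed right_diff_distrib)
  qed
  have "p \<in> proj p" using I.a_rcos_self[OF p] by (simp add: proj_def)
  have "c \<odot>\<^bsub>A\<^esub> proj p = (\<Union>x\<in>proj p. proj (Poly_Mapping.single 0 c * x))"
    by (simp add: quot_alg_def free_alg_simps proj_def)
  also have "\<dots> = (\<Union>x\<in>proj p. proj (Poly_Mapping.single 0 c * p))"
    by (rule SUP_cong[OF refl eq])
  also have "\<dots> = proj (Poly_Mapping.single 0 c * p)"
    using \<open>p \<in> proj p\<close> by blast
  finally show ?thesis .
qed

lemma ring_quot: "ring A"
proof (rule ringI)
  show "abelian_group A"
  proof (rule abelian_groupI)
    fix x assume "x \<in> carrier A"
    then obtain p where p: "p \<in> carrier F" "x = proj p" by (auto simp: carrier_quot)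
    then show "\<exists>y\<in>carrier A. y \<oplus>\<^bsub>A\<^esub> x = \<zero>\<^bsub>A\<^esub>"
      by (intro bexI[of _ "proj (- p)"]) (auto simp: quot_simps carrier_quot free_alg_closed)
  qed (auto simp: quot_simps carrier_quot free_alg_closed free_alg_zero add_ac)
  show "Group.monoid A"
    by (rule monoidI)
      (auto simp: quot_simps carrier_quot free_alg_closed free_alg_one mult.assoc)
qed (auto simp: quot_simps carrier_quot free_alg_closed algebra_simps)

sublocale A: complex_algebra A
proof (rule complex_algebra.intro[OF ring_quot], unfold_locales)
  fix c d x
  have one: "c \<odot>\<^bsub>A\<^esub> \<one>\<^bsub>A\<^esub> = proj (Poly_Mapping.single 0 c)" for c
    by (simp add: quot_simps quot_smult free_alg_one)
  show "c \<odot>\<^bsub>A\<^esub> \<one>\<^bsub>A\<^esub> \<in> carrier A"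
    unfolding one by (auto simp: carrier_quot free_alg_scalar)
  show "(c + d) \<odot>\<^bsub>A\<^esub> \<one>\<^bsub>A\<^esub> = c \<odot>\<^bsub>A\<^esub> \<one>\<^bsub>A\<^esub> \<oplus>\<^bsub>A\<^esub> d \<odot>\<^bsub>A\<^esub> \<one>\<^bsub>A\<^esub>"
    unfolding one by (simp add: quot_simps free_alg_scalar single_add)
  show "(c * d) \<odot>\<^bsub>A\<^esub> \<one>\<^bsub>A\<^esub> = (c \<odot>\<^bsub>A\<^esub> \<one>\<^bsub>A\<^esub>) \<otimes>\<^bsub>A\<^esub> (d \<odot>\<^bsub>A\<^esub> \<one>\<^bsub>A\<^esub>)"
    unfolding one by (simp add: quot_simps free_alg_scalar mult_single)
  show "1 \<odot>\<^bsub>A\<^esub> \<one>\<^bsub>A\<^esub> = \<one>\<^bsub>A\<^esub>"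
    unfolding one by (simp add: quot_simps)
  assume "x \<in> carrier A"
  then obtain p where p: "p \<in> carrier F" "x = proj p" by (auto simp: carrier_quot)
  show "(c \<odot>\<^bsub>A\<^esub> \<one>\<^bsub>A\<^esub>) \<otimes>\<^bsub>A\<^esub> x = x \<otimes>\<^bsub>A\<^esub> (c \<odot>\<^bsub>A\<^esub> \<one>\<^bsub>A\<^esub>)"
    unfolding one p(2) by (simp add: quot_simps p free_alg_scalar scalar_mult_commute)
  show "c \<odot>\<^bsub>A\<^esub> x = (c \<odot>\<^bsub>A\<^esub> \<one>\<^bsub>A\<^esub>) \<otimes>\<^bsub>A\<^esub> x"
    unfolding one p(2) by (simp add: quot_simps p free_alg_scalar quot_smult)
qed

definition word_class :: "'g list \<Rightarrow> ('g word \<Rightarrow>\<^sub>0 complex) set" where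
  "word_class w = proj (Poly_Mapping.single (Word w) 1)"

lemma word_class_closed: "set w \<subseteq> S \<Longrightarrow> word_class w \<in> carrier A"
  by (auto simp: word_class_def carrier_quot free_alg_single)

lemma word_class_append:
  "set v \<subseteq> S \<Longrightarrow> set w \<subseteq> S \<Longrightarrow> word_class (v @ w) = word_class v \<otimes>\<^bsub>A\<^esub> word_class w"
  by (simp add: word_class_def quot_simps free_alg_single mult_single plus_word_def)

lemma word_class_Nil: "word_class [] = \<one>\<^bsub>A\<^esub>"
  using single_one[where ?'a = "'g word" and ?'b = complex]
  by (simp add: word_class_def quot_simps zero_word_def)

lemma proj_single:
  "set w \<subseteq> S \<Longrightarrow> proj (Poly_Mapping.single (Word w) c) = c \<odot>\<^bsub>A\<^esub> word_class w"
  by (simp add: word_class_def quot_smult free_alg_single mult_single)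

lemma carrier_induct [consumes 1, case_names zero add]:
  assumes "x \<in> carrier A" and "P \<zero>\<^bsub>A\<^esub>"
    and "\<And>w c x. set w \<subseteq> S \<Longrightarrow> x \<in> carrier A \<Longrightarrow> P x \<Longrightarrow> P (c \<odot>\<^bsub>A\<^esub> word_class w \<oplus>\<^bsub>A\<^esub> x)"
  shows "P x"
proof -
  obtain p where p: "p \<in> carrier F" "x = proj p" using assms(1) by (auto simp: carrier_quot)
  from p(1) have "P (proj p)"
  proof (induction rule: free_alg_induct)
    case zero
    then show ?case using assms(2) by (simp add: quot_simps)
  next
    case (add w c p)
    have "proj (Poly_Mapping.single w c + p) = c \<odot>\<^bsub>A\<^esub> word_class (letters w) \<oplus>\<^bsub>A\<^esub> proj p"
      using add by (simp add: quot_simps(1)[symmetric] free_alg_single proj_single[symmetric])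
    then show ?case using assms(3)[of "letters w" "proj p" c] add by (auto simp: carrier_quot)
  qed
  then show ?thesis by (simp add: p)
qed

text \<open>
  Maps on the free algebra that respect \<open>I\<close> are transported to the quotient by choosing
  representatives of the cosets.
\<close>

definition rep :: "('g word \<Rightarrow>\<^sub>0 complex) set \<Rightarrow> ('g word \<Rightarrow>\<^sub>0 complex)" where
  "rep x = (SOME p. p \<in> carrier F \<and> x = proj p)"

lemma rep:
  assumes "p \<in> carrier F"
  shows "rep (proj p) \<in> carrier F" "rep (proj p) - p \<in> I"
proof -
  have "rep (proj p) \<in> carrier F \<and> proj p = proj (rep (proj p))"
    unfolding rep_def by (rule someI[of _ p]) (use assms in simp)
  then show "rep (proj p) \<in> carrier F" "rep (proj p) - p \<in> I"
    using proj_eq_iff[of "rep (proj p)" p] assms by auto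
qed

end

section \<open>Ideals cut out by characters and by reversal\<close>

lemma free_alg_idealI:
  assumes sub: "I \<subseteq> carrier (free_alg S)" and zero: "0 \<in> I"
    and add: "\<And>p q. p \<in> I \<Longrightarrow> q \<in> I \<Longrightarrow> p + q \<in> I"
    and left: "\<And>p q. p \<in> I \<Longrightarrow> q \<in> carrier (free_alg S) \<Longrightarrow> q * p \<in> I"
    and right: "\<And>p q. p \<in> I \<Longrightarrow> q \<in> carrier (free_alg S) \<Longrightarrow> p * q \<in> I"
  shows "ideal I (free_alg S)"
proof (rule idealI)
  interpret ring "free_alg S" by (rule ring_free_alg)
  show "subgroup I (add_monoid (free_alg S))"
  proof (rule add.subgroupI)
    fix p assume p: "p \<in> I"
    then have "\<ominus>\<^bsub>free_alg S\<^esub> p = - p"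
      using sub free_alg_minus[of 0 S p] by (auto simp: free_alg_zero a_minus_def free_alg_simps)
    moreover have "- p \<in> I"
      using left[OF p free_alg_closed(2)[OF free_alg_one free_alg_one]] by simp
    ultimately show "\<ominus>\<^bsub>free_alg S\<^esub> p \<in> I" by simp
  qed (use sub zero add in \<open>auto simp: free_alg_simps\<close>)
qed (use left right ring_free_alg in \<open>auto simp: free_alg_simps\<close>)

text \<open>A test ideal: by minimality of a generated ideal, vanishing of a character on the
  defining relations extends to the whole ideal.\<close>

lemma ideal_vanishing_evaluation:
  "ideal {p \<in> carrier (free_alg S). evaluate f p = 0} (free_alg S)"
  by (rule free_alg_idealI)
    (auto simp: free_alg_zero free_alg_closed evaluate_zero evaluate_add evaluate_mult)

text \<open>The second test ideal, for stability under reversal. As \<open>reversal\<close> swaps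
  factors, left absorption in the preimage comes from right absorption in \<open>I\<close>, and
  conversely.\<close>

lemma ideal_reversal:
  assumes "ideal I (free_alg S)"
  shows "ideal {p \<in> carrier (free_alg S). reversal p \<in> I} (free_alg S)"
proof -
  interpret ideal I "free_alg S" by fact
  have "p + q \<in> I" if "p \<in> I" "q \<in> I" for p q
    using additive_subgroup.a_closed[OF is_additive_subgroup that] by (simp add: free_alg_simps)
  moreover have "p * q \<in> I" "q * p \<in> I" if "p \<in> I" "q \<in> carrier (free_alg S)" for p q
    using I_r_closed[OF that] I_l_closed[OF that] by (simp_all add: free_alg_simps)
  moreover have "0 \<in> I" using additive_subgroup.zero_closed[OF is_additive_subgroup] by (simp add: free_alg_simps)
  ultimately show ?thesis
    by (intro free_alg_idealI) (auto simp: free_alg_zero free_alg_closed reversal_zero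
      reversal_add reversal_mult reversal_closed)
qed


section \<open>The algebra underlying the Nichols Hopf algebra\<close>

lemma nichols_rels_closed: "nichols_rels m \<subseteq> carrier (free_alg (nichols_gens m))"
  by (auto simp: nichols_rels_def nichols_gens_def intro!: free_alg_closed free_alg_single free_alg_one)

definition nichols_ideal :: "nat \<Rightarrow> (nichols_gen word \<Rightarrow>\<^sub>0 complex) set" where
  "nichols_ideal m = genideal (free_alg (nichols_gens m)) (nichols_rels m)"

lemma nichols_eq: "nichols m = quot_alg (free_alg (nichols_gens m)) (nichols_ideal m)"
  by (simp add: nichols_def nichols_ideal_def Let_def)

lemma ideal_nichols_ideal: "ideal (nichols_ideal m) (free_alg (nichols_gens m))"
  unfolding nichols_ideal_def
  by (rule ring.genideal_ideal[OF ring_free_alg nichols_rels_closed])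

lemma nichols_rels_subset: "nichols_rels m \<subseteq> nichols_ideal m"
  unfolding nichols_ideal_def
  by (rule ring.genideal_self[OF ring_free_alg nichols_rels_closed])

lemma nichols_ideal_minimal:
  "ideal J (free_alg (nichols_gens m)) \<Longrightarrow> nichols_rels m \<subseteq> J \<Longrightarrow> nichols_ideal m \<subseteq> J"
  unfolding nichols_ideal_def by (rule ring.genideal_minimal[OF ring_free_alg])

locale nichols_algebra =
  fixes m :: nat
begin

sublocale free_quotient "nichols_gens m" "nichols_ideal m"
  by (rule free_quotient.intro[OF ideal_nichols_ideal])

subsection \<open>The reversal anti-automorphism\<close>

lemma reversal_rels: "p \<in> nichols_rels m \<Longrightarrow> reversal p \<in> nichols_rels m"
proof -
  \<comment> \<open>Each relation is itself fixed: squares are palindromes, and the two terms of an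
    anticommutator trade places.\<close>
  have "reversal p = p" if "p \<in> nichols_rels m"
    using that unfolding nichols_rels_def
    by (auto simp: reversal_add reversal_diff reversal_one reversal_mult reversal_single rev_word_def add.commute)
  then show ?thesis if "p \<in> nichols_rels m" using that by simp
qed

lemma reversal_ideal: "p \<in> nichols_ideal m \<Longrightarrow> reversal p \<in> nichols_ideal m"
  using nichols_ideal_minimal[OF ideal_reversal[OF ideal_nichols_ideal]] reversal_rels
    nichols_rels_closed nichols_rels_subset by blast

definition anti :: "(nichols_gen word \<Rightarrow>\<^sub>0 complex) set \<Rightarrow> (nichols_gen word \<Rightarrow>\<^sub>0 complex) set" where
  "anti x = proj (reversal (rep x))"

lemma anti_proj:
  assumes "p \<in> carrier F"
  shows "anti (proj p) = proj (reversal p)"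
  using rep[OF assms] assms reversal_ideal[of "rep (proj p) - p"]
  by (simp add: anti_def proj_eq_iff reversal_closed reversal_diff)

lemma anti_properties:
  "bij_betw anti (carrier A) (carrier A)"
  "x \<in> carrier A \<Longrightarrow> y \<in> carrier A \<Longrightarrow> anti (x \<oplus>\<^bsub>A\<^esub> y) = anti x \<oplus>\<^bsub>A\<^esub> anti y"
  "x \<in> carrier A \<Longrightarrow> y \<in> carrier A \<Longrightarrow> anti (x \<otimes>\<^bsub>A\<^esub> y) = anti y \<otimes>\<^bsub>A\<^esub> anti x"
  "anti \<one>\<^bsub>A\<^esub> = \<one>\<^bsub>A\<^esub>"
  "x \<in> carrier A \<Longrightarrow> anti (c \<odot>\<^bsub>A\<^esub> x) = c \<odot>\<^bsub>A\<^esub> anti x"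
proof -
  show "bij_betw anti (carrier A) (carrier A)"
    by (rule bij_betw_byWitness[where f' = anti])
      (auto simp: carrier_quot anti_proj reversal_closed reversal_reversal)
  show "x \<in> carrier A \<Longrightarrow> y \<in> carrier A \<Longrightarrow> anti (x \<oplus>\<^bsub>A\<^esub> y) = anti x \<oplus>\<^bsub>A\<^esub> anti y"
    by (auto simp: carrier_quot quot_simps anti_proj free_alg_closed reversal_closed reversal_add)
  show "x \<in> carrier A \<Longrightarrow> y \<in> carrier A \<Longrightarrow> anti (x \<otimes>\<^bsub>A\<^esub> y) = anti y \<otimes>\<^bsub>A\<^esub> anti x"
    by (auto simp: carrier_quot quot_simps anti_proj free_alg_closed reversal_closed reversal_mult)
  show "anti \<one>\<^bsub>A\<^esub> = \<one>\<^bsub>A\<^esub>"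
    by (simp add: quot_simps anti_proj free_alg_one reversal_one)
  show "x \<in> carrier A \<Longrightarrow> anti (c \<odot>\<^bsub>A\<^esub> x) = c \<odot>\<^bsub>A\<^esub> anti x"
    by (auto simp: carrier_quot quot_smult anti_proj scalar_mult_closed reversal_closed
      reversal_mult reversal_scalar scalar_mult_commute[symmetric])
qed

subsection \<open>Characters and idempotents\<close>

text \<open>The action on the simple modules: \<open>False\<close> stands for V(0), where K acts by
  1, and \<open>True\<close> for V(1), where K acts by -1.\<close>

definition chi_gen :: "bool \<Rightarrow> nichols_gen \<Rightarrow> complex" where
  "chi_gen r x = (if x = GK then if r then - 1 else 1 else 0)"

lemma evaluate_ideal: "p \<in> nichols_ideal m \<Longrightarrow> evaluate (chi_gen r) p = 0"
proof -
  have "evaluate (chi_gen r) p = 0" if "p \<in> nichols_rels m" for p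
    using that unfolding nichols_rels_def
    by (auto simp: evaluate_add evaluate_diff evaluate_mult evaluate_single evaluate_one chi_gen_def)
  then have "nichols_rels m \<subseteq> {p \<in> carrier F. evaluate (chi_gen r) p = 0}"
    using nichols_rels_closed[of m] by auto
  then show "p \<in> nichols_ideal m \<Longrightarrow> evaluate (chi_gen r) p = 0"
    using nichols_ideal_minimal[OF ideal_vanishing_evaluation] by blast
qed

definition chi :: "bool \<Rightarrow> (nichols_gen word \<Rightarrow>\<^sub>0 complex) set \<Rightarrow> complex" where
  "chi r x = evaluate (chi_gen r) (rep x)"

lemma chi_proj: "p \<in> carrier F \<Longrightarrow> chi r (proj p) = evaluate (chi_gen r) p"
  using rep[of p] evaluate_ideal[of "rep (proj p) - p" r] by (simp add: chi_def evaluate_diff)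

lemma chi_add: "x \<in> carrier A \<Longrightarrow> y \<in> carrier A \<Longrightarrow> chi r (x \<oplus>\<^bsub>A\<^esub> y) = chi r x + chi r y"
  by (auto simp: carrier_quot quot_simps chi_proj free_alg_closed evaluate_add)

lemma chi_mult: "x \<in> carrier A \<Longrightarrow> y \<in> carrier A \<Longrightarrow> chi r (x \<otimes>\<^bsub>A\<^esub> y) = chi r x * chi r y"
  by (auto simp: carrier_quot quot_simps chi_proj free_alg_closed evaluate_mult)

lemma chi_smult: "x \<in> carrier A \<Longrightarrow> chi r (c \<odot>\<^bsub>A\<^esub> x) = c * chi r x"
  by (auto simp: carrier_quot quot_smult chi_proj scalar_mult_closed evaluate_mult
    evaluate_scalar)

lemma chi_word_class:
  "set w \<subseteq> nichols_gens m \<Longrightarrow> chi r (word_class w) = prod_list (map (chi_gen r) w)"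
  by (simp add: word_class_def chi_proj free_alg_single evaluate_single)

text \<open>Represents the projection onto the eigenspace of K whose eigenvalue is
  \<open>chi_gen r GK\<close>. With this sign the idempotents are dual to the two
  characters.\<close>

definition idem_poly :: "bool \<Rightarrow> nichols_gen word \<Rightarrow>\<^sub>0 complex" where
  "idem_poly r = Poly_Mapping.single 0 (1 / 2) +
    Poly_Mapping.single (Word [GK]) (if r then - 1 / 2 else 1 / 2)"

definition e :: "bool \<Rightarrow> (nichols_gen word \<Rightarrow>\<^sub>0 complex) set" where
  "e r = proj (idem_poly r)"

lemma idem_poly_closed: "idem_poly r \<in> carrier F"
  by (auto simp: idem_poly_def nichols_gens_def intro!: free_alg_closed free_alg_single free_alg_scalar)

lemma e_closed: "e r \<in> carrier A"
  by (simp add: e_def carrier_quot idem_poly_closed)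

lemma e_sum: "e False \<oplus>\<^bsub>A\<^esub> e True = \<one>\<^bsub>A\<^esub>"
proof -
  have "idem_poly False + idem_poly True = 1"
    by (intro poly_mapping_eqI)
      (auto simp: idem_poly_def lookup_add lookup_single lookup_one when_def)
  then show ?thesis by (simp add: e_def quot_simps idem_poly_closed)
qed

lemma e_idem: "e r \<otimes>\<^bsub>A\<^esub> e r = e r"
proof -
  \<comment> \<open>For either sign of K, squaring (1 + K)/2 or (1 - K)/2 and subtracting the
    original leaves (K^2 - 1)/4, a multiple of a relation.\<close>
  have "idem_poly r * idem_poly r - idem_poly r =
      Poly_Mapping.single 0 (1 / 4) * (gen GK * gen GK - 1)"
  proof -
    have "gen GK * gen GK - 1 = Poly_Mapping.single (Word [GK, GK]) 1 - Poly_Mapping.single 0 (1::complex)"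
      by (simp add: mult_single plus_word_def)
    then show ?thesis
      by (intro poly_mapping_eqI)
        (auto simp: idem_poly_def distrib_left distrib_right right_diff_distrib mult_single
          lookup_add lookup_minus lookup_single when_def plus_word_def zero_word_def)
  qed
  moreover have "gen GK * gen GK - 1 \<in> nichols_ideal m"
    using nichols_rels_subset by (auto simp: nichols_rels_def)
  ultimately have "idem_poly r * idem_poly r - idem_poly r \<in> nichols_ideal m"
    using I.I_l_closed[OF _ free_alg_scalar] by (simp add: free_alg_simps)
  then show ?thesis
    by (simp add: e_def quot_simps idem_poly_closed proj_eq_iff free_alg_closed)
qed

lemma chi_e: "chi r (e s) = (if r = s then 1 else 0)"
  by (simp add: e_def chi_proj idem_poly_closed)
    (simp add: idem_poly_def evaluate_add evaluate_scalar evaluate_single chi_gen_def letters_zero)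

subsection \<open>Reduction of words\<close>

text \<open>Any two distinct generators anticommute, K included, so words can be rearranged without
  distinguishing K from the odd generators.\<close>

lemma swap_in_ideal:
  assumes "x \<in> nichols_gens m" "y \<in> nichols_gens m" "x \<noteq> y"
  shows "gen x * gen y + gen y * gen x \<in> nichols_ideal m"
proof -
  have "gen x * gen y + gen y * gen x \<in> nichols_rels m"
    using assms unfolding nichols_gens_def nichols_rels_def
    by (cases x; cases y) (auto simp: add.commute)
  then show ?thesis using nichols_rels_subset by blast
qed

text \<open>The scalar is -1 for distinct letters. Leaving it unspecified covers equal letters as
  well, so that a letter can be moved past an arbitrary word.\<close>

lemma word_class_swap:
  assumes xy: "x \<in> nichols_gens m" "y \<in> nichols_gens m"
  shows "\<exists>s. word_class [x, y] = s \<odot>\<^bsub>A\<^esub> word_class [y, x]"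
proof (cases "x = y")
  case True
  then show ?thesis
    using A.one_smult[OF word_class_closed[of "[x, x]"]] xy by (intro exI[of _ 1]) auto
next
  case False
  have "Poly_Mapping.single (Word [x, y]) 1 - Poly_Mapping.single (Word [y, x]) (- 1 :: complex) =
      gen x * gen y + gen y * gen x"
    by (simp add: mult_single plus_word_def single_uminus)
  then have "word_class [x, y] = proj (Poly_Mapping.single (Word [y, x]) (- 1))"
    unfolding word_class_def using swap_in_ideal[OF xy False] xy
    by (subst proj_eq_iff) (auto simp: free_alg_single)
  then show ?thesis using proj_single[of "[y, x]" "- 1"] xy by auto
qed

lemma word_class_square:
  assumes x: "x \<in> nichols_gens m"
  shows "word_class [x, x] = (if x = GK then 1 else 0) \<odot>\<^bsub>A\<^esub> word_class []"
proof -
  have "Poly_Mapping.single (Word [x, x]) 1 - Poly_Mapping.single 0 (if x = GK then 1 else 0 :: complex)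
      = (if x = GK then gen GK * gen GK - 1 else gen x * gen x)"
    by (simp add: mult_single plus_word_def)
  moreover have "\<dots> \<in> nichols_rels m"
    using x unfolding nichols_gens_def nichols_rels_def by (cases x) auto
  ultimately have "Poly_Mapping.single (Word [x, x]) 1 -
      Poly_Mapping.single 0 (if x = GK then 1 else 0 :: complex) \<in> nichols_ideal m"
    using nichols_rels_subset[of m] by (metis subsetD)
  then have "word_class [x, x] = proj (Poly_Mapping.single 0 (if x = GK then 1 else 0))"
    unfolding word_class_def using x by (subst proj_eq_iff) (auto simp: free_alg_single free_alg_scalar)
  then show ?thesis by (simp add: proj_single[symmetric] zero_word_def)
qed

text \<open>The left \<open>x\<close> travels past the letters of \<open>v\<close>, each swap
  costing a scalar, until it meets the other \<open>x\<close> and the two become a square. The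
  square of an odd generator vanishes, which makes the total scalar zero.\<close>

lemma word_class_sandwich:
  assumes x: "x \<in> nichols_gens m" and v: "set v \<subseteq> nichols_gens m"
  shows "\<exists>s. (x \<noteq> GK \<longrightarrow> s = 0) \<and> word_class (x # v @ [x]) = s \<odot>\<^bsub>A\<^esub> word_class v"
  using v
proof (induction v)
  case Nil
  then show ?case using word_class_square[OF x]
    by (intro exI[of _ "if x = GK then 1 else 0"]) auto
next
  case (Cons y v)
  then obtain s where s: "x \<noteq> GK \<longrightarrow> s = 0" "word_class (x # v @ [x]) = s \<odot>\<^bsub>A\<^esub> word_class v"
    by auto
  have y: "y \<in> nichols_gens m" "set v \<subseteq> nichols_gens m" using Cons by auto
  obtain t where t: "word_class [x, y] = t \<odot>\<^bsub>A\<^esub> word_class [y, x]"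
    using word_class_swap[OF x y(1)] by blast
  have cl: "word_class [y, x] \<in> carrier A" "word_class (v @ [x]) \<in> carrier A"
    "word_class [y] \<in> carrier A" "word_class v \<in> carrier A" "word_class [x] \<in> carrier A"
    using x y by (auto intro!: word_class_closed)
  have "word_class (x # (y # v) @ [x]) = word_class [x, y] \<otimes>\<^bsub>A\<^esub> word_class (v @ [x])"
    using word_class_append[of "[x, y]" "v @ [x]"] x y by simp
  also have "\<dots> = t \<odot>\<^bsub>A\<^esub> (word_class [y, x] \<otimes>\<^bsub>A\<^esub> word_class (v @ [x]))"
    unfolding t using cl by (simp add: A.smult_mult_left)
  also have "word_class [y, x] \<otimes>\<^bsub>A\<^esub> word_class (v @ [x]) = word_class [y] \<otimes>\<^bsub>A\<^esub> word_class (x # v @ [x])"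
    using word_class_append[of "[y, x]" "v @ [x]"] word_class_append[of "[y]" "x # v @ [x]"] x y by simp
  also have "\<dots> = s \<odot>\<^bsub>A\<^esub> word_class (y # v)"
    unfolding s(2) using cl word_class_append[of "[y]" v] y by (simp add: A.smult_mult_right)
  also have "t \<odot>\<^bsub>A\<^esub> (s \<odot>\<^bsub>A\<^esub> word_class (y # v)) = (t * s) \<odot>\<^bsub>A\<^esub> word_class (y # v)"
    using y word_class_closed[of "y # v"] by (simp add: A.smult_assoc)
  finally show ?case using s(1) by (intro exI[of _ "t * s"]) auto
qed

definition degree_xi :: "nichols_gen list \<Rightarrow> nat" where
  "degree_xi w = length (filter (\<lambda>x. x \<noteq> GK) w)"

text \<open>A repeated letter encloses a word, and the sandwich rule removes the pair, shortening
  the word. A pair of odd generators kills the word, while a pair of \<open>GK\<close> does not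
  count towards \<open>degree_xi\<close>. Hence whatever survives keeps its degree.\<close>

lemma word_class_reduce:
  assumes "set w \<subseteq> nichols_gens m"
  shows "word_class w = \<zero>\<^bsub>A\<^esub> \<or> (\<exists>s v. distinct v \<and> set v \<subseteq> nichols_gens m \<and>
    degree_xi v = degree_xi w \<and> word_class w = s \<odot>\<^bsub>A\<^esub> word_class v)"
  using assms
proof (induction w rule: length_induct)
  case (1 w)
  show ?case
  proof (cases "distinct w")
    case True
    then show ?thesis using A.one_smult[OF word_class_closed] 1 by metis
  next
    case False
    then obtain xs ys zs y where w: "w = xs @ [y] @ ys @ [y] @ zs"
      using not_distinct_decomp by blast
    have sets: "set xs \<subseteq> nichols_gens m" "set ys \<subseteq> nichols_gens m" "set zs \<subseteq> nichols_gens m"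
      "y \<in> nichols_gens m"
      using 1 w by auto
    obtain s where s: "y \<noteq> GK \<longrightarrow> s = 0" "word_class (y # ys @ [y]) = s \<odot>\<^bsub>A\<^esub> word_class ys"
      using word_class_sandwich[OF sets(4,2)] by blast
    note cl = sets(1-3)[THEN word_class_closed]
    let ?v = "xs @ ys @ zs"
    have vc: "word_class ?v \<in> carrier A" using sets by (intro word_class_closed) auto
    have "word_class w = word_class xs \<otimes>\<^bsub>A\<^esub> (word_class (y # ys @ [y]) \<otimes>\<^bsub>A\<^esub> word_class zs)"
      using word_class_append[of xs "(y # ys @ [y]) @ zs"] word_class_append[of "y # ys @ [y]" zs] sets w
      by simp
    also have "\<dots> = s \<odot>\<^bsub>A\<^esub> word_class ?v"
      unfolding s(2) using cl sets
      by (simp add: A.smult_mult_left A.smult_mult_right word_class_append)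
    finally have eq: "word_class w = s \<odot>\<^bsub>A\<^esub> word_class ?v" .
    show ?thesis
    proof (cases "y = GK")
      case False
      then show ?thesis using eq s(1) vc by (simp add: A.zero_smult)
    next
      case True
      have "word_class ?v = \<zero>\<^bsub>A\<^esub> \<or> (\<exists>s v. distinct v \<and> set v \<subseteq> nichols_gens m \<and>
          degree_xi v = degree_xi ?v \<and> word_class ?v = s \<odot>\<^bsub>A\<^esub> word_class v)"
        using 1(1) sets w by auto
      moreover have "degree_xi ?v = degree_xi w" using True w by (simp add: degree_xi_def)
      ultimately show ?thesis
        unfolding eq by (metis A.smult_assoc A.smult_zero word_class_closed)
    qed
  qed
qed

lemma degree_xi_distinct:
  assumes "distinct w" "set w \<subseteq> nichols_gens m"
  shows "degree_xi w \<le> m"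
proof -
  have "degree_xi w = card (set (filter (\<lambda>x. x \<noteq> GK) w))"
    using distinct_card[OF distinct_filter[OF assms(1), of "\<lambda>x. x \<noteq> GK"]]
    by (simp add: degree_xi_def)
  also have "\<dots> \<le> card (GXi ` {1..m})"
    using assms(2) by (intro card_mono) (auto simp: nichols_gens_def)
  also have "\<dots> \<le> m" using card_image_le[of "{1..m}" GXi] by simp
  finally show ?thesis .
qed

text \<open>By reduction the words without repeated letters span, and over finitely many generators
  there are finitely many of them.\<close>

lemma fin_dim_nichols: "fin_dim A (regular_module A)"
proof -
  interpret R: left_module A "regular_module A" by (rule A.left_module_regular)
  let ?D = "word_class ` {w. distinct w \<and> set w \<subseteq> nichols_gens m}"
  have "finite {w. set w \<subseteq> nichols_gens m \<and> distinct w}"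
    by (rule finite_subset_distinct) (simp add: nichols_gens_def)
  then have "finite ?D" by (simp add: conj_commute)
  moreover have "?D \<subseteq> carrier (regular_module A)"
    by (auto simp: regular_module_def word_class_closed)
  moreover have "x \<in> coeff_span A.scalars (regular_module A) ?D" if "x \<in> carrier A" for x
    using that
  proof (induction x rule: carrier_induct)
    case zero
    then show ?case using coeff_span.zero[of "regular_module A"] by (simp add: regular_module_def)
  next
    case (add w c x)
    from word_class_reduce[OF add(1)] show ?case
    proof (elim disjE exE conjE)
      assume "word_class w = \<zero>\<^bsub>A\<^esub>"
      then show ?thesis using add by (simp add: A.smult_zero)
    next
      fix s v assume v: "distinct v" "set v \<subseteq> nichols_gens m" "word_class w = s \<odot>\<^bsub>A\<^esub> word_class v"
      have "c \<odot>\<^bsub>A\<^esub> word_class w = ((c * s) \<odot>\<^bsub>A\<^esub> \<one>\<^bsub>A\<^esub>) \<otimes>\<^bsub>A\<^esub> word_class v"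
        unfolding v(3) using v(2) by (simp add: A.smult_assoc word_class_closed A.smult_eq[of "word_class v" "c * s"])
      moreover have "((c * s) \<odot>\<^bsub>A\<^esub> \<one>\<^bsub>A\<^esub>) \<odot>\<^bsub>regular_module A\<^esub> word_class v \<oplus>\<^bsub>regular_module A\<^esub> x
          \<in> coeff_span A.scalars (regular_module A) ?D"
        using v add by (intro coeff_span.step) (auto simp: A.scalars_def)
      ultimately show ?thesis by (simp add: regular_module_def)
    qed
  qed
  ultimately show ?thesis
    unfolding A.fin_dim_iff[OF A.left_module_regular]
    by (intro exI[of _ ?D]) (auto simp: regular_module_def)
qed

subsection \<open>The filtration by the number of odd generators\<close>

text \<open>The \<open>k\<close>-th power of the ideal generated by the odd generators. Degrees are
  counted in arbitrary words, where they add under concatenation, so the filtration is visibly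
  multiplicative.\<close>

definition fil :: "nat \<Rightarrow> (nichols_gen word \<Rightarrow>\<^sub>0 complex) set set" where
  "fil k = coeff_span A.scalars (regular_module A)
    (word_class ` {w. set w \<subseteq> nichols_gens m \<and> k \<le> degree_xi w})"

lemma fil_zero: "\<zero>\<^bsub>A\<^esub> \<in> fil k"
  using coeff_span.zero[of "regular_module A"] by (simp add: fil_def regular_module_def)

lemma fil_step:
  assumes "set w \<subseteq> nichols_gens m" "k \<le> degree_xi w" "x \<in> fil k"
  shows "c \<odot>\<^bsub>A\<^esub> word_class w \<oplus>\<^bsub>A\<^esub> x \<in> fil k"
proof -
  have "(c \<odot>\<^bsub>A\<^esub> \<one>\<^bsub>A\<^esub>) \<odot>\<^bsub>regular_module A\<^esub> word_class w \<oplus>\<^bsub>regular_module A\<^esub> x \<in> fil k"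
    unfolding fil_def
    by (rule coeff_span.step) (use assms in \<open>auto simp: A.scalars_def fil_def\<close>)
  then show ?thesis
    using A.smult_eq[OF word_class_closed[OF assms(1)], of c] by (simp add: regular_module_def)
qed

lemma fil_induct [consumes 1, case_names zero step]:
  assumes "x \<in> fil k" and "P \<zero>\<^bsub>A\<^esub>"
    and "\<And>w c x. set w \<subseteq> nichols_gens m \<Longrightarrow> k \<le> degree_xi w \<Longrightarrow> x \<in> fil k \<Longrightarrow> P x \<Longrightarrow>
      P (c \<odot>\<^bsub>A\<^esub> word_class w \<oplus>\<^bsub>A\<^esub> x)"
  shows "P x"
  using assms(1) unfolding fil_def
proof induction
  case zero
  then show ?case using assms(2) by (simp add: regular_module_def)
next
  case (step a s x)
  then obtain c w where a: "a = c \<odot>\<^bsub>A\<^esub> \<one>\<^bsub>A\<^esub>"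
    and w: "set w \<subseteq> nichols_gens m" "k \<le> degree_xi w" "s = word_class w"
    by (auto simp: A.scalars_def)
  have "P (c \<odot>\<^bsub>A\<^esub> word_class w \<oplus>\<^bsub>A\<^esub> x)"
    using step w by (intro assms(3)) (auto simp: fil_def)
  then show ?case
    using A.smult_eq[OF word_class_closed[OF w(1)], of c] by (simp add: regular_module_def a w(3))
qed

lemma fil_closed: "x \<in> fil k \<Longrightarrow> x \<in> carrier A"
  by (induction rule: fil_induct) (auto simp: A.smult_closed word_class_closed)

lemma fil_add: "x \<in> fil k \<Longrightarrow> y \<in> fil k \<Longrightarrow> x \<oplus>\<^bsub>A\<^esub> y \<in> fil k"
proof (induction x rule: fil_induct)
  case zero
  then show ?case by (simp add: fil_closed)
next
  case (step w c x)
  then show ?case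
    using fil_step[of w k "x \<oplus>\<^bsub>A\<^esub> y" c]
    by (simp add: A.a_assoc A.smult_closed word_class_closed fil_closed)
qed

lemma fil_mult:
  assumes x: "x \<in> fil j" and y: "y \<in> fil k"
  shows "x \<otimes>\<^bsub>A\<^esub> y \<in> fil (j + k)"
  using x
proof (induction rule: fil_induct)
  case zero
  then show ?case using y by (simp add: fil_closed fil_zero)
next
  case (step v c x)
  have "(c \<odot>\<^bsub>A\<^esub> word_class v) \<otimes>\<^bsub>A\<^esub> y \<in> fil (j + k)"
    using y
  proof (induction rule: fil_induct)
    case zero
    then show ?case using step by (simp add: A.smult_closed word_class_closed fil_zero)
  next
    case (step w d y)
    have "(c \<odot>\<^bsub>A\<^esub> word_class v) \<otimes>\<^bsub>A\<^esub> (d \<odot>\<^bsub>A\<^esub> word_class w \<oplus>\<^bsub>A\<^esub> y) =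
        (d * c) \<odot>\<^bsub>A\<^esub> word_class (v @ w) \<oplus>\<^bsub>A\<^esub> (c \<odot>\<^bsub>A\<^esub> word_class v) \<otimes>\<^bsub>A\<^esub> y"
      using step \<open>set v \<subseteq> nichols_gens m\<close>
      by (simp add: A.r_distr A.smult_closed word_class_closed fil_closed A.smult_mult_left
        A.smult_mult_right A.smult_assoc word_class_append)
    moreover have "\<dots> \<in> fil (j + k)"
      using step \<open>set v \<subseteq> nichols_gens m\<close> \<open>j \<le> degree_xi v\<close>
      by (intro fil_step) (auto simp: degree_xi_def)
    ultimately show ?case by simp
  qed
  then show ?case
    using step y by (simp add: A.l_distr A.smult_closed word_class_closed fil_closed fil_add)
qed

text \<open>Reduction preserves the degree, and a word without repetitions contains at most
  \<open>m\<close> odd generators; so every word of larger degree has class zero.\<close>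

lemma fil_vanishes: "x \<in> fil k \<Longrightarrow> m < k \<Longrightarrow> x = \<zero>\<^bsub>A\<^esub>"
proof (induction rule: fil_induct)
  case (step w c x)
  then have "word_class w = \<zero>\<^bsub>A\<^esub>"
    using word_class_reduce[OF step(1)] degree_xi_distinct by fastforce
  then show ?case using step by (simp add: A.smult_zero)
qed simp

lemma fil_power: "x \<in> fil 1 \<Longrightarrow> x [^]\<^bsub>A\<^esub> n \<in> fil n"
proof (induction n)
  case 0
  have "1 \<odot>\<^bsub>A\<^esub> word_class [] \<oplus>\<^bsub>A\<^esub> \<zero>\<^bsub>A\<^esub> \<in> fil 0"
    by (rule fil_step) (auto simp: fil_zero)
  then show ?case by (simp add: word_class_Nil A.one_smult)
next
  case (Suc n)
  then show ?case using fil_mult[of "x [^]\<^bsub>A\<^esub> n" n x 1] by simp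
qed

lemma chi_fil: "x \<in> fil 1 \<Longrightarrow> chi r x = 0"
proof (induction rule: fil_induct)
  case zero
  then show ?case using chi_add[of "\<zero>\<^bsub>A\<^esub>" "\<zero>\<^bsub>A\<^esub>" r] by simp
next
  case (step w c x)
  then have "filter (\<lambda>x. x \<noteq> GK) w \<noteq> []" by (auto simp: degree_xi_def)
  then have "\<exists>y\<in>set w. y \<noteq> GK" by (simp add: filter_empty_conv)
  then have "prod_list (map (chi_gen r) w) = 0"
    by (auto simp: prod_list_zero_iff chi_gen_def)
  then show ?case
    using step by (simp add: chi_add chi_smult chi_word_class A.smult_closed word_class_closed fil_closed)
qed

text \<open>Modulo \<open>fil 1\<close> only words in \<open>GK\<close> remain, and these reduce to
  the empty word or to \<open>[GK]\<close>.\<close>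

lemma decompose_mod_fil:
  assumes "x \<in> carrier A"
  shows "\<exists>a b. \<exists>y\<in>fil 1. x = a \<odot>\<^bsub>A\<^esub> \<one>\<^bsub>A\<^esub> \<oplus>\<^bsub>A\<^esub> (b \<odot>\<^bsub>A\<^esub> word_class [GK] \<oplus>\<^bsub>A\<^esub> y)"
  using assms
proof (induction rule: carrier_induct)
  case zero
  have "word_class [GK] \<in> carrier A" by (rule word_class_closed) (simp add: nichols_gens_def)
  then show ?case
    by (intro exI[of _ 0] bexI[of _ "\<zero>\<^bsub>A\<^esub>"]) (auto simp: A.zero_smult fil_zero)
next
  case (add w c x)
  then obtain a b y where y: "y \<in> fil 1"
    and x: "x = a \<odot>\<^bsub>A\<^esub> \<one>\<^bsub>A\<^esub> \<oplus>\<^bsub>A\<^esub> (b \<odot>\<^bsub>A\<^esub> word_class [GK] \<oplus>\<^bsub>A\<^esub> y)" by blast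
  have K: "word_class [GK] \<in> carrier A" by (rule word_class_closed) (simp add: nichols_gens_def)
  note cl = K A.smult_closed fil_closed[OF y] word_class_closed[OF add(1)]
  show ?case
  proof (cases "degree_xi w = 0")
    case False
    then have "c \<odot>\<^bsub>A\<^esub> word_class w \<oplus>\<^bsub>A\<^esub> y \<in> fil 1" using fil_step[OF add(1) _ y] by simp
    moreover have "c \<odot>\<^bsub>A\<^esub> word_class w \<oplus>\<^bsub>A\<^esub> x =
        a \<odot>\<^bsub>A\<^esub> \<one>\<^bsub>A\<^esub> \<oplus>\<^bsub>A\<^esub> (b \<odot>\<^bsub>A\<^esub> word_class [GK] \<oplus>\<^bsub>A\<^esub> (c \<odot>\<^bsub>A\<^esub> word_class w \<oplus>\<^bsub>A\<^esub> y))"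
      unfolding x using cl by (simp add: A.a_lcomm)
    ultimately show ?thesis by blast
  next
    case True
    from word_class_reduce[OF add(1)] show ?thesis
    proof (elim disjE exE conjE)
      assume "word_class w = \<zero>\<^bsub>A\<^esub>"
      then show ?thesis using add by (simp add: A.smult_zero)
    next
      fix s v assume v: "distinct v" "degree_xi v = degree_xi w"
        "word_class w = s \<odot>\<^bsub>A\<^esub> word_class v"
      have "set v \<subseteq> {GK}" using v(2) True by (auto simp: degree_xi_def filter_empty_conv)
      then have "card (set v) \<le> 1" using card_mono[of "{GK}" "set v"] by simp
      then have "length v \<le> 1" using v(1) by (simp add: distinct_card)
      then have "v = [] \<or> v = [GK]" using \<open>set v \<subseteq> {GK}\<close> by (cases v) auto
      then show ?thesis
      proof
        assume "v = []"
        then have "c \<odot>\<^bsub>A\<^esub> word_class w = (c * s) \<odot>\<^bsub>A\<^esub> \<one>\<^bsub>A\<^esub>"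
          using v(3) by (simp add: word_class_Nil A.smult_assoc)
        then have "c \<odot>\<^bsub>A\<^esub> word_class w \<oplus>\<^bsub>A\<^esub> x =
            (c * s + a) \<odot>\<^bsub>A\<^esub> \<one>\<^bsub>A\<^esub> \<oplus>\<^bsub>A\<^esub> (b \<odot>\<^bsub>A\<^esub> word_class [GK] \<oplus>\<^bsub>A\<^esub> y)"
          unfolding x using cl by (simp add: A.scalar_add A.a_assoc)
        then show ?thesis using y by blast
      next
        assume "v = [GK]"
        then have "c \<odot>\<^bsub>A\<^esub> word_class w = (c * s) \<odot>\<^bsub>A\<^esub> word_class [GK]"
          using v(3) K by (simp add: A.smult_assoc)
        then have "c \<odot>\<^bsub>A\<^esub> word_class w \<oplus>\<^bsub>A\<^esub> x =
            a \<odot>\<^bsub>A\<^esub> \<one>\<^bsub>A\<^esub> \<oplus>\<^bsub>A\<^esub> ((c * s + b) \<odot>\<^bsub>A\<^esub> word_class [GK] \<oplus>\<^bsub>A\<^esub> y)"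
          unfolding x using cl by (simp add: A.smult_add_left A.a_assoc A.a_lcomm)
        then show ?thesis using y by blast
      qed
    qed
  qed
qed

text \<open>The characters take the values \<open>a + b\<close> and \<open>a - b\<close> on an
  element with coefficients \<open>a\<close> of the unit and \<open>b\<close> of K modulo
  \<open>fil 1\<close>. If both values vanish, so do \<open>a\<close> and \<open>b\<close>.\<close>

lemma ker_chi_fil:
  assumes x: "x \<in> carrier A" and chi: "\<And>r. chi r x = 0"
  shows "x \<in> fil 1"
proof -
  obtain a b y where y: "y \<in> fil 1"
    and eq: "x = a \<odot>\<^bsub>A\<^esub> \<one>\<^bsub>A\<^esub> \<oplus>\<^bsub>A\<^esub> (b \<odot>\<^bsub>A\<^esub> word_class [GK] \<oplus>\<^bsub>A\<^esub> y)"
    using decompose_mod_fil[OF x] by blast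
  have K: "set [GK] \<subseteq> nichols_gens m" by (simp add: nichols_gens_def)
  note cl = word_class_closed[OF K] A.smult_closed fil_closed[OF y]
  have "chi r \<one>\<^bsub>A\<^esub> = 1" for r
    using chi_word_class[of "[]" r] by (simp add: word_class_Nil)
  then have "chi r x = a + b * (if r then - 1 else 1)" for r
    unfolding eq using cl K chi_fil[OF y, of r]
    by (simp add: chi_add chi_smult chi_word_class chi_gen_def)
  from this[of False] this[of True] have "a = 0" "b = 0" using chi by (auto simp: add_eq_0_iff2)
  then show ?thesis using eq y cl by (simp add: A.zero_smult)
qed

text \<open>The case treated separately is nilpotency in the corners. From \<open>a = a e r\<close>
  the other character vanishes on \<open>a\<close>, so \<open>chi r a = 0\<close> puts
  \<open>a\<close> into \<open>fil 1\<close>. Its power with exponent \<open>Suc m\<close> then lies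
  in a vanishing step of the filtration.\<close>

sublocale two_vertex_algebra A e chi
proof (unfold_locales, goal_cases)
  case (9 a r)
  have "chi s a = 0" for s
  proof (cases "s = r")
    case False
    have "chi s a = chi s a * chi s (e r)"
      using 9 chi_mult[of a "e r" s] e_closed by simp
    then show ?thesis using False chi_e by simp
  qed (use 9 in simp)
  then have "a \<in> fil 1" using 9 ker_chi_fil by blast
  then have "a [^]\<^bsub>A\<^esub> Suc m = \<zero>\<^bsub>A\<^esub>" using fil_power fil_vanishes by blast
  then show ?case by blast
qed (use fin_dim_nichols e_closed e_idem e_sum chi_add chi_mult chi_e chi_smult[of "\<one>\<^bsub>A\<^esub>"]
  chi_word_class[of "[]"] in \<open>auto simp: word_class_Nil\<close>)

end

theorem proposition2p1:
  fixes m :: nat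
  assumes "m \<ge> 1"
  shows "(\<exists>Ps. full_list_indec_proj (nichols m) Ps) \<and>
         (\<forall>Ps. full_list_indec_proj (nichols m) Ps \<longrightarrow>
            alg_iso (proj_auslander_alg (nichols m) Ps) (nichols m))"
proof -
  interpret nichols_algebra m .
  have "alg_iso (End_alg A (direct_sum Ps)) A" if "full_list_indec_proj A Ps" for Ps
  proof -
    obtain u where "principal_module A (direct_sum Ps) \<one>\<^bsub>A\<^esub> u"
      using full_list_direct_sum_principal(2)[OF \<open>full_list_indec_proj A Ps\<close>] by blast
    then show ?thesis
      by (rule A.End_alg_iso[OF full_list_direct_sum_principal(1)[OF that] _ anti_properties])
  qed
  then show ?thesis
    using full_list_exists by (simp add: nichols_eq proj_auslander_alg_def)
qed


end
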